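(* Assume the spectral gap, removable singularity, quadratic degeneracy, $a$-regularity, $b$-regularity and unitary transfer conditions stated in the context. Then there is a positive constant $C_{12}$ independent of $\varepsilon$ such that for all $0<\varepsilon<1$ $$\mathrm{dist}_H\Big(\bigcup_{\theta\in\Theta}\mathrm{Sp}\,\mathcal L_{\varepsilon,\theta}^{-1}\cup\{0\}\,,\ \bigcup_{\xi\in\mathbb R^n}\mathrm{Sp}\,\mathbb L_\xi^{-1}\cup\{0\}\Big)\le C_{12}\,\varepsilon,$$ where for non-empty $X,Y\subset\mathbb R$, $\mathrm{dist}_H(X,Y):=\max\big(\sup_{x\in X}\mathrm{dist}(x,Y),\ \sup_{y\in Y}\mathrm{dist}(y,X)\big)$.
   Context: $\mathrm{Sp}$ denotes the spectrum. $H$ is a separable complex Hilbert space, $n\ge 1$, $\Theta\subset\mathbb R^n$ is compact and connected with $0$ an interior point, and for each $\theta\in\Theta$, $a_\theta$ and $b_\theta$ are non-negative sesquilinear forms on $H\times H$. For a sesquilinear form $\mathfrak b$ write $\mathfrak b[u]:=\mathfrak b(u,u)$. Standing assumptions: for each $\theta$, $(u,\tilde u)_\theta:=a_\theta(u,\tilde u)+b_\theta(u,\tilde u)$ is an inner product on $H$ equivalent to the original one, with norm $\|\cdot\|_\theta$; there is $K>0$ with $\|u\|_{\theta_1}\le K\|u\|_{\theta_2}$ for all $u\in H$, $\theta_1,\theta_2\in\Theta$; there is $L_a>0$ with $|a_{\theta_1}(u,\tilde u)-a_{\theta_2}(u,\tilde u)|\le L_a|\theta_1-\theta_2|\,\|u\|_{\theta_1}\|\tilde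 u\|_{\theta_1}$ for all $u,\tilde u\in H$, $\theta_1,\theta_2\in\Theta$. $V_\theta:=\{v\in H: a_\theta[v]=0\}$ (a closed subspace), $W_\theta:=\{w\in H:(w,v)_\theta=0\ \forall v\in V_\theta\}$. Spectral gap condition: for every $\theta\in\Theta$ there is $\nu_\theta>0$ with $a_\theta[w]\ge\nu_\theta\|w\|_\theta^2$ for all $w\in W_\theta$. Removable singularity condition: there are a closed subspace $V_\star\subset H$ and $L_\star\ge0$ such that, with $V^\star_\theta:=V_\theta$ for $\theta\ne0$ and $V^\star_0:=V_\star$, one has $\inf_{v_2\in V^\star_{\theta_2}}\|v_1-v_2\|_{\theta_2}\le L_\star|\theta_1-\theta_2|\,\|v_1\|_{\theta_1}$ for all $v_1\in V^\star_{\theta_1}$, $\theta_1,\theta_2\in\Theta$. (Then $V_\star\subset V_0$.) $Z$ is a fixed closed subspace of $V_0$ with $V_0=V_\star\dot+Z$ (direct sum) and, for some $0\le K_Z<1$, $|(v_\star,z)_0|\le K_Z\|v_\star\|_0\|z\|_0$ for all $v_\star\in V_\star$, $z\in Z$. Quadratic degeneracy: there is $\gamma>0$ with $a_\theta[w]\ge\gamma|\theta|^2\|w\|_\theta^2$ for all $w\in W_\theta$, $\theta\in\Theta$. $a$-regularity: there exist sesquilinear maps $a_0':V_0\times H\to\mathbb C^n$, $a_0'':V_0\times V_0\to\mathbb C^{n\times n}$ and constants $K_{a'},K_{a''}\ge0$ with $|a_\theta(v,u)-a_0'(v,u)\cdot\theta|\le K_{a'}|\theta|^2\|v\|_0\|u\|_0$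 for all $v\in V_0,u\in H,\theta\in\Theta$, and $|a_\theta(v,\tilde v)-a_0''(v,\tilde v)\theta\cdot\theta|\le K_{a''}|\theta|^3\|v\|_0\|\tilde v\|_0$ for all $v,\tilde v\in V_0$, $\theta\in\Theta$. $b$-regularity: there is $L_b\ge0$ with $|b_\theta(v,\tilde v)-b_0(v,\tilde v)|\le L_b|\theta|\,\|v\|_0\|\tilde v\|_\theta$ for all $v,\tilde v\in V_0$, $\theta\in\Theta$. Homogenised form: for $\theta\in\mathbb R^n$, $N_\theta:V_0\to W_0$ is the linear map such that $N_\theta v$ is the unique solution in $W_0$ of $a_0(N_\theta v,\tilde w_0)=-a_0'(v,\tilde w_0)\cdot\theta$ for all $\tilde w_0\in W_0$; and $a^{\rm h}_\theta(v,\tilde v):=a_0''(v,\tilde v)\theta\cdot\theta-a_0(N_\theta v,N_\theta\tilde v)$ for $v,\tilde v\in V_0$, $\theta\in\mathbb R^n$. Ambient space: $\mathcal H$ is a complex separable Hilbert space with a family of equivalent inner products $d_\theta$, $\theta\in\Theta$, such that $d_{\theta_1}[u]\le K_d\,d_{\theta_2}[u]$ for some $K_d>0$ and all $u,\theta_1,\theta_2$; $H$ is a compactly embedded dense subset of $\mathcal H$; and $d_\theta[u]\le b_\theta[u]$ for all $u\in H$, $\theta\in\Theta$. $\mathcal L_{\varepsilon,\theta}$ is the self-adjoint operator in $(\mathcal H,d_\theta)$ generated by the closed form $\varepsilon^{-2}a_\theta+b_\theta$ with form domain $H$. $\mathcal H_0$ is the closure of $V_\star\dot+Z$ in $\mathcal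 H$, equipped with $d_0$. For $\xi\in\mathbb R^n$, $\mathbb L_\xi$ is the self-adjoint operator in $\mathcal H_0$ generated by the form $\mathbb S_\xi(v+z,\tilde v+\tilde z):=a^{\rm h}_\xi(z,\tilde z)+b_0(v+z,\tilde v+\tilde z)$ with form domain $V_\star\dot+Z$. Unitary transfer condition: there are linear bijections $\mathcal E_\theta:V_\star\to V_\theta^\star$, $\theta\in\Theta$, with $b_\theta(\mathcal E_\theta v,\mathcal E_\theta\tilde v)=b_0(v,\tilde v)$ for all $v,\tilde v\in V_\star$ and $|b_\theta(\mathcal E_\theta v,z)-b_0(v,z)|\le K_b|\theta|\|v\|_0\|z\|_0$ for all $v\in V_\star,z\in Z$ ($K_b\ge0$ independent of $\theta$), which extend to bijections of $\mathcal H$ (again denoted $\mathcal E_\theta$) satisfying $d_\theta(\mathcal E_\theta u,\mathcal E_\theta\tilde u)=d_0(u,\tilde u)$ for all $u,\tilde u\in\mathcal H$, $\mathcal E_0=I$, and $\|\mathcal E_{\theta_1}-\mathcal E_{\theta_2}\|_{(\mathcal H,d_0)\to(\mathcal H,d_{\theta_1})}\le K_e|\theta_1-\theta_2|$ for all $\theta_1,\theta_2\in\Theta$ and some $K_e\ge0$. *)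

theory Defs
  imports "HOL-Analysis.Analysis"
begin

section \<open>Complex vector spaces, forms and inner products on subspaces\<close>

class scaleC =
  fixes scaleC :: "complex \<Rightarrow> 'a \<Rightarrow> 'a"  (infixr \<open>*\<^sub>C\<close> 75)

class complex_vector = scaleC + ab_group_add +
  assumes scaleC_add_right: "c *\<^sub>C (x + y) = c *\<^sub>C x + c *\<^sub>C y"
    and scaleC_add_left: "(c + c') *\<^sub>C x = c *\<^sub>C x + c' *\<^sub>C x"
    and scaleC_scaleC: "c *\<^sub>C (c' *\<^sub>C x) = (c * c') *\<^sub>C x"
    and scaleC_one: "1 *\<^sub>C x = x"

global_interpretation complex_vector: vector_space "scaleC :: complex \<Rightarrow> 'a \<Rightarrow> 'a::complex_vector"
  by standard (simp_all add: scaleC_add_right scaleC_add_left scaleC_scaleC scaleC_one)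

text \<open>
  Forms are functions on the whole type of which only the values on the relevant subspaces matter.
  Sesquilinear means linear in the first and conjugate-linear in the second argument.
\<close>

definition sesquilinear_on ::
    "'a::complex_vector set \<Rightarrow> 'a set \<Rightarrow> ('a \<Rightarrow> 'a \<Rightarrow> complex) \<Rightarrow> bool" where
  "sesquilinear_on S T q \<longleftrightarrow>
     (\<forall>u\<in>S. \<forall>u'\<in>S. \<forall>v\<in>T. q (u + u') v = q u v + q u' v) \<and>
     (\<forall>c. \<forall>u\<in>S. \<forall>v\<in>T. q (c *\<^sub>C u) v = c * q u v) \<and>
     (\<forall>u\<in>S. \<forall>v\<in>T. \<forall>v'\<in>T. q u (v + v') = q u v + q u v') \<and>
     (\<forall>c. \<forall>u\<in>S. \<forall>v\<in>T. q u (c *\<^sub>C v) = cnj c * q u v)"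

definition nonneg_form_on :: "'a::complex_vector set \<Rightarrow> ('a \<Rightarrow> 'a \<Rightarrow> complex) \<Rightarrow> bool" where
  "nonneg_form_on S q \<longleftrightarrow> sesquilinear_on S S q \<and> (\<forall>u\<in>S. q u u \<in> \<real> \<and> 0 \<le> Re (q u u))"

text \<open>The quadratic form; it is only used for forms that are real on the diagonal.\<close>

definition qf :: "('a \<Rightarrow> 'a \<Rightarrow> complex) \<Rightarrow> 'a \<Rightarrow> real" where
  "qf q u = Re (q u u)"

definition form_norm :: "('a \<Rightarrow> 'a \<Rightarrow> complex) \<Rightarrow> 'a \<Rightarrow> real" where
  "form_norm q u = sqrt (qf q u)"

definition inner_product_on :: "'a::complex_vector set \<Rightarrow> ('a \<Rightarrow> 'a \<Rightarrow> complex) \<Rightarrow> bool" where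
  "inner_product_on S q \<longleftrightarrow>
     complex_vector.subspace S \<and> nonneg_form_on S q \<and>
     (\<forall>u\<in>S. \<forall>v\<in>S. q v u = cnj (q u v)) \<and>
     (\<forall>u\<in>S. q u u = 0 \<longrightarrow> u = 0)"

text \<open>
  The locale \<^locale>\<open>Metric_space\<close> wants a function that is non-negative and symmetric on the whole
  type, hence the value \<open>0\<close> off the carrier.
\<close>

definition form_dist ::
    "'a::complex_vector set \<Rightarrow> ('a \<Rightarrow> 'a \<Rightarrow> complex) \<Rightarrow> 'a \<Rightarrow> 'a \<Rightarrow> real" where
  "form_dist S q x y = (if x \<in> S \<and> y \<in> S then form_norm q (x - y) else 0)"

definition form_topology ::
    "'a::complex_vector set \<Rightarrow> ('a \<Rightarrow> 'a \<Rightarrow> complex) \<Rightarrow> 'a topology" where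
  "form_topology S q = Metric_space.mtopology S (form_dist S q)"

definition separable_hilbert_on :: "'a::complex_vector set \<Rightarrow> ('a \<Rightarrow> 'a \<Rightarrow> complex) \<Rightarrow> bool" where
  "separable_hilbert_on S q \<longleftrightarrow>
     inner_product_on S q \<and> Metric_space.mcomplete S (form_dist S q) \<and>
     separable_space (form_topology S q)"

definition equivalent_inner_product_on ::
    "'a::complex_vector set \<Rightarrow> ('a \<Rightarrow> 'a \<Rightarrow> complex) \<Rightarrow> ('a \<Rightarrow> 'a \<Rightarrow> complex) \<Rightarrow> bool" where
  "equivalent_inner_product_on S p q \<longleftrightarrow>
     inner_product_on S q \<and>
     (\<exists>c>0. \<exists>C>0. \<forall>u\<in>S. c * form_norm p u \<le> form_norm q u \<and> form_norm q u \<le> C * form_norm p u)"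

definition closed_subspace_on ::
    "'a::complex_vector set \<Rightarrow> ('a \<Rightarrow> 'a \<Rightarrow> complex) \<Rightarrow> 'a set \<Rightarrow> bool" where
  "closed_subspace_on S q V \<longleftrightarrow> complex_vector.subspace V \<and> closedin (form_topology S q) V"

definition linear_on_set :: "'a::complex_vector set \<Rightarrow> ('a \<Rightarrow> 'a) \<Rightarrow> bool" where
  "linear_on_set S f \<longleftrightarrow>
     (\<forall>u\<in>S. \<forall>v\<in>S. f (u + v) = f u + f v) \<and> (\<forall>c. \<forall>u\<in>S. f (c *\<^sub>C u) = c *\<^sub>C f u)"


section \<open>Operators generated by forms, spectrum, Hausdorff distance\<close>

text \<open>
  Operators in a Hilbert space \<open>(X, d)\<close> are represented by their graphs, so that the inverse of an
  operator is the converse of its graph.  The operator generated by a form \<open>q\<close> with form domain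
  \<open>D\<close> has as domain all \<open>u \<in> D\<close> for which \<open>q u\<close> is represented on \<open>D\<close> by some \<open>f \<in> X\<close>, to which
  it maps \<open>u\<close>.
\<close>

definition form_operator ::
    "'a set \<Rightarrow> ('a \<Rightarrow> 'a \<Rightarrow> complex) \<Rightarrow> 'a set \<Rightarrow> ('a \<Rightarrow> 'a \<Rightarrow> complex) \<Rightarrow> ('a \<times> 'a) set" where
  "form_operator X d D q = {(u, f). u \<in> D \<and> f \<in> X \<and> (\<forall>w\<in>D. q u w = d f w)}"

text \<open>
  \<open>c\<close> is in the resolvent set of an operator \<open>T\<close> in \<open>(X, d)\<close> iff \<open>T - c\<close> maps the domain of \<open>T\<close>
  bijectively onto \<open>X\<close> and has a bounded inverse; \<open>(u, f + c u) \<in> T\<close> says \<open>(T - c) u = f\<close>.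
\<close>

definition resolvent_set ::
    "'a::complex_vector set \<Rightarrow> ('a \<Rightarrow> 'a \<Rightarrow> complex) \<Rightarrow> ('a \<times> 'a) set \<Rightarrow> complex set" where
  "resolvent_set X d T =
     {c. (\<forall>f\<in>X. \<exists>!u. (u, f + c *\<^sub>C u) \<in> T) \<and>
         (\<exists>C. \<forall>f\<in>X. \<forall>u. (u, f + c *\<^sub>C u) \<in> T \<longrightarrow> form_norm d u \<le> C * form_norm d f)}"

definition spectrum ::
    "'a::complex_vector set \<Rightarrow> ('a \<Rightarrow> 'a \<Rightarrow> complex) \<Rightarrow> ('a \<times> 'a) set \<Rightarrow> complex set" where
  "spectrum X d T = - resolvent_set X d T"

text \<open>
  Extended-real valued, so that no boundedness has to be presupposed.  The spectra to which it is
  applied are those of self-adjoint operators, hence real; as subsets of the complex plane they have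
  the same Hausdorff distance.
\<close>

definition hausdorff_distance :: "'a::metric_space set \<Rightarrow> 'a set \<Rightarrow> ereal" where
  "hausdorff_distance X Y =
     max (SUP x\<in>X. ereal (infdist x Y)) (SUP y\<in>Y. ereal (infdist y X))"


section \<open>The family of forms\<close>

definition sum_form ::
    "('p \<Rightarrow> 'a \<Rightarrow> 'a \<Rightarrow> complex) \<Rightarrow> ('p \<Rightarrow> 'a \<Rightarrow> 'a \<Rightarrow> complex) \<Rightarrow> 'p \<Rightarrow> 'a \<Rightarrow> 'a \<Rightarrow> complex" where
  "sum_form a b \<theta> u v = a \<theta> u v + b \<theta> u v"

locale form_family =
  fixes ipH :: "'a::complex_vector \<Rightarrow> 'a \<Rightarrow> complex"
    and H :: "'a set"
    and \<Theta> :: "(real ^ 'n) set"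
    and a b :: "real ^ 'n \<Rightarrow> 'a \<Rightarrow> 'a \<Rightarrow> complex"
  assumes H_hilbert: "separable_hilbert_on H ipH"
    and Theta: "compact \<Theta>" "connected \<Theta>" "0 \<in> interior \<Theta>"
    and a_nonneg: "\<And>\<theta>. \<theta> \<in> \<Theta> \<Longrightarrow> nonneg_form_on H (a \<theta>)"
    and b_nonneg: "\<And>\<theta>. \<theta> \<in> \<Theta> \<Longrightarrow> nonneg_form_on H (b \<theta>)"
    and sum_equivalent: "\<And>\<theta>. \<theta> \<in> \<Theta> \<Longrightarrow> equivalent_inner_product_on H ipH (sum_form a b \<theta>)"
    and norms_comparable: "\<exists>K>0. \<forall>u\<in>H. \<forall>\<theta>\<^sub>1\<in>\<Theta>. \<forall>\<theta>\<^sub>2\<in>\<Theta>.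
      form_norm (sum_form a b \<theta>\<^sub>1) u \<le> K * form_norm (sum_form a b \<theta>\<^sub>2) u"
    and a_lipschitz: "\<exists>L>0. \<forall>u\<in>H. \<forall>v\<in>H. \<forall>\<theta>\<^sub>1\<in>\<Theta>. \<forall>\<theta>\<^sub>2\<in>\<Theta>.
      cmod (a \<theta>\<^sub>1 u v - a \<theta>\<^sub>2 u v) \<le>
        L * norm (\<theta>\<^sub>1 - \<theta>\<^sub>2) * form_norm (sum_form a b \<theta>\<^sub>1) u * form_norm (sum_form a b \<theta>\<^sub>1) v"

text \<open>
  The ambient Hilbert space is the whole type, with original inner product \<open>ip\<close>; \<open>H\<close> is a linear
  subspace of it.  Compactness of the embedding: the unit ball of \<open>H\<close> is relatively compact.
\<close>

locale ambient_form_family = form_family ipH H \<Theta> a b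
  for ipH :: "'a::complex_vector \<Rightarrow> 'a \<Rightarrow> complex"
    and H :: "'a set"
    and \<Theta> :: "(real ^ 'n) set"
    and a b :: "real ^ 'n \<Rightarrow> 'a \<Rightarrow> 'a \<Rightarrow> complex" +
  fixes ip :: "'a \<Rightarrow> 'a \<Rightarrow> complex"
    and d :: "real ^ 'n \<Rightarrow> 'a \<Rightarrow> 'a \<Rightarrow> complex"
  assumes ambient_hilbert: "separable_hilbert_on UNIV ip"
    and d_equivalent: "\<And>\<theta>. \<theta> \<in> \<Theta> \<Longrightarrow> equivalent_inner_product_on UNIV ip (d \<theta>)"
    and d_comparable: "\<exists>K>0. \<forall>u. \<forall>\<theta>\<^sub>1\<in>\<Theta>. \<forall>\<theta>\<^sub>2\<in>\<Theta>. qf (d \<theta>\<^sub>1) u \<le> K * qf (d \<theta>\<^sub>2) u"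
    and H_dense: "form_topology UNIV ip closure_of H = UNIV"
    and H_compactly_embedded:
      "compactin (form_topology UNIV ip)
         (form_topology UNIV ip closure_of {u \<in> H. form_norm ipH u \<le> 1})"
    and d_le_b: "\<And>\<theta> u. \<theta> \<in> \<Theta> \<Longrightarrow> u \<in> H \<Longrightarrow> qf (d \<theta>) u \<le> qf (b \<theta>) u"

definition V_space :: "'a set \<Rightarrow> ('p \<Rightarrow> 'a \<Rightarrow> 'a \<Rightarrow> complex) \<Rightarrow> 'p \<Rightarrow> 'a set" where
  "V_space H a \<theta> = {v \<in> H. a \<theta> v v = 0}"

definition W_space ::
    "'a set \<Rightarrow> ('p \<Rightarrow> 'a \<Rightarrow> 'a \<Rightarrow> complex) \<Rightarrow> ('p \<Rightarrow> 'a \<Rightarrow> 'a \<Rightarrow> complex) \<Rightarrow> 'p \<Rightarrow> 'a set" where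
  "W_space H a b \<theta> = {w \<in> H. \<forall>v\<in>V_space H a \<theta>. sum_form a b \<theta> w v = 0}"

definition Vstar_space ::
    "'a set \<Rightarrow> ('p::zero \<Rightarrow> 'a \<Rightarrow> 'a \<Rightarrow> complex) \<Rightarrow> 'a set \<Rightarrow> 'p \<Rightarrow> 'a set" where
  "Vstar_space H a Vs \<theta> = (if \<theta> = 0 then Vs else V_space H a \<theta>)"


section \<open>The hypotheses\<close>

definition spectral_gap ::
    "'a set \<Rightarrow> 'p set \<Rightarrow> ('p \<Rightarrow> 'a \<Rightarrow> 'a \<Rightarrow> complex) \<Rightarrow> ('p \<Rightarrow> 'a \<Rightarrow> 'a \<Rightarrow> complex) \<Rightarrow> bool" where
  "spectral_gap H \<Theta> a b \<longleftrightarrow>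
     (\<forall>\<theta>\<in>\<Theta>. \<exists>\<nu>>0. \<forall>w\<in>W_space H a b \<theta>. qf (a \<theta>) w \<ge> \<nu> * (form_norm (sum_form a b \<theta>) w)\<^sup>2)"

definition removable_singularity ::
    "('a::complex_vector \<Rightarrow> 'a \<Rightarrow> complex) \<Rightarrow> 'a set \<Rightarrow> (real ^ 'n) set \<Rightarrow>
     (real ^ 'n \<Rightarrow> 'a \<Rightarrow> 'a \<Rightarrow> complex) \<Rightarrow> (real ^ 'n \<Rightarrow> 'a \<Rightarrow> 'a \<Rightarrow> complex) \<Rightarrow> 'a set \<Rightarrow> bool" where
  "removable_singularity ipH H \<Theta> a b Vs \<longleftrightarrow>
     closed_subspace_on H ipH Vs \<and>
     (\<exists>L\<ge>0. \<forall>\<theta>\<^sub>1\<in>\<Theta>. \<forall>\<theta>\<^sub>2\<in>\<Theta>. \<forall>v\<^sub>1\<in>Vstar_space H a Vs \<theta>\<^sub>1.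
        (INF v\<^sub>2\<in>Vstar_space H a Vs \<theta>\<^sub>2. form_norm (sum_form a b \<theta>\<^sub>2) (v\<^sub>1 - v\<^sub>2))
          \<le> L * norm (\<theta>\<^sub>1 - \<theta>\<^sub>2) * form_norm (sum_form a b \<theta>\<^sub>1) v\<^sub>1)"

definition sum_space :: "'a::plus set \<Rightarrow> 'a set \<Rightarrow> 'a set" where
  "sum_space Vs Z = {v + z |v z. v \<in> Vs \<and> z \<in> Z}"

definition defect_complement ::
    "('a::complex_vector \<Rightarrow> 'a \<Rightarrow> complex) \<Rightarrow> 'a set \<Rightarrow>
     (real ^ 'n \<Rightarrow> 'a \<Rightarrow> 'a \<Rightarrow> complex) \<Rightarrow> (real ^ 'n \<Rightarrow> 'a \<Rightarrow> 'a \<Rightarrow> complex) \<Rightarrow>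
     'a set \<Rightarrow> 'a set \<Rightarrow> bool" where
  "defect_complement ipH H a b Vs Z \<longleftrightarrow>
     closed_subspace_on H ipH Z \<and>
     V_space H a 0 = sum_space Vs Z \<and> Vs \<inter> Z = {0} \<and>
     (\<exists>K. 0 \<le> K \<and> K < 1 \<and> (\<forall>v\<in>Vs. \<forall>z\<in>Z.
        cmod (sum_form a b 0 v z) \<le>
          K * form_norm (sum_form a b 0) v * form_norm (sum_form a b 0) z))"

definition quadratic_degeneracy ::
    "'a set \<Rightarrow> (real ^ 'n) set \<Rightarrow>
     (real ^ 'n \<Rightarrow> 'a \<Rightarrow> 'a \<Rightarrow> complex) \<Rightarrow> (real ^ 'n \<Rightarrow> 'a \<Rightarrow> 'a \<Rightarrow> complex) \<Rightarrow> bool" where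
  "quadratic_degeneracy H \<Theta> a b \<longleftrightarrow>
     (\<exists>\<gamma>>0. \<forall>\<theta>\<in>\<Theta>. \<forall>w\<in>W_space H a b \<theta>.
        qf (a \<theta>) w \<ge> \<gamma> * (norm \<theta>)\<^sup>2 * (form_norm (sum_form a b \<theta>) w)\<^sup>2)"

definition cvec :: "real ^ 'n \<Rightarrow> complex ^ 'n" where
  "cvec \<theta> = (\<chi> i. complex_of_real (\<theta> $ i))"

text \<open>The dot product of a complex vector with a real one.\<close>

definition cdot :: "complex ^ 'n \<Rightarrow> real ^ 'n \<Rightarrow> complex" where
  "cdot x \<theta> = (\<Sum>i\<in>UNIV. x $ i * complex_of_real (\<theta> $ i))"

definition a_regularity ::
    "'a::complex_vector set \<Rightarrow> (real ^ 'n) set \<Rightarrow>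
     (real ^ 'n \<Rightarrow> 'a \<Rightarrow> 'a \<Rightarrow> complex) \<Rightarrow> (real ^ 'n \<Rightarrow> 'a \<Rightarrow> 'a \<Rightarrow> complex) \<Rightarrow>
     ('a \<Rightarrow> 'a \<Rightarrow> complex ^ 'n) \<Rightarrow> ('a \<Rightarrow> 'a \<Rightarrow> complex ^ 'n ^ 'n) \<Rightarrow> bool" where
  "a_regularity H \<Theta> a b a' a'' \<longleftrightarrow>
     (\<forall>i. sesquilinear_on (V_space H a 0) H (\<lambda>v u. a' v u $ i)) \<and>
     (\<forall>i j. sesquilinear_on (V_space H a 0) (V_space H a 0) (\<lambda>v u. a'' v u $ i $ j)) \<and>
     (\<exists>K\<ge>0. \<forall>v\<in>V_space H a 0. \<forall>u\<in>H. \<forall>\<theta>\<in>\<Theta>.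
        cmod (a \<theta> v u - cdot (a' v u) \<theta>) \<le>
          K * (norm \<theta>)\<^sup>2 * form_norm (sum_form a b 0) v * form_norm (sum_form a b 0) u) \<and>
     (\<exists>K\<ge>0. \<forall>v\<in>V_space H a 0. \<forall>u\<in>V_space H a 0. \<forall>\<theta>\<in>\<Theta>.
        cmod (a \<theta> v u - cdot (a'' v u *v cvec \<theta>) \<theta>) \<le>
          K * (norm \<theta>) ^ 3 * form_norm (sum_form a b 0) v * form_norm (sum_form a b 0) u)"

definition b_regularity ::
    "'a set \<Rightarrow> (real ^ 'n) set \<Rightarrow>
     (real ^ 'n \<Rightarrow> 'a \<Rightarrow> 'a \<Rightarrow> complex) \<Rightarrow> (real ^ 'n \<Rightarrow> 'a \<Rightarrow> 'a \<Rightarrow> complex) \<Rightarrow> bool" where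
  "b_regularity H \<Theta> a b \<longleftrightarrow>
     (\<exists>L\<ge>0. \<forall>v\<in>V_space H a 0. \<forall>u\<in>V_space H a 0. \<forall>\<theta>\<in>\<Theta>.
        cmod (b \<theta> v u - b 0 v u) \<le>
          L * norm \<theta> * form_norm (sum_form a b 0) v * form_norm (sum_form a b \<theta>) u)"

text \<open>
  \<open>E \<theta>\<close> denotes both the bijection from \<open>Vs\<close> and its extension to the ambient space; linearity of
  the extension is a consequence of the isometry property.
\<close>

definition unitary_transfer ::
    "'a::complex_vector set \<Rightarrow> (real ^ 'n) set \<Rightarrow>
     (real ^ 'n \<Rightarrow> 'a \<Rightarrow> 'a \<Rightarrow> complex) \<Rightarrow> (real ^ 'n \<Rightarrow> 'a \<Rightarrow> 'a \<Rightarrow> complex) \<Rightarrow>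
     (real ^ 'n \<Rightarrow> 'a \<Rightarrow> 'a \<Rightarrow> complex) \<Rightarrow> 'a set \<Rightarrow> 'a set \<Rightarrow> (real ^ 'n \<Rightarrow> 'a \<Rightarrow> 'a) \<Rightarrow> bool" where
  "unitary_transfer H \<Theta> a b d Vs Z E \<longleftrightarrow>
     (\<forall>\<theta>\<in>\<Theta>. linear_on_set Vs (E \<theta>) \<and> bij_betw (E \<theta>) Vs (Vstar_space H a Vs \<theta>)) \<and>
     (\<forall>\<theta>\<in>\<Theta>. \<forall>v\<in>Vs. \<forall>v'\<in>Vs. b \<theta> (E \<theta> v) (E \<theta> v') = b 0 v v') \<and>
     (\<exists>K\<ge>0. \<forall>\<theta>\<in>\<Theta>. \<forall>v\<in>Vs. \<forall>z\<in>Z.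
        cmod (b \<theta> (E \<theta> v) z - b 0 v z) \<le>
          K * norm \<theta> * form_norm (sum_form a b 0) v * form_norm (sum_form a b 0) z) \<and>
     (\<forall>\<theta>\<in>\<Theta>. bij (E \<theta>) \<and> (\<forall>u u'. d \<theta> (E \<theta> u) (E \<theta> u') = d 0 u u')) \<and>
     E 0 = id \<and>
     (\<exists>K\<ge>0. \<forall>\<theta>\<^sub>1\<in>\<Theta>. \<forall>\<theta>\<^sub>2\<in>\<Theta>. \<forall>u.
        form_norm (d \<theta>\<^sub>1) (E \<theta>\<^sub>1 u - E \<theta>\<^sub>2 u) \<le> K * norm (\<theta>\<^sub>1 - \<theta>\<^sub>2) * form_norm (d 0) u)"


section \<open>The operators\<close>

definition N_map ::
    "'a set \<Rightarrow> (real ^ 'n \<Rightarrow> 'a \<Rightarrow> 'a \<Rightarrow> complex) \<Rightarrow> (real ^ 'n \<Rightarrow> 'a \<Rightarrow> 'a \<Rightarrow> complex) \<Rightarrow>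
     ('a \<Rightarrow> 'a \<Rightarrow> complex ^ 'n) \<Rightarrow> real ^ 'n \<Rightarrow> 'a \<Rightarrow> 'a" where
  "N_map H a b a' \<theta> v =
     (THE w. w \<in> W_space H a b 0 \<and> (\<forall>w'\<in>W_space H a b 0. a 0 w w' = - cdot (a' v w') \<theta>))"

definition homogenised_form ::
    "'a set \<Rightarrow> (real ^ 'n \<Rightarrow> 'a \<Rightarrow> 'a \<Rightarrow> complex) \<Rightarrow> (real ^ 'n \<Rightarrow> 'a \<Rightarrow> 'a \<Rightarrow> complex) \<Rightarrow>
     ('a \<Rightarrow> 'a \<Rightarrow> complex ^ 'n) \<Rightarrow> ('a \<Rightarrow> 'a \<Rightarrow> complex ^ 'n ^ 'n) \<Rightarrow>
     real ^ 'n \<Rightarrow> 'a \<Rightarrow> 'a \<Rightarrow> complex" where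
  "homogenised_form H a b a' a'' \<theta> v v' =
     cdot (a'' v v' *v cvec \<theta>) \<theta> - a 0 (N_map H a b a' \<theta> v) (N_map H a b a' \<theta> v')"

definition Z_part :: "'a::plus set \<Rightarrow> 'a set \<Rightarrow> 'a \<Rightarrow> 'a" where
  "Z_part Vs Z u = (THE z. z \<in> Z \<and> (\<exists>v\<in>Vs. u = v + z))"

definition S_form ::
    "'a::plus set \<Rightarrow> (real ^ 'n \<Rightarrow> 'a \<Rightarrow> 'a \<Rightarrow> complex) \<Rightarrow> (real ^ 'n \<Rightarrow> 'a \<Rightarrow> 'a \<Rightarrow> complex) \<Rightarrow>
     ('a \<Rightarrow> 'a \<Rightarrow> complex ^ 'n) \<Rightarrow> ('a \<Rightarrow> 'a \<Rightarrow> complex ^ 'n ^ 'n) \<Rightarrow> 'a set \<Rightarrow> 'a set \<Rightarrow>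
     real ^ 'n \<Rightarrow> 'a \<Rightarrow> 'a \<Rightarrow> complex" where
  "S_form H a b a' a'' Vs Z \<xi> u u' =
     homogenised_form H a b a' a'' \<xi> (Z_part Vs Z u) (Z_part Vs Z u') + b 0 u u'"

definition L_op ::
    "'a set \<Rightarrow> (real ^ 'n \<Rightarrow> 'a \<Rightarrow> 'a \<Rightarrow> complex) \<Rightarrow> (real ^ 'n \<Rightarrow> 'a \<Rightarrow> 'a \<Rightarrow> complex) \<Rightarrow>
     (real ^ 'n \<Rightarrow> 'a \<Rightarrow> 'a \<Rightarrow> complex) \<Rightarrow> real \<Rightarrow> real ^ 'n \<Rightarrow> ('a \<times> 'a) set" where
  "L_op H a b d \<epsilon> \<theta> =
     form_operator UNIV (d \<theta>) H (\<lambda>u v. complex_of_real (1 / \<epsilon>\<^sup>2) * a \<theta> u v + b \<theta> u v)"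

definition H0_space ::
    "('a::complex_vector \<Rightarrow> 'a \<Rightarrow> complex) \<Rightarrow> 'a set \<Rightarrow> 'a set \<Rightarrow> 'a set" where
  "H0_space ip Vs Z = form_topology UNIV ip closure_of (sum_space Vs Z)"

definition LL_op ::
    "('a::complex_vector \<Rightarrow> 'a \<Rightarrow> complex) \<Rightarrow> 'a set \<Rightarrow>
     (real ^ 'n \<Rightarrow> 'a \<Rightarrow> 'a \<Rightarrow> complex) \<Rightarrow> (real ^ 'n \<Rightarrow> 'a \<Rightarrow> 'a \<Rightarrow> complex) \<Rightarrow>
     (real ^ 'n \<Rightarrow> 'a \<Rightarrow> 'a \<Rightarrow> complex) \<Rightarrow>
     ('a \<Rightarrow> 'a \<Rightarrow> complex ^ 'n) \<Rightarrow> ('a \<Rightarrow> 'a \<Rightarrow> complex ^ 'n ^ 'n) \<Rightarrow> 'a set \<Rightarrow> 'a set \<Rightarrow>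
     real ^ 'n \<Rightarrow> ('a \<times> 'a) set" where
  "LL_op ip H a b d a' a'' Vs Z \<xi> =
     form_operator (H0_space ip Vs Z) (d 0) (sum_space Vs Z) (S_form H a b a' a'' Vs Z \<xi>)"

end

theory Submission
  imports Defs
begin

text \<open>
  Write \<open>A\<close> for the inverse of \<open>L_op\<close> at \<open>(\<epsilon>, \<theta>)\<close> and \<open>B \<xi>\<close> for the inverse of \<open>LL_op\<close> at \<open>\<xi>\<close>, extended to the
  ambient space.  Both are bounded, self-adjoint solution operators, so the claim reduces to the norm
  estimate \<open>\<parallel>A E\<^sub>\<theta> - E\<^sub>\<theta> B (\<theta>/\<epsilon>)\<parallel> \<le> C \<epsilon>\<close>: since \<open>E\<^sub>\<theta>\<close> is unitary, approximate eigenvectors of one operator are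
  approximate eigenvectors of the other, and a self-adjoint operator has spectrum within distance
  \<open>\<eta>\<close> of any \<open>\<eta>\<close>-approximate eigenvalue.

  For small \<open>\<theta>\<close> the solution of the homogenised problem \<open>v + z \<in> Vs + Z\<close> is inserted as
  \<open>E\<^sub>\<theta> v + z + N\<^sub>\<theta> z\<close> into the form \<open>\<epsilon>\<^sup>-\<^sup>2 a\<^sub>\<theta> + b\<^sub>\<theta>\<close>.  Here \<open>E\<^sub>\<theta> v\<close> is annihilated by \<open>a\<^sub>\<theta>\<close> and carries \<open>b\<^sub>0\<close> to \<open>b\<^sub>\<theta>\<close>
  exactly, while \<open>a\<^sub>\<theta>\<close> agrees with the homogenised form on the corrected \<open>z\<close> up to \<open>|\<theta>|\<^sup>3\<close>.  Coercivity of
  the homogenised form gives \<open>\<parallel>z\<parallel> = O (1 / (1 + |\<theta>/\<epsilon>|\<^sup>2))\<close>, so every error term is \<open>O (\<epsilon>)\<close>.  For \<open>\<theta>\<close> or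
  \<open>\<epsilon> \<xi>\<close> away from \<open>0\<close> both operators are \<open>O (\<epsilon>)\<close>-close to the solution operator of \<open>b\<^sub>0\<close> on \<open>Vs\<close>.
\<close>

section \<open>Forms and the Riesz representation theorem\<close>

text \<open>The obstacle is that the coercivity of \<open>a \<theta>\<close> off its null space
  degenerates as \<theta> tends to 0: for small \<theta> different from 0 the non-zero vectors of
  \<open>Z\<close>, which are null vectors at 0, have left the null space. The energy therefore
  controls the complement of \<open>V \<theta>\<close> only with weight |\<theta>|/\<epsilon>. For
  this reason the error is tested against vectors written as
  \<open>E \<theta> x + T \<theta> z + w\<close>, with the same corrector on the test side as on the
  solution side: \<open>w\<close> is O(\<epsilon>) in terms of the energy and \<open>z\<close> is
  O(\<epsilon> / (\<epsilon> + |\<theta>|)), while \<open>x\<close>, which is merely bounded, is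
  paired only with terms that are small on the solution side.

  Spectra are reached through approximate eigenvectors alone. The slack this costs can be made as
  small as desired and is taken to be \<epsilon>, which adds 1 to the final constant. The point 0
  adjoined to both sets pays for extending the limit operator from the closure of
  \<open>Vs + Z\<close> to the whole ambient space, where only the value 0 can be new.\<close>

locale nonneg_form =
  fixes S :: "'a::complex_vector set" and q :: "'a \<Rightarrow> 'a \<Rightarrow> complex"
  assumes subspace: "complex_vector.subspace S" and nonneg_form: "nonneg_form_on S q"
begin

lemma zero_mem [simp]: "0 \<in> S"
  and add_mem [simp]: "u \<in> S \<Longrightarrow> v \<in> S \<Longrightarrow> u + v \<in> S"
  and diff_mem [simp]: "u \<in> S \<Longrightarrow> v \<in> S \<Longrightarrow> u - v \<in> S"
  and minus_mem [simp]: "u \<in> S \<Longrightarrow> - u \<in> S"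
  and scale_mem [simp]: "u \<in> S \<Longrightarrow> c *\<^sub>C u \<in> S"
  using complex_vector.subspace_0[OF subspace] complex_vector.subspace_add[OF subspace]
    complex_vector.subspace_diff[OF subspace] complex_vector.subspace_neg[OF subspace]
    complex_vector.subspace_scale[OF subspace]
  by simp_all

lemma add_left: "u \<in> S \<Longrightarrow> u' \<in> S \<Longrightarrow> v \<in> S \<Longrightarrow> q (u + u') v = q u v + q u' v"
  and add_right: "u \<in> S \<Longrightarrow> v \<in> S \<Longrightarrow> v' \<in> S \<Longrightarrow> q u (v + v') = q u v + q u v'"
  and scale_left: "u \<in> S \<Longrightarrow> v \<in> S \<Longrightarrow> q (c *\<^sub>C u) v = c * q u v"
  and scale_right: "u \<in> S \<Longrightarrow> v \<in> S \<Longrightarrow> q u (c *\<^sub>C v) = cnj c * q u v"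
  using nonneg_form unfolding nonneg_form_on_def sesquilinear_on_def by blast+

lemma zero_left [simp]: "v \<in> S \<Longrightarrow> q 0 v = 0"
  using scale_left[of 0 v 0] by simp

lemma zero_right [simp]: "u \<in> S \<Longrightarrow> q u 0 = 0"
  using scale_right[of u 0 0] by simp

lemma diff_left: "u \<in> S \<Longrightarrow> u' \<in> S \<Longrightarrow> v \<in> S \<Longrightarrow> q (u - u') v = q u v - q u' v"
  using add_left[of "u - u'" u' v] by simp

lemma diff_right: "u \<in> S \<Longrightarrow> v \<in> S \<Longrightarrow> v' \<in> S \<Longrightarrow> q u (v - v') = q u v - q u v'"
  using add_right[of u "v - v'" v'] by simp

lemma minus_left: "u \<in> S \<Longrightarrow> v \<in> S \<Longrightarrow> q (- u) v = - q u v"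
  using diff_left[of 0 u v] by simp

lemma minus_right: "u \<in> S \<Longrightarrow> v \<in> S \<Longrightarrow> q u (- v) = - q u v"
  using diff_right[of u 0 v] by simp

lemmas form_simps = add_left add_right scale_left scale_right diff_left diff_right
  minus_left minus_right

lemma qf_nonneg [simp]: "u \<in> S \<Longrightarrow> 0 \<le> qf q u"
  and diagonal: "u \<in> S \<Longrightarrow> q u u = complex_of_real (qf q u)"
  using nonneg_form unfolding nonneg_form_on_def qf_def by (auto simp: complex_is_Real_iff complex_eq_iff)

text \<open>Symmetry is not among the assumptions on a non-negative form. It follows by
  polarisation, since the diagonal is real at \<open>u + v\<close> and at
  \<open>u + \<i> *\<^sub>C v\<close>.\<close>

lemma hermitian:
  assumes u: "u \<in> S" and v: "v \<in> S"
  shows "q v u = cnj (q u v)"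
proof -
  have "q (u + v) (u + v) = q u u + q u v + (q v u + q v v)"
    using assms by (simp add: form_simps)
  then have "Im (q u v) + Im (q v u) = 0"
    using diagonal[of "u + v"] diagonal[OF u] diagonal[OF v] assms by (simp add: complex_eq_iff)
  moreover have "q (u + \<i> *\<^sub>C v) (u + \<i> *\<^sub>C v) = q u u + cnj \<i> * q u v + \<i> * (q v u + cnj \<i> * q v v)"
    using assms by (simp add: form_simps algebra_simps)
  then have "Re (q v u) - Re (q u v) = 0"
    using diagonal[of "u + \<i> *\<^sub>C v"] diagonal[OF u] diagonal[OF v] assms by (simp add: complex_eq_iff)
  ultimately show ?thesis by (simp add: complex_eq_iff)
qed

lemma form_norm_nonneg [simp]: "u \<in> S \<Longrightarrow> 0 \<le> form_norm q u"
  by (simp add: form_norm_def)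

lemma form_norm_zero [simp]: "form_norm q 0 = 0"
  using zero_left[of 0] by (simp add: form_norm_def qf_def)

lemma form_norm_sq: "u \<in> S \<Longrightarrow> (form_norm q u)\<^sup>2 = qf q u"
  by (simp add: form_norm_def)

lemma qf_add: "u \<in> S \<Longrightarrow> v \<in> S \<Longrightarrow> qf q (u + v) = qf q u + 2 * Re (q u v) + qf q v"
  using hermitian[of u v] by (simp add: qf_def form_simps)

lemma qf_diff: "u \<in> S \<Longrightarrow> v \<in> S \<Longrightarrow> qf q (u - v) = qf q u - 2 * Re (q u v) + qf q v"
  using hermitian[of u v] by (simp add: qf_def form_simps)

lemma qf_scale:
  assumes "u \<in> S" shows "qf q (c *\<^sub>C u) = (cmod c)\<^sup>2 * qf q u"
proof -
  have "q (c *\<^sub>C u) (c *\<^sub>C u) = (c * cnj c) * q u u" using assms by (simp add: form_simps)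
  also have "\<dots> = complex_of_real ((cmod c)\<^sup>2) * q u u" by (simp only: complex_norm_square)
  finally show ?thesis by (simp add: qf_def)
qed

lemma qf_scale_real: "u \<in> S \<Longrightarrow> qf q (complex_of_real t *\<^sub>C u) = t\<^sup>2 * qf q u"
  by (simp add: qf_scale)

lemma form_norm_scale: "u \<in> S \<Longrightarrow> form_norm q (c *\<^sub>C u) = cmod c * form_norm q u"
  by (simp add: form_norm_def qf_scale real_sqrt_mult)

lemma form_norm_minus: "u \<in> S \<Longrightarrow> form_norm q (- u) = form_norm q u"
  by (simp add: form_norm_def qf_def form_simps)

lemma form_norm_commute:
  assumes "u \<in> S" "v \<in> S" shows "form_norm q (u - v) = form_norm q (v - u)"
  using form_norm_minus[of "v - u"] assms by simp

text \<open>The form may be degenerate, so the usual combination of \<open>u\<close> and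
  \<open>v\<close> with the norms as coefficients could not be divided out. Both norms are raised by
  a small \<open>k > 0\<close>, whose effect on the right-hand side stays below
  \<open>e\<close>.\<close>

lemma Cauchy_Schwarz_Re:
  assumes u: "u \<in> S" and v: "v \<in> S"
  shows "Re (q u v) \<le> form_norm q u * form_norm q v"
proof (rule field_le_epsilon)
  fix e :: real assume e: "e > 0"
  define s t where "s = form_norm q u" and "t = form_norm q v"
  have st: "s \<ge> 0" "t \<ge> 0" using assms by (simp_all add: s_def t_def)
  obtain k where k: "k > 0" "k * s + k * t + k\<^sup>2 \<le> e"
  proof
    let ?k = "min 1 (e / (s + t + 1))"
    show "?k > 0" using e st by simp
    have "?k * s + ?k * t + ?k\<^sup>2 \<le> ?k * s + ?k * t + ?k"
    proof -
      have "0 \<le> ?k" "?k \<le> 1" using e st by auto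
      then show ?thesis using mult_left_le[of ?k ?k] by (simp add: power2_eq_square)
    qed
    also have "\<dots> = ?k * (s + t + 1)" by (simp add: algebra_simps)
    also have "\<dots> \<le> e / (s + t + 1) * (s + t + 1)" using st by (intro mult_right_mono) auto
    finally show "?k * s + ?k * t + ?k\<^sup>2 \<le> e" using st by simp
  qed
  let ?a = "t + k" and ?b = "s + k"
  have "0 \<le> qf q (complex_of_real ?a *\<^sub>C u - complex_of_real ?b *\<^sub>C v)" using assms by simp
  also have "\<dots> = ?a\<^sup>2 * s\<^sup>2 - 2 * (?a * ?b) * Re (q u v) + ?b\<^sup>2 * t\<^sup>2"
    using assms st k
    by (simp add: qf_diff qf_scale_real form_simps form_norm_sq s_def t_def del: of_real_add)
  finally have "2 * (?a * ?b) * Re (q u v) \<le> ?a\<^sup>2 * s\<^sup>2 + ?b\<^sup>2 * t\<^sup>2" by simp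
  also have "\<dots> \<le> 2 * (?a * ?b) * (?a * ?b)"
  proof -
    have "?a\<^sup>2 * s\<^sup>2 \<le> ?a\<^sup>2 * ?b\<^sup>2" "?b\<^sup>2 * t\<^sup>2 \<le> ?b\<^sup>2 * ?a\<^sup>2"
      using st k by (auto intro!: mult_left_mono power_mono)
    moreover have "2 * (?a * ?b) * (?a * ?b) = ?a\<^sup>2 * ?b\<^sup>2 + ?b\<^sup>2 * ?a\<^sup>2" by algebra
    ultimately show ?thesis by linarith
  qed
  finally have "Re (q u v) \<le> ?a * ?b"
    using st k by (simp add: mult_le_cancel_left_pos)
  then show "Re (q u v) \<le> form_norm q u * form_norm q v + e"
    using k by (simp add: s_def t_def algebra_simps power2_eq_square)
qed

lemma Cauchy_Schwarz:
  assumes u: "u \<in> S" and v: "v \<in> S"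
  shows "cmod (q u v) \<le> form_norm q u * form_norm q v"
proof (cases "q u v = 0")
  case True
  then show ?thesis using assms by simp
next
  case False
  \<comment> \<open>This phase makes \<open>c * q u v\<close> real and non-negative, which reduces
    the modulus to the real part.\<close>
  define c where "c = cnj (q u v) / cmod (q u v)"
  have c: "cmod c = 1" using False by (simp add: c_def norm_divide)
  have "c * q u v = complex_of_real (cmod (q u v))"
    using False complex_norm_square[of "q u v"]
    by (simp add: c_def field_simps power2_eq_square)
  then have "cmod (q u v) = Re (q (c *\<^sub>C u) v)" using assms by (simp add: form_simps)
  also have "\<dots> \<le> form_norm q (c *\<^sub>C u) * form_norm q v" by (rule Cauchy_Schwarz_Re) (use assms in auto)
  also have "\<dots> = form_norm q u * form_norm q v" using assms c by (simp add: form_norm_scale)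
  finally show ?thesis .
qed

lemma form_norm_triangle:
  assumes u: "u \<in> S" and v: "v \<in> S"
  shows "form_norm q (u + v) \<le> form_norm q u + form_norm q v"
proof (rule power2_le_imp_le)
  show "(form_norm q (u + v))\<^sup>2 \<le> (form_norm q u + form_norm q v)\<^sup>2"
    using Cauchy_Schwarz_Re[OF u v] assms by (simp add: form_norm_sq qf_add power2_sum)
qed (use assms in simp)

lemma form_norm_triangle_diff:
  assumes u: "u \<in> S" and v: "v \<in> S"
  shows "form_norm q (u - v) \<le> form_norm q u + form_norm q v"
  using form_norm_triangle[of u "- v"] assms by (simp add: form_norm_minus)

lemma form_norm_triangle_dist:
  assumes "u \<in> S" "v \<in> S" "w \<in> S"
  shows "form_norm q (u - w) \<le> form_norm q (u - v) + form_norm q (v - w)"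
  using form_norm_triangle[of "u - v" "v - w"] assms by simp

lemma null_left:
  assumes "u \<in> S" "v \<in> S" "q u u = 0" shows "q u v = 0"
  using Cauchy_Schwarz[OF assms(1,2)] assms(3) by (simp add: form_norm_def qf_def)

lemma null_right:
  assumes "u \<in> S" "v \<in> S" "q v v = 0" shows "q u v = 0"
  using Cauchy_Schwarz[OF assms(1,2)] assms(3) by (simp add: form_norm_def qf_def)

lemma restrict: "complex_vector.subspace T \<Longrightarrow> T \<subseteq> S \<Longrightarrow> nonneg_form T q"
  using nonneg_form unfolding nonneg_form_def nonneg_form_on_def sesquilinear_on_def by blast

end

locale definite_form = nonneg_form +
  assumes definite: "u \<in> S \<Longrightarrow> q u u = 0 \<Longrightarrow> u = 0"
begin

lemma form_norm_eq_0: "u \<in> S \<Longrightarrow> form_norm q u = 0 \<longleftrightarrow> u = 0"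
  using definite[of u] diagonal[of u] form_norm_zero by (auto simp: form_norm_def)

lemma form_norm_pos: "u \<in> S \<Longrightarrow> u \<noteq> 0 \<Longrightarrow> 0 < form_norm q u"
  using form_norm_eq_0[of u] form_norm_nonneg[of u] by linarith

lemma form_eqI:
  assumes "u \<in> S" "v \<in> S" "\<And>w. w \<in> S \<Longrightarrow> q u w = q v w"
  shows "u = v"
  using definite[of "u - v"] assms by (simp add: form_simps)

lemma metric: "Metric_space S (form_dist S q)"
proof
  fix x y z
  show "0 \<le> form_dist S q x y" by (simp add: form_dist_def)
  show "form_dist S q x y = form_dist S q y x" by (auto simp: form_dist_def intro: form_norm_commute)
  show "form_dist S q x y = 0 \<longleftrightarrow> x = y" if "x \<in> S" "y \<in> S"
    using that form_norm_eq_0[of "x - y"] by (simp add: form_dist_def)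
  show "form_dist S q x z \<le> form_dist S q x y + form_dist S q y z" if "x \<in> S" "y \<in> S" "z \<in> S"
    using that form_norm_triangle_dist[of x y z] by (simp add: form_dist_def)
qed

end

lemma definite_form_iff: "definite_form S q \<longleftrightarrow> inner_product_on S q"
proof
  assume "definite_form S q"
  then interpret definite_form S q .
  show "inner_product_on S q"
    unfolding inner_product_on_def
    by (intro conjI ballI impI)
      (rule subspace | rule nonneg_form | erule (1) hermitian | erule (1) definite)+
next
  assume q: "inner_product_on S q"
  show "definite_form S q"
  proof
    show "complex_vector.subspace S" using q unfolding inner_product_on_def by (elim conjE)
    show "nonneg_form_on S q" using q unfolding inner_product_on_def by (elim conjE)
    have "\<forall>u\<in>S. q u u = 0 \<longrightarrow> u = 0" using q unfolding inner_product_on_def by (elim conjE)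
    then show "u = 0" if "u \<in> S" "q u u = 0" for u using that by simp
  qed
qed

text \<open>Completeness is phrased with sequences and \<open>form_norm\<close> alone, so that it
  passes to closed subspaces and equivalent forms by plain estimates.\<close>

locale hilbert_form = definite_form +
  assumes complete:
    "\<And>x. range x \<subseteq> S \<Longrightarrow> \<forall>e>0. \<exists>N. \<forall>m\<ge>N. \<forall>n\<ge>N. form_norm q (x m - x n) < e
      \<Longrightarrow> \<exists>l\<in>S. (\<lambda>n. form_norm q (x (n::nat) - l)) \<longlonglongrightarrow> 0"
begin

text \<open>By minimising \<open>q[w] - 2 Re (l w)\<close>.\<close>

lemma riesz:
  assumes l_add: "\<And>u v. u \<in> S \<Longrightarrow> v \<in> S \<Longrightarrow> l (u + v) = l u + l v"
    and l_scale: "\<And>c u. u \<in> S \<Longrightarrow> l (c *\<^sub>C u) = cnj c * l u"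
    and l_bound: "\<And>u. u \<in> S \<Longrightarrow> cmod (l u) \<le> C * form_norm q u"
  shows "\<exists>u\<in>S. \<forall>w\<in>S. q u w = l w"
proof -
  define J where "J w = qf q w - 2 * Re (l w)" for w
  have J_lower: "- C\<^sup>2 \<le> J w" if "w \<in> S" for w
  proof -
    have "Re (l w) \<le> C * form_norm q w" using l_bound[OF that] complex_Re_le_cmod order_trans by blast
    moreover have "0 \<le> (form_norm q w - C)\<^sup>2" by simp
    ultimately show ?thesis
      using that by (simp add: J_def power2_diff form_norm_sq algebra_simps)
  qed
  define m where "m = Inf (J ` S)"
  have bdd: "bdd_below (J ` S)" using J_lower by (auto intro!: bdd_belowI2)
  have m_le: "m \<le> J w" if "w \<in> S" for w
    unfolding m_def using bdd that by (intro cInf_lower) auto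
  have "\<exists>w\<in>S. J w < m + 1 / real (Suc n)" for n
  proof -
    have "Inf (J ` S) < m + 1 / real (Suc n)" by (simp add: m_def)
    then show ?thesis using cInf_lessD[of "J ` S"] zero_mem by blast
  qed
  then obtain x where x: "x n \<in> S" "J (x n) < m + 1 / real (Suc n)" for n by metis
  \<comment> \<open>Almost-minimality becomes the Cauchy property because \<open>J\<close> is at
    least \<open>m\<close> at the midpoint as well.\<close>
  have parallelogram: "qf q (x i - x j) \<le> 2 / real (Suc i) + 2 / real (Suc j)" for i j
  proof -
    let ?h = "(1/2) *\<^sub>C (x i + x j)"
    have h: "4 * J ?h = qf q (x i + x j) - 4 * Re (l (x i)) - 4 * Re (l (x j))"
      using x(1)[of i] x(1)[of j] qf_scale[of "x i + x j" "1/2"]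
      by (simp add: J_def l_scale l_add power2_eq_square norm_divide field_simps)
    have "qf q (x i - x j) = 2 * J (x i) + 2 * J (x j) - 4 * J ?h"
      unfolding h using x(1)[of i] x(1)[of j] by (simp add: J_def qf_add qf_diff)
    moreover have "m \<le> J ?h" using x(1) by (intro m_le) simp
    ultimately show ?thesis using x(2)[of i] x(2)[of j] by simp
  qed
  have "\<forall>e>0. \<exists>N. \<forall>i\<ge>N. \<forall>j\<ge>N. form_norm q (x i - x j) < e"
  proof (intro allI impI)
    fix e :: real assume e: "e > 0"
    obtain N where N: "inverse (real (Suc N)) < e\<^sup>2 / 4"
      using reals_Archimedean[of "e\<^sup>2 / 4"] e by auto
    have "form_norm q (x i - x j) < e" if "i \<ge> N" "j \<ge> N" for i j
    proof -
      have "2 / real (Suc i) \<le> 2 / real (Suc N)" "2 / real (Suc j) \<le> 2 / real (Suc N)"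
        using that by (auto simp: field_simps)
      then have "qf q (x i - x j) < e\<^sup>2"
        using parallelogram[of i j] N unfolding divide_inverse[of 2] by linarith
      then have "sqrt (qf q (x i - x j)) < sqrt (e\<^sup>2)" by (rule real_sqrt_less_mono)
      then show ?thesis using e by (simp add: form_norm_def)
    qed
    then show "\<exists>N. \<forall>i\<ge>N. \<forall>j\<ge>N. form_norm q (x i - x j) < e" by blast
  qed
  then obtain u where u: "u \<in> S" "(\<lambda>n. form_norm q (x n - u)) \<longlonglongrightarrow> 0"
    using complete[of x] x(1) by blast
  have Re_eq: "Re (q u w) = Re (l w)" if w: "w \<in> S" for w
  proof -
    define D where "D = Re (q u w) - Re (l w)"
    have lim: "(\<lambda>n. Re (q (x n) w)) \<longlonglongrightarrow> Re (q u w)"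
    proof (rule LIM_zero_cancel, rule Lim_null_comparison)
      show "\<forall>\<^sub>F n in sequentially. norm (Re (q (x n) w) - Re (q u w)) \<le> form_norm q (x n - u) * form_norm q w"
      proof (intro always_eventually allI)
        fix n
        have "\<bar>Re (q (x n - u) w)\<bar> \<le> form_norm q (x n - u) * form_norm q w"
          using Cauchy_Schwarz[of "x n - u" w] abs_Re_le_cmod[of "q (x n - u) w"] x(1)[of n] u(1) w by simp
        then show "norm (Re (q (x n) w) - Re (q u w)) \<le> form_norm q (x n - u) * form_norm q w"
          using x(1)[of n] u(1) w by (simp add: diff_left)
      qed
      show "(\<lambda>n. form_norm q (x n - u) * form_norm q w) \<longlonglongrightarrow> 0"
        using tendsto_mult_right[OF u(2)] by simp
    qed
    \<comment> \<open>Comparing \<open>x n\<close> with its variation in direction \<open>w\<close>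
      and letting \<open>n\<close> tend to infinity gives this inequality for every real
      \<open>t\<close>; a linear coefficient \<open>D\<close> other than 0 would violate it for
      small \<open>t\<close>.\<close>
    have key: "0 \<le> t\<^sup>2 * qf q w + 2 * t * D" for t
    proof -
      have "- (1 / real (Suc n)) \<le> t\<^sup>2 * qf q w + 2 * t * (Re (q (x n) w) - Re (l w))" for n
      proof -
        have "m \<le> J (x n + complex_of_real t *\<^sub>C w)" using x(1) w by (intro m_le) simp
        also have "\<dots> = J (x n) + (t\<^sup>2 * qf q w + 2 * t * (Re (q (x n) w) - Re (l w)))"
          using x(1)[of n] w
          by (simp add: J_def qf_add qf_scale form_simps l_add l_scale algebra_simps)
        finally show ?thesis using x(2)[of n] by linarith
      qed
      moreover have "(\<lambda>n. - (1 / real (Suc n))) \<longlonglongrightarrow> - 0"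
        by (intro tendsto_minus) (use LIMSEQ_inverse_real_of_nat in \<open>simp add: inverse_eq_divide\<close>)
      moreover have "(\<lambda>n. t\<^sup>2 * qf q w + 2 * t * (Re (q (x n) w) - Re (l w)))
          \<longlonglongrightarrow> t\<^sup>2 * qf q w + 2 * t * D"
        unfolding D_def by (intro tendsto_intros lim)
      ultimately show ?thesis using LIMSEQ_le[of _ "- 0" _ "t\<^sup>2 * qf q w + 2 * t * D"] by auto
    qed
    have "D = 0"
    proof (rule ccontr)
      assume "D \<noteq> 0"
      \<comment> \<open>The summand 1 keeps \<open>A\<close> positive even if
        \<open>qf q w = 0\<close>; the choice \<open>t = - D / A\<close> then makes the right-hand
        side of \<open>key\<close> negative.\<close>
      define A where "A = qf q w + 1"
      have A: "A > 0" using w by (simp add: A_def add_nonneg_pos)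
      have "0 \<le> (- D / A)\<^sup>2 * qf q w + 2 * (- D / A) * D" by (rule key)
      also have "\<dots> \<le> (- D / A)\<^sup>2 * A + 2 * (- D / A) * D" by (simp add: A_def mult_left_mono)
      also have "\<dots> = - (D\<^sup>2 / A)" using A by (simp add: power2_eq_square field_simps)
      finally show False using A \<open>D \<noteq> 0\<close> by (simp add: divide_le_0_iff zero_le_divide_iff)
    qed
    then show ?thesis by (simp add: D_def)
  qed
  have "q u w = l w" if w: "w \<in> S" for w
  proof -
    \<comment> \<open>Both sides are conjugate-linear in \<open>w\<close>, so their real parts at
      \<open>\<i> *\<^sub>C w\<close> are their imaginary parts at \<open>w\<close>.\<close>
    have "Im (q u w) = Im (l w)"
      using Re_eq[of "\<i> *\<^sub>C w"] w u(1) by (simp add: form_simps l_scale)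
    then show ?thesis using Re_eq[OF w] by (simp add: complex_eq_iff)
  qed
  then show ?thesis using u(1) by blast
qed

end

section \<open>Completeness under change of norm and subspace\<close>

lemma hilbert_formI:
  assumes "inner_product_on S q" and mcomplete: "Metric_space.mcomplete S (form_dist S q)"
  shows "hilbert_form S q"
proof -
  interpret definite_form S q using assms(1) by (simp add: definite_form_iff)
  interpret M: Metric_space S "form_dist S q" by (rule metric)
  show ?thesis
  proof
    fix x :: "nat \<Rightarrow> 'a" assume x: "range x \<subseteq> S" and c: "\<forall>e>0. \<exists>N. \<forall>m\<ge>N. \<forall>n\<ge>N. form_norm q (x m - x n) < e"
    then have mem: "x n \<in> S" for n by blast
    have "M.MCauchy x" unfolding M.MCauchy_def using x mem c by (simp add: form_dist_def)
    then obtain u where u: "limitin M.mtopology x u sequentially" using mcomplete M.mcomplete_def by blast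
    then have uS: "u \<in> S" using M.limitin_mspace by blast
    have "(\<lambda>n. form_norm q (x n - u)) \<longlonglongrightarrow> 0"
      using u unfolding M.limitin_metric_dist_null using mem uS by (simp add: form_dist_def)
    then show "\<exists>l\<in>S. (\<lambda>n. form_norm q (x n - l)) \<longlonglongrightarrow> 0" using uS by blast
  qed
qed

text \<open>The completeness of every derived form comes from here: a Cauchy sequence for
  \<open>q\<close> is one for \<open>p\<close>, its limit stays in \<open>T\<close> by sequential
  closedness, and the upper bound returns the convergence to \<open>q\<close>. The lower bound also
  makes \<open>q\<close> definite.\<close>

lemma hilbert_form_transfer:
  assumes "hilbert_form S p" and T: "complex_vector.subspace T" "nonneg_form_on T q"
    and sub: "T \<subseteq> S"
    and closed: "\<And>x l. range x \<subseteq> T \<Longrightarrow> l \<in> S \<Longrightarrow> (\<lambda>n::nat. form_norm p (x n - l)) \<longlonglongrightarrow> 0 \<Longrightarrow> l \<in> T"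
    and lower: "\<And>u. u \<in> T \<Longrightarrow> form_norm p u \<le> C * form_norm q u"
    and upper: "\<And>u. u \<in> T \<Longrightarrow> form_norm q u \<le> C' * form_norm p u"
  shows "hilbert_form T q"
proof -
  interpret p: hilbert_form S p by fact
  interpret q: nonneg_form T q using T by unfold_locales
  show ?thesis
  proof
    fix u assume u: "u \<in> T" "q u u = 0"
    then have "form_norm p u \<le> 0" using lower[of u] by (simp add: form_norm_def[of q] qf_def)
    moreover have "0 \<le> form_norm p u" using u sub p.form_norm_nonneg by blast
    ultimately show "u = 0" using p.form_norm_eq_0[of u] u sub by auto
  next
    fix x :: "nat \<Rightarrow> 'a" assume x: "range x \<subseteq> T"
      and c: "\<forall>e>0. \<exists>N. \<forall>m\<ge>N. \<forall>n\<ge>N. form_norm q (x m - x n) < e"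
    then have mem: "x n \<in> T" for n by blast
    have "\<forall>e>0. \<exists>N. \<forall>m\<ge>N. \<forall>n\<ge>N. form_norm p (x m - x n) < e"
    proof (intro allI impI)
      fix e :: real assume e: "e > 0"
      \<comment> \<open>\<open>\<bar>C\<bar> + 1\<close> is a positive divisor whatever the sign of
        \<open>C\<close>.\<close>
      obtain N where N: "\<forall>m\<ge>N. \<forall>n\<ge>N. form_norm q (x m - x n) < e / (\<bar>C\<bar> + 1)"
        using c e by (metis abs_ge_zero divide_pos_pos add_nonneg_pos zero_less_one)
      have "form_norm p (x m - x n) < e" if "m \<ge> N" "n \<ge> N" for m n
      proof -
        let ?r = "form_norm q (x m - x n)"
        have "form_norm p (x m - x n) \<le> C * ?r" using mem by (intro lower) simp
        also have "\<dots> \<le> (\<bar>C\<bar> + 1) * ?r" using mem by (intro mult_right_mono) auto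
        also have "\<dots> < (\<bar>C\<bar> + 1) * (e / (\<bar>C\<bar> + 1))" using N that by (intro mult_strict_left_mono) auto
        finally show ?thesis by simp
      qed
      then show "\<exists>N. \<forall>m\<ge>N. \<forall>n\<ge>N. form_norm p (x m - x n) < e" by blast
    qed
    then obtain l where l: "l \<in> S" "(\<lambda>n. form_norm p (x n - l)) \<longlonglongrightarrow> 0"
      using p.complete[of x] x sub by blast
    then have lT: "l \<in> T" using closed x by blast
    have "(\<lambda>n. form_norm q (x n - l)) \<longlonglongrightarrow> 0"
    proof (rule Lim_null_comparison)
      show "\<forall>\<^sub>F n in sequentially. norm (form_norm q (x n - l)) \<le> C' * form_norm p (x n - l)"
        using upper mem lT by (intro always_eventually allI) simp
      show "(\<lambda>n. C' * form_norm p (x n - l)) \<longlonglongrightarrow> 0" using tendsto_mult_left[OF l(2)] by simp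
    qed
    then show "\<exists>l\<in>T. (\<lambda>n. form_norm q (x n - l)) \<longlonglongrightarrow> 0" using lT by blast
  qed
qed

lemma (in definite_form) closedin_sequentially:
  assumes "closedin (form_topology S q) T" "range x \<subseteq> T" "l \<in> S"
    "(\<lambda>n::nat. form_norm q (x n - l)) \<longlonglongrightarrow> 0"
  shows "l \<in> T"
proof -
  interpret M: Metric_space S "form_dist S q" by (rule metric)
  have T: "closedin M.mtopology T" using assms(1) by (simp add: form_topology_def)
  then have TS: "T \<subseteq> S" using closedin_subset by fastforce
  have "limitin M.mtopology x l sequentially"
    unfolding M.limitin_metric_dist_null using assms(2-4) TS by (auto simp: form_dist_def image_subset_iff subset_iff)
  then show ?thesis using T assms(2) unfolding M.metric_closedin_iff_sequentially_closed by blast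
qed

lemma hilbert_form_equivalent:
  assumes p: "hilbert_form S p" and q: "equivalent_inner_product_on S p q"
    and T: "complex_vector.subspace T" "closedin (form_topology S p) T"
  shows "hilbert_form T q"
proof -
  interpret p: hilbert_form S p by fact
  interpret M: Metric_space S "form_dist S p" by (rule p.metric)
  have q': "definite_form S q" using q by (simp add: equivalent_inner_product_on_def definite_form_iff)
  then interpret q: definite_form S q .
  have TS: "T \<subseteq> S" using closedin_subset[OF T(2)] by (simp add: form_topology_def)
  obtain c C where c: "c > 0" "\<And>u. u \<in> S \<Longrightarrow> c * form_norm p u \<le> form_norm q u"
    "\<And>u. u \<in> S \<Longrightarrow> form_norm q u \<le> C * form_norm p u"
    using q unfolding equivalent_inner_product_on_def by blast
  show ?thesis
  proof (rule hilbert_form_transfer[OF p T(1)])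
    show "nonneg_form_on T q" using q.restrict[OF T(1) TS] by (simp add: nonneg_form_def)
    show "form_norm p u \<le> 1 / c * form_norm q u" if "u \<in> T" for u
      using c(1) c(2)[of u] that TS by (auto simp: field_simps)
    show "form_norm q u \<le> C * form_norm p u" if "u \<in> T" for u using c(3) that TS by blast
    show "l \<in> T" if "range x \<subseteq> T" "l \<in> S" "(\<lambda>n::nat. form_norm p (x n - l)) \<longlonglongrightarrow> 0" for x l
      using T(2) that by (rule p.closedin_sequentially)
  qed (rule TS)
qed

lemma closedin_form_topology_self:
  assumes "definite_form S p" shows "closedin (form_topology S p) S"
proof -
  interpret definite_form S p by fact
  interpret M: Metric_space S "form_dist S p" by (rule metric)
  show ?thesis by (simp add: form_topology_def)
qed

text \<open>Makes \<open>H0_space\<close>, which is defined as a closure, a linear space on which an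
  operator can act.\<close>

lemma (in definite_form) subspace_closure_of:
  assumes T: "complex_vector.subspace T" "T \<subseteq> S"
  shows "complex_vector.subspace (form_topology S q closure_of T)"
proof -
  interpret M: Metric_space S "form_dist S q" by (rule metric)
  have cl: "x \<in> form_topology S q closure_of T \<longleftrightarrow>
      x \<in> S \<and> (\<forall>r>0. \<exists>y\<in>T. form_norm q (x - y) < r)" for x
    unfolding form_topology_def M.metric_closure_of using T(2)
    by (auto simp: form_dist_def subset_iff M.in_mball Bex_def)
  show ?thesis
  proof (rule complex_vector.subspaceI)
    show "0 \<in> form_topology S q closure_of T"
      unfolding cl using complex_vector.subspace_0[OF T(1)] by (auto intro!: bexI[of _ 0])
  next
    fix x y assume "x \<in> form_topology S q closure_of T" "y \<in> form_topology S q closure_of T"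
    then have x: "x \<in> S" "\<forall>r>0. \<exists>y\<in>T. form_norm q (x - y) < r"
      and y: "y \<in> S" "\<forall>r>0. \<exists>z\<in>T. form_norm q (y - z) < r" unfolding cl by auto
    have "\<exists>z\<in>T. form_norm q (x + y - z) < r" if r: "r > 0" for r
    proof -
      obtain x' y' where *: "x' \<in> T" "form_norm q (x - x') < r / 2" "y' \<in> T" "form_norm q (y - y') < r / 2"
        using x y r half_gt_zero by metis
      have "form_norm q ((x - x') + (y - y')) \<le> form_norm q (x - x') + form_norm q (y - y')"
        using x y * T by (intro form_norm_triangle) auto
      then have "form_norm q (x + y - (x' + y')) < r" using * by (simp add: algebra_simps)
      then show ?thesis using * complex_vector.subspace_add[OF T(1)] by blast
    qed
    then show "x + y \<in> form_topology S q closure_of T" unfolding cl using x y by simp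
  next
    fix c x assume "x \<in> form_topology S q closure_of T"
    then have x: "x \<in> S" "\<forall>r>0. \<exists>y\<in>T. form_norm q (x - y) < r" unfolding cl by auto
    have "\<exists>z\<in>T. form_norm q (c *\<^sub>C x - z) < r" if r: "r > 0" for r
    proof -
      obtain x' where *: "x' \<in> T" "form_norm q (x - x') < r / (cmod c + 1)"
        using x(2) r by (meson divide_pos_pos add_nonneg_pos norm_ge_zero zero_less_one)
      have "form_norm q (c *\<^sub>C x - c *\<^sub>C x') = cmod c * form_norm q (x - x')"
        using x * T by (simp add: form_norm_scale subset_iff flip: complex_vector.scale_right_diff_distrib)
      also have "\<dots> \<le> (cmod c + 1) * form_norm q (x - x')"
        using x * T by (intro mult_right_mono) auto
      also have "\<dots> < (cmod c + 1) * (r / (cmod c + 1))"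
        using * by (intro mult_strict_left_mono) (auto simp: add_nonneg_pos)
      also have "\<dots> = r" using norm_ge_zero[of c] by (simp add: add_nonneg_eq_0_iff)
      finally show ?thesis using * complex_vector.subspace_scale[OF T(1)] by blast
    qed
    then show "c *\<^sub>C x \<in> form_topology S q closure_of T" unfolding cl using x by simp
  qed
qed

section \<open>Approximate eigenvalues of self-adjoint operators\<close>

text \<open>The approximate point spectrum (Weyl's criterion). The condition passes to a nearby
  operator up to a small shift of \<open>c\<close>, which exact eigenvectors do not offer directly;
  for bounded self-adjoint \<open>B\<close> in a complete space it describes the whole
  spectrum.\<close>

definition approx_eigenvalue ::
    "'a::complex_vector set \<Rightarrow> ('a \<Rightarrow> 'a \<Rightarrow> complex) \<Rightarrow> ('a \<Rightarrow> 'a) \<Rightarrow> complex \<Rightarrow> bool" where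
  "approx_eigenvalue X d B c \<longleftrightarrow>
     (\<forall>\<delta>>0. \<exists>u\<in>X. u \<noteq> 0 \<and> form_norm d (B u - c *\<^sub>C u) \<le> \<delta> * form_norm d u)"

locale selfadjoint_operator = definite_form X d
  for X :: "'a::complex_vector set" and d +
  fixes B :: "'a \<Rightarrow> 'a" and C :: real
  assumes maps: "u \<in> X \<Longrightarrow> B u \<in> X"
    and op_add: "u \<in> X \<Longrightarrow> v \<in> X \<Longrightarrow> B (u + v) = B u + B v"
    and op_scale: "u \<in> X \<Longrightarrow> B (c *\<^sub>C u) = c *\<^sub>C B u"
    and selfadjoint: "u \<in> X \<Longrightarrow> v \<in> X \<Longrightarrow> d (B u) v = d u (B v)"
    and bounded: "u \<in> X \<Longrightarrow> form_norm d (B u) \<le> C * form_norm d u"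
    and C_nonneg: "0 \<le> C"
begin

declare maps [simp]

definition shift :: "complex \<Rightarrow> 'a \<Rightarrow> 'a" where "shift c u = B u - c *\<^sub>C u"

lemma shift_mem [simp]: "u \<in> X \<Longrightarrow> shift c u \<in> X"
  by (simp add: shift_def)

lemma shift_add: "u \<in> X \<Longrightarrow> v \<in> X \<Longrightarrow> shift c (u + v) = shift c u + shift c v"
  by (simp add: shift_def op_add scaleC_add_right)

lemma shift_scale: "u \<in> X \<Longrightarrow> shift c (k *\<^sub>C u) = k *\<^sub>C shift c u"
  by (simp add: shift_def op_scale complex_vector.scale_right_diff_distrib mult.commute)

lemma shift_zero [simp]: "shift c 0 = 0"
  using shift_scale[of 0 c 0] by simp

lemma shift_adjoint: "u \<in> X \<Longrightarrow> v \<in> X \<Longrightarrow> d (shift c u) v = d u (shift (cnj c) v)"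
  by (simp add: shift_def form_simps selfadjoint)

lemma shift_bounded:
  assumes "u \<in> X"
  shows "form_norm d (shift c u) \<le> (C + cmod c) * form_norm d u"
proof -
  have "form_norm d (shift c u) \<le> form_norm d (B u) + form_norm d (c *\<^sub>C u)"
    unfolding shift_def using assms by (intro form_norm_triangle_diff) auto
  then show ?thesis using bounded[OF assms] assms by (simp add: form_norm_scale algebra_simps)
qed

text \<open>The shift by the real part of \<open>c\<close> is symmetric, so its cross term with
  \<open>\<i> * Im c\<close> times \<open>u\<close> is purely imaginary and drops out. This forces
  approximate eigenvalues to be real and gives \<open>shift c\<close> and
  \<open>shift (cnj c)\<close> equal norms.\<close>

lemma qf_shift:
  assumes u: "u \<in> X"
  shows "qf d (shift c u) = qf d (shift (complex_of_real (Re c)) u) + (Im c)\<^sup>2 * qf d u"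
proof -
  let ?v = "shift (complex_of_real (Re c)) u"
  have "shift c u = ?v - (\<i> * complex_of_real (Im c)) *\<^sub>C u"
    unfolding shift_def by (subst complex_eq[of c]) (simp add: scaleC_add_left diff_diff_eq)
  then have "qf d (shift c u) = qf d ?v
      - 2 * Re (d ?v ((\<i> * complex_of_real (Im c)) *\<^sub>C u)) + (Im c)\<^sup>2 * qf d u"
    using u by (simp add: qf_diff qf_scale norm_mult)
  moreover have "Im (d ?v u) = 0"
  proof -
    have "d ?v u = cnj (d ?v u)"
      using shift_adjoint[OF u u, of "complex_of_real (Re c)"] hermitian[of "?v" u] u by simp
    then show ?thesis by (simp add: complex_eq_iff)
  qed
  ultimately show ?thesis using u by (simp add: form_simps)
qed

lemma form_norm_shift_cnj: "u \<in> X \<Longrightarrow> form_norm d (shift (cnj c) u) = form_norm d (shift c u)"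
  using qf_shift[of u c] qf_shift[of u "cnj c"] by (simp add: form_norm_def)

lemma approx_eigenvalue_shift:
  "approx_eigenvalue X d B c \<longleftrightarrow>
     (\<forall>\<delta>>0. \<exists>u\<in>X. u \<noteq> 0 \<and> form_norm d (shift c u) \<le> \<delta> * form_norm d u)"
  by (simp add: approx_eigenvalue_def shift_def)

lemma not_approx_eigenvalue:
  assumes "\<not> approx_eigenvalue X d B c"
  shows "\<exists>\<delta>>0. \<forall>u\<in>X. \<delta> * form_norm d u \<le> form_norm d (shift c u)"
proof -
  obtain \<delta> where \<delta>: "\<delta> > 0" "\<And>u. u \<in> X \<Longrightarrow> u \<noteq> 0 \<Longrightarrow> \<delta> * form_norm d u < form_norm d (shift c u)"
    using assms unfolding approx_eigenvalue_shift by (auto simp: not_le)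
  have "\<delta> * form_norm d u \<le> form_norm d (shift c u)" if "u \<in> X" for u
    using \<delta>(2)[OF that] that by (cases "u = 0") auto
  then show ?thesis using \<delta>(1) by blast
qed

lemma approx_eigenvalue_real:
  assumes "approx_eigenvalue X d B c"
  shows "c = complex_of_real (Re c)"
proof (rule ccontr)
  assume "c \<noteq> complex_of_real (Re c)"
  then have Im: "\<bar>Im c\<bar> > 0" by (auto simp: complex_eq_iff)
  then obtain u where u: "u \<in> X" "u \<noteq> 0" "form_norm d (shift c u) \<le> \<bar>Im c\<bar> / 2 * form_norm d u"
    using assms unfolding approx_eigenvalue_shift by (meson half_gt_zero)
  have "(Im c)\<^sup>2 * qf d u \<le> qf d (shift c u)" using qf_shift[OF u(1), of c] u(1) by simp
  then have "sqrt ((Im c)\<^sup>2 * qf d u) \<le> form_norm d (shift c u)"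
    unfolding form_norm_def by (rule real_sqrt_le_mono)
  then have "\<bar>Im c\<bar> * form_norm d u \<le> \<bar>Im c\<bar> / 2 * form_norm d u"
    using u(3) by (simp add: real_sqrt_mult form_norm_def)
  moreover have "0 < \<bar>Im c\<bar> * form_norm d u" using Im form_norm_pos[OF u(1,2)] by (rule mult_pos_pos)
  ultimately show False by linarith
qed

text \<open>For \<open>T = B - \<alpha>\<close> and \<open>m\<close> the largest lower bound of \<open>T\<close>, the form of \<open>T\<^sup>2 - m\<^sup>2\<close> is
  non-negative, so almost-minimisers of \<open>\<parallel>T u\<parallel>\<close> are, by the Cauchy--Schwarz inequality for that
  form, almost in the kernel of \<open>T\<^sup>2 - m\<^sup>2 = (B - \<alpha> - m) (B - \<alpha> + m)\<close>.\<close>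

lemma approx_eigenvalue_near:
  fixes \<alpha> \<eta> :: real
  assumes u0: "u0 \<in> X" "u0 \<noteq> 0"
    and near: "form_norm d (shift (complex_of_real \<alpha>) u0) \<le> \<eta> * form_norm d u0"
  obtains \<beta> where "\<bar>\<beta> - \<alpha>\<bar> \<le> \<eta>" "approx_eigenvalue X d B (complex_of_real \<beta>)"
proof -
  let ?T = "shift (complex_of_real \<alpha>)"
  define R where "R = (\<lambda>u. form_norm d (?T u) / form_norm d u) ` (X - {0})"
  define m where "m = Inf R"
  have R_nonneg: "0 \<le> r" if "r \<in> R" for r using that by (auto simp: R_def)
  have bdd: "bdd_below R" using R_nonneg by (intro bdd_belowI[of _ 0])
  have R_ne: "R \<noteq> {}" using u0 by (auto simp: R_def)
  have m0: "0 \<le> m" unfolding m_def using R_ne R_nonneg by (rule cInf_greatest)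
  have m_low: "m * form_norm d u \<le> form_norm d (?T u)" if u: "u \<in> X" for u
  proof (cases "u = 0")
    case False
    then have "m \<le> form_norm d (?T u) / form_norm d u"
      unfolding m_def using bdd u by (intro cInf_lower) (auto simp: R_def)
    then show ?thesis using form_norm_pos[OF u False] by (simp add: field_simps)
  qed simp
  have m_eta: "m \<le> \<eta>"
  proof -
    have "m \<le> form_norm d (?T u0) / form_norm d u0"
      unfolding m_def using bdd u0 by (intro cInf_lower) (auto simp: R_def)
    also have "\<dots> \<le> \<eta>" using near form_norm_pos[OF u0] by (simp add: field_simps)
    finally show ?thesis .
  qed
  define p where "p u v = d (?T u) (?T v) - complex_of_real (m\<^sup>2) * d u v" for u v
  define A where "A u = ?T (?T u) - complex_of_real (m\<^sup>2) *\<^sub>C u" for u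
  have qf_p: "qf p u = (form_norm d (?T u))\<^sup>2 - m\<^sup>2 * (form_norm d u)\<^sup>2" if "u \<in> X" for u
    using that by (simp add: form_norm_sq) (simp add: p_def qf_def)
  interpret p: nonneg_form X p
  proof
    have "0 \<le> qf p u" if "u \<in> X" for u
      using power_mono[OF m_low[OF that], of 2] m0 that by (simp add: qf_p power_mult_distrib)
    moreover have "Im (p u u) = 0" if "u \<in> X" for u
      using that by (simp add: p_def diagonal)
    ultimately show "nonneg_form_on X p"
      unfolding nonneg_form_on_def sesquilinear_on_def
      by (auto simp: qf_def complex_is_Real_iff)
        (simp_all add: p_def form_simps shift_add shift_scale algebra_simps)
  qed (rule subspace)
  define M where "M = C + \<bar>\<alpha>\<bar> + 1"
  have M: "M > 0" using C_nonneg by (simp add: M_def)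
  have T_bound: "form_norm d (?T u) \<le> M * form_norm d u" if "u \<in> X" for u
    using shift_bounded[OF that, of "complex_of_real \<alpha>"] that
    by (simp add: M_def algebra_simps add_increasing)
  have A_mem: "A u \<in> X" if "u \<in> X" for u using that by (simp add: A_def)
  have d_A: "d (A u) v = p u v" if "u \<in> X" "v \<in> X" for u v
    using that shift_adjoint[of "?T u" v "complex_of_real \<alpha>"] by (simp add: A_def p_def form_simps)
  \<comment> \<open>Since \<open>qf d (A u)\<close> is the real part of \<open>p u (A u)\<close>,
    the Cauchy--Schwarz inequality for \<open>p\<close> together with
    \<open>form_norm p (A u) \<le> form_norm d (?T (A u))\<close> leaves a bound linear in
    \<open>form_norm p u\<close>.\<close>
  have A_bound: "form_norm d (A u) \<le> M * form_norm p u" if u: "u \<in> X" for u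
  proof (cases "A u = 0")
    case True then show ?thesis using M u by simp
  next
    case False
    note A = A_mem[OF u]
    have "qf d (A u) \<le> cmod (p u (A u))"
      using d_A[OF u A] complex_Re_le_cmod[of "p u (A u)"] by (simp add: qf_def)
    also have "\<dots> \<le> form_norm p u * form_norm p (A u)" by (rule p.Cauchy_Schwarz[OF u A])
    also have "form_norm p (A u) \<le> form_norm d (?T (A u))"
      unfolding form_norm_def[of p] using A by (intro real_le_lsqrt) (auto simp: qf_p)
    then have "form_norm p u * form_norm p (A u) \<le> form_norm p u * (M * form_norm d (A u))"
      using T_bound[OF A] u by (intro mult_left_mono) auto
    finally have "form_norm d (A u) * form_norm d (A u) \<le> (M * form_norm p u) * form_norm d (A u)"
      using A by (simp add: mult_ac flip: form_norm_sq power2_eq_square)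
    then show ?thesis using form_norm_pos[OF A False] by (simp add: mult_le_cancel_right)
  qed
  have small: "\<exists>u\<in>X. u \<noteq> 0 \<and> form_norm d (A u) \<le> \<delta> * form_norm d u" if \<delta>: "\<delta> > 0" for \<delta>
  proof -
    \<comment> \<open>\<open>h\<close> bounds how far \<open>u\<close> misses the infimum. Because
      \<open>h \<le> 1\<close>, the difference \<open>(m + h)\<^sup>2 - m\<^sup>2\<close> is at most
      \<open>h * (2 * m + 1)\<close>, which the second entry keeps below
      \<open>(\<delta> / M)\<^sup>2\<close>.\<close>
    define h where "h = min 1 ((\<delta> / M)\<^sup>2 / (2 * m + 1))"
    have h: "h > 0" "h \<le> 1" "h * (2 * m + 1) \<le> (\<delta> / M)\<^sup>2"
    proof -
      show "h > 0" "h \<le> 1" using \<delta> M m0 by (auto simp: h_def)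
      have "h * (2 * m + 1) \<le> (\<delta> / M)\<^sup>2 / (2 * m + 1) * (2 * m + 1)"
        using m0 by (intro mult_right_mono) (auto simp: h_def)
      then show "h * (2 * m + 1) \<le> (\<delta> / M)\<^sup>2" using m0 by simp
    qed
    have "Inf R < m + h" using h by (simp add: m_def)
    then obtain r where "r \<in> R" "r < m + h" using cInf_lessD[OF R_ne] by blast
    then obtain u where u: "u \<in> X" "u \<noteq> 0" "form_norm d (?T u) / form_norm d u < m + h"
      by (auto simp: R_def)
    have "form_norm d (?T u) \<le> (m + h) * form_norm d u"
      using u(3) form_norm_pos[OF u(1,2)] by (simp add: field_simps)
    then have "(form_norm d (?T u))\<^sup>2 \<le> ((m + h) * form_norm d u)\<^sup>2"
      using u by (intro power_mono) auto
    then have "qf p u \<le> ((m + h)\<^sup>2 - m\<^sup>2) * (form_norm d u)\<^sup>2"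
      using u by (simp add: qf_p power_mult_distrib left_diff_distrib)
    also have "\<dots> \<le> (\<delta> / M)\<^sup>2 * (form_norm d u)\<^sup>2"
    proof (rule mult_right_mono)
      have "(m + h)\<^sup>2 - m\<^sup>2 = h * (2 * m + h)" by (simp add: power2_eq_square algebra_simps)
      also have "\<dots> \<le> h * (2 * m + 1)" using h by (intro mult_left_mono) auto
      finally show "(m + h)\<^sup>2 - m\<^sup>2 \<le> (\<delta> / M)\<^sup>2" using h by linarith
    qed simp
    finally have "form_norm p u \<le> \<delta> / M * form_norm d u"
      unfolding form_norm_def[of p] using \<delta> M u by (intro real_le_lsqrt) (auto simp: power_mult_distrib power_divide)
    then have "M * form_norm p u \<le> \<delta> * form_norm d u" using M by (simp add: field_simps)
    then show ?thesis using A_bound[OF u(1)] u by (meson order_trans)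
  qed
  have factor: "shift (complex_of_real (\<alpha> + m)) (shift (complex_of_real (\<alpha> - m)) u) = A u" if "u \<in> X" for u
  proof -
    have B0: "B (- u) = - B u" if "u \<in> X" for u using op_scale[OF that, of "-1"] by simp
    have Bd: "B (u - v) = B u - B v" if "u \<in> X" "v \<in> X" for u v
      using op_add[of u "-v"] B0[of v] that by simp
    show ?thesis
      using that by (simp add: A_def shift_def Bd op_add op_scale scaleC_add_left complex_vector.scale_left_diff_distrib
          complex_vector.scale_right_diff_distrib scaleC_scaleC power2_eq_square algebra_simps)
  qed
  \<comment> \<open>If both factors of \<open>A\<close> were bounded below, so would be
    \<open>A\<close>, against \<open>small\<close>.\<close>
  have "approx_eigenvalue X d B (complex_of_real (\<alpha> + m)) \<or> approx_eigenvalue X d B (complex_of_real (\<alpha> - m))"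
  proof (rule ccontr)
    assume "\<not> ?thesis"
    then have "\<not> approx_eigenvalue X d B (complex_of_real (\<alpha> + m))"
      "\<not> approx_eigenvalue X d B (complex_of_real (\<alpha> - m))" by blast+
    from this[THEN not_approx_eigenvalue] obtain \<delta>1 \<delta>2 where \<delta>: "\<delta>1 > 0" "\<delta>2 > 0"
      and low1: "\<forall>u\<in>X. \<delta>1 * form_norm d u \<le> form_norm d (shift (complex_of_real (\<alpha> + m)) u)"
      and low2: "\<forall>u\<in>X. \<delta>2 * form_norm d u \<le> form_norm d (shift (complex_of_real (\<alpha> - m)) u)"
      by blast
    have "\<delta>1 * \<delta>2 / 2 > 0" using \<delta> by simp
    then obtain u where u: "u \<in> X" "u \<noteq> 0" "form_norm d (A u) \<le> \<delta>1 * \<delta>2 / 2 * form_norm d u"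
      using small by blast
    let ?v = "shift (complex_of_real (\<alpha> - m)) u"
    have "\<delta>1 * (\<delta>2 * form_norm d u) \<le> \<delta>1 * form_norm d ?v" using low2 u \<delta> by (intro mult_left_mono) auto
    also have "\<dots> \<le> form_norm d (A u)" using bspec[OF low1 shift_mem[OF u(1), of "complex_of_real (\<alpha> - m)"]] unfolding factor[OF u(1)] .
    also have "\<dots> \<le> \<delta>1 * \<delta>2 / 2 * form_norm d u" by (rule u(3))
    finally have "\<delta>1 * \<delta>2 * form_norm d u \<le> 0" by simp
    moreover have "0 < \<delta>1 * \<delta>2 * form_norm d u" using \<delta> form_norm_pos[OF u(1,2)] by simp
    ultimately show False by linarith
  qed
  then show ?thesis
  proof
    assume "approx_eigenvalue X d B (complex_of_real (\<alpha> + m))"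
    then show ?thesis using that[of "\<alpha> + m"] m0 m_eta by simp
  next
    assume "approx_eigenvalue X d B (complex_of_real (\<alpha> - m))"
    then show ?thesis using that[of "\<alpha> - m"] m0 m_eta by simp
  qed
qed

lemma graph_shift:
  "f \<in> X \<Longrightarrow> u \<in> X \<Longrightarrow> (u, f + c *\<^sub>C u) \<in> {(g, B g) |g. g \<in> X} \<longleftrightarrow> shift c u = f"
  by (auto simp: shift_def algebra_simps)

lemma approx_eigenvalue_in_spectrum:
  assumes "approx_eigenvalue X d B c"
  shows "c \<in> spectrum X d {(g, B g) |g. g \<in> X}"
proof (rule ccontr)
  assume "\<not> ?thesis"
  then obtain K where K: "\<forall>f\<in>X. \<forall>u. (u, f + c *\<^sub>C u) \<in> {(g, B g) |g. g \<in> X} \<longrightarrow> form_norm d u \<le> K * form_norm d f"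
    unfolding spectrum_def resolvent_set_def by blast
  define L where "L = \<bar>K\<bar> + 1"
  have L: "L > 0" by (simp add: L_def)
  obtain u where u: "u \<in> X" "u \<noteq> 0" "form_norm d (shift c u) \<le> 1 / (2 * L) * form_norm d u"
    using assms L unfolding approx_eigenvalue_shift by (meson divide_pos_pos mult_pos_pos zero_less_numeral zero_less_one)
  have "form_norm d u \<le> K * form_norm d (shift c u)"
    using K graph_shift[of "shift c u" u c] u by auto
  also have "\<dots> \<le> L * form_norm d (shift c u)" using u by (intro mult_right_mono) (auto simp: L_def)
  also have "\<dots> \<le> L * (1 / (2 * L) * form_norm d u)" using u L by (intro mult_left_mono) auto
  also have "\<dots> = form_norm d u / 2" using L by simp
  finally show False using form_norm_pos[OF u(1,2)] by simp
qed

text \<open>If \<open>shift c\<close> is bounded below, only surjectivity is at stake. The form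
  \<open>d (shift c u) (shift c v)\<close> is then complete, so Riesz representation solves the
  normal equation: some \<open>u\<close> makes \<open>shift (cnj c)\<close> vanish at
  \<open>shift c u - f\<close>. As \<open>shift (cnj c)\<close> has the same norms as
  \<open>shift c\<close>, it is injective, and \<open>shift c u = f\<close>.\<close>

lemma spectrum_approx_eigenvalue:
  assumes complete: "hilbert_form X d" and c: "c \<in> spectrum X d {(g, B g) |g. g \<in> X}"
  shows "approx_eigenvalue X d B c"
proof (rule ccontr)
  assume "\<not> approx_eigenvalue X d B c"
  then obtain \<delta> where \<delta>: "\<delta> > 0"
    and low: "\<And>u. u \<in> X \<Longrightarrow> \<delta> * form_norm d u \<le> form_norm d (shift c u)"
    using not_approx_eigenvalue by blast
  have inj: "u = 0" if "u \<in> X" "form_norm d (shift c u) = 0" for u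
    using low[OF that(1)] that(2) \<delta> form_norm_pos[OF that(1)] by (auto simp: mult_le_0_iff)
  define q where "q u v = d (shift c u) (shift c v)" for u v
  have fn_q: "form_norm q u = form_norm d (shift c u)" for u by (simp add: form_norm_def qf_def q_def)
  have "hilbert_form X q"
  proof (rule hilbert_form_transfer[OF complete subspace])
    show "nonneg_form_on X q"
      unfolding nonneg_form_on_def sesquilinear_on_def
      by (auto simp: q_def form_simps shift_add shift_scale diagonal)
    show "form_norm d u \<le> 1 / \<delta> * form_norm q u" if "u \<in> X" for u
      using low[OF that] \<delta> by (simp add: fn_q field_simps)
    show "form_norm q u \<le> (C + cmod c) * form_norm d u" if "u \<in> X" for u
      using shift_bounded[OF that] by (simp add: fn_q)
  qed auto
  then interpret q: hilbert_form X q .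
  have surj: "\<exists>u\<in>X. shift c u = f" if f: "f \<in> X" for f
  proof -
    have "\<exists>u\<in>X. \<forall>w\<in>X. q u w = d f (shift c w)"
    proof (rule q.riesz)
      show "cmod (d f (shift c w)) \<le> form_norm d f * form_norm q w" if "w \<in> X" for w
        using Cauchy_Schwarz[of f "shift c w"] f that by (simp add: fn_q)
    qed (use f in \<open>simp_all add: shift_add shift_scale form_simps\<close>)
    then obtain u where u: "u \<in> X" "\<forall>w\<in>X. q u w = d f (shift c w)" by blast
    define h where "h = shift c u - f"
    have h: "h \<in> X" using u f by (simp add: h_def)
    have "d (shift (cnj c) h) w = 0" if "w \<in> X" for w
      using u(2) that h shift_adjoint[of h w "cnj c"] u(1) f by (simp add: h_def q_def form_simps)
    then have "shift (cnj c) h = 0" using h definite by simp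
    then have "h = 0" using inj[OF h] form_norm_shift_cnj[OF h, of c] by simp
    then show ?thesis using u(1) by (auto simp: h_def)
  qed
  have diff: "shift c (u - v) = shift c u - shift c v" if "u \<in> X" "v \<in> X" for u v
    using shift_add[of "u - v" v c] that by simp
  have "\<exists>!u. (u, f + c *\<^sub>C u) \<in> {(g, B g) |g. g \<in> X}" if f: "f \<in> X" for f
  proof (rule ex_ex1I)
    show "\<exists>u. (u, f + c *\<^sub>C u) \<in> {(g, B g) |g. g \<in> X}"
      using surj[OF f] graph_shift[OF f] by blast
  next
    fix u v assume *: "(u, f + c *\<^sub>C u) \<in> {(g, B g) |g. g \<in> X}" "(v, f + c *\<^sub>C v) \<in> {(g, B g) |g. g \<in> X}"
    then have uv: "u \<in> X" "v \<in> X" by auto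
    then have "shift c u = f" "shift c v = f" using * graph_shift[OF f, of _ c] by blast+
    then have "u - v = 0" using inj[of "u - v"] diff[OF uv] uv by simp
    then show "u = v" by simp
  qed
  moreover have "form_norm d u \<le> 1 / \<delta> * form_norm d f"
    if f: "f \<in> X" and "(u, f + c *\<^sub>C u) \<in> {(g, B g) |g. g \<in> X}" for f u
  proof -
    have u: "u \<in> X" using that by auto
    then have "shift c u = f" using that graph_shift[OF f, of _ c] by blast
    then show ?thesis using low[OF u] \<delta> by (simp add: field_simps)
  qed
  ultimately have "c \<in> resolvent_set X d {(g, B g) |g. g \<in> X}"
    unfolding resolvent_set_def by blast
  then show False using c by (simp add: spectrum_def)
qed

end

section \<open>Solution operators of forms\<close>

text \<open>The domination of \<open>d\<close> by \<open>q\<close> makes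
  \<open>w \<mapsto> d f w\<close> continuous for \<open>q\<close>, so the Riesz theorem in
  \<open>D\<close> solves the equation for every \<open>f\<close> of \<open>X\<close>.\<close>

locale form_solution =
  amb: definite_form X d + dom: hilbert_form D q
  for X :: "'a::complex_vector set" and d and D and q +
  assumes D_sub: "D \<subseteq> X" and norm_le: "u \<in> D \<Longrightarrow> form_norm d u \<le> form_norm q u"
begin

definition sol :: "'a \<Rightarrow> 'a" where
  "sol f = (THE u. u \<in> D \<and> (\<forall>w\<in>D. q u w = d f w))"

lemma sol_exists:
  assumes f: "f \<in> X" shows "\<exists>u\<in>D. \<forall>w\<in>D. q u w = d f w"
proof (rule dom.riesz)
  show "cmod (d f w) \<le> form_norm d f * form_norm q w" if "w \<in> D" for w
  proof -
    have "cmod (d f w) \<le> form_norm d f * form_norm d w" using f that D_sub by (intro amb.Cauchy_Schwarz) auto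
    also have "\<dots> \<le> form_norm d f * form_norm q w" using f norm_le[OF that] by (intro mult_left_mono) auto
    finally show ?thesis .
  qed
qed (use f D_sub in \<open>auto simp: amb.form_simps subset_iff\<close>)

lemma sol_unique:
  assumes "f \<in> X" "u \<in> D" "\<And>w. w \<in> D \<Longrightarrow> q u w = d f w"
  shows "sol f = u"
  unfolding sol_def using assms by (intro the_equality) (auto intro: dom.form_eqI)

lemma sol:
  assumes "f \<in> X"
  shows sol_mem: "sol f \<in> D" and sol_eq: "w \<in> D \<Longrightarrow> q (sol f) w = d f w"
  using sol_exists[OF assms] sol_unique[OF assms] by auto

text \<open>Obtained by testing the equation with the solution itself. It makes \<open>sol\<close> a
  contraction, whence the bound 1 in the sublocale below.\<close>

lemma sol_energy:
  assumes f: "f \<in> X" shows "form_norm q (sol f) \<le> form_norm d f"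
proof (cases "sol f = 0")
  case True then show ?thesis using f by simp
next
  case False
  note s = sol_mem[OF f]
  have "qf q (sol f) = Re (d f (sol f))" using sol_eq[OF f s] by (simp add: qf_def)
  also have "\<dots> \<le> form_norm d f * form_norm d (sol f)" using f s D_sub by (intro amb.Cauchy_Schwarz_Re) auto
  also have "\<dots> \<le> form_norm d f * form_norm q (sol f)" using f norm_le[OF s] by (intro mult_left_mono) auto
  finally have "form_norm q (sol f) * form_norm q (sol f) \<le> form_norm d f * form_norm q (sol f)"
    using s by (simp flip: dom.form_norm_sq power2_eq_square)
  then show ?thesis using dom.form_norm_pos[OF s False] by (simp add: mult_le_cancel_right)
qed

sublocale selfadjoint_operator X d sol 1
proof
  fix f g c assume f: "f \<in> X"
  show "sol f \<in> X" using sol_mem[OF f] D_sub by blast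
  show "sol (c *\<^sub>C f) = c *\<^sub>C sol f"
    using f sol_mem[OF f] sol_eq[OF f] D_sub
    by (intro sol_unique) (auto simp: amb.form_simps dom.form_simps subset_iff)
  show "form_norm d (sol f) \<le> 1 * form_norm d f"
    using sol_energy[OF f] norm_le[OF sol_mem[OF f]] by simp
  assume g: "g \<in> X"
  show "sol (f + g) = sol f + sol g"
    using f g sol_mem[OF f] sol_eq[OF f] sol_mem[OF g] sol_eq[OF g] D_sub
    by (intro sol_unique) (auto simp: amb.form_simps dom.form_simps subset_iff)
  have "d (sol f) g = cnj (d g (sol f))"
    using g sol_mem[OF f] D_sub by (intro amb.hermitian) auto
  also have "\<dots> = cnj (q (sol g) (sol f))" using sol_eq[OF g sol_mem[OF f]] by simp
  also have "\<dots> = q (sol f) (sol g)" using sol_mem f g by (intro dom.hermitian[symmetric]) auto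
  also have "\<dots> = d f (sol g)" using sol_eq[OF f sol_mem[OF g]] .
  finally show "d (sol f) g = d f (sol g)" .
qed simp

lemma inverse_form_operator: "(form_operator X d D q)\<inverse> = {(g, sol g) |g. g \<in> X}"
  unfolding form_operator_def using sol_mem sol_eq by (auto simp: sol_unique)

end

text \<open>Both candidates for the image have the same product with every \<open>U w\<close>; as
  \<open>U\<close> is onto, definiteness of \<open>d2\<close> identifies them. This supplies
  linearity of the extension of \<open>E \<theta>\<close> to the ambient space.\<close>

lemma isometry_linear:
  assumes "definite_form X1 d1" "definite_form X2 d2" "U ` X1 = X2"
    and iso: "\<And>u v. u \<in> X1 \<Longrightarrow> v \<in> X1 \<Longrightarrow> d2 (U u) (U v) = d1 u v"
  shows "linear_on_set X1 U"
proof -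
  interpret d1: definite_form X1 d1 by fact
  interpret d2: definite_form X2 d2 by fact
  have mem: "U u \<in> X2" if "u \<in> X1" for u using that assms(3) by blast
  show ?thesis
    unfolding linear_on_set_def
  proof (intro conjI allI ballI)
    fix u v assume uv: "u \<in> X1" "v \<in> X1"
    have "d2 (U (u + v)) (U w) = d2 (U u + U v) (U w)" if "w \<in> X1" for w
      using uv that by (simp add: iso mem d1.form_simps d2.form_simps)
    then show "U (u + v) = U u + U v"
      using uv assms(3) by (intro d2.form_eqI) (auto simp: mem)
  next
    fix c u assume u: "u \<in> X1"
    have "d2 (U (c *\<^sub>C u)) (U w) = d2 (c *\<^sub>C U u) (U w)" if "w \<in> X1" for w
      using u that by (simp add: iso mem d1.form_simps d2.form_simps)
    then show "U (c *\<^sub>C u) = c *\<^sub>C U u"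
      using u assms(3) by (intro d2.form_eqI) (auto simp: mem)
  qed
qed

text \<open>\<open>U\<close> sends a \<delta>-approximate eigenvector of \<open>B1\<close> to one of
  \<open>B2\<close> with error \<eta> + \<delta>, and \<open>approx_eigenvalue_near\<close> finds a
  true approximate eigenvalue within that distance. The slack \<delta> is there because
  \<open>B1\<close> itself need not have an eigenvector.\<close>

lemma approx_eigenvalue_transfer:
  fixes U :: "'a::complex_vector \<Rightarrow> 'a" and \<eta> \<delta> :: real
  assumes "selfadjoint_operator X1 d1 B1 C1" "selfadjoint_operator X2 d2 B2 C2"
    and U: "U ` X1 = X2"
    and iso: "\<And>u v. u \<in> X1 \<Longrightarrow> v \<in> X1 \<Longrightarrow> d2 (U u) (U v) = d1 u v"
    and close: "\<And>u. u \<in> X1 \<Longrightarrow> form_norm d2 (B2 (U u) - U (B1 u)) \<le> \<eta> * form_norm d1 u"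
    and c: "approx_eigenvalue X1 d1 B1 c" and \<delta>: "\<delta> > 0"
  shows "\<exists>c'. approx_eigenvalue X2 d2 B2 c' \<and> dist c c' \<le> \<eta> + \<delta>"
proof -
  interpret o1: selfadjoint_operator X1 d1 B1 C1 by fact
  interpret o2: selfadjoint_operator X2 d2 B2 C2 by fact
  have lin: "linear_on_set X1 U"
    by (rule isometry_linear[OF o1.definite_form_axioms o2.definite_form_axioms U iso])
  have U_add: "U (u + v) = U u + U v" if "u \<in> X1" "v \<in> X1" for u v
    using lin that by (simp add: linear_on_set_def)
  have U_scale: "U (k *\<^sub>C u) = k *\<^sub>C U u" if "u \<in> X1" for u k
    using lin that by (simp add: linear_on_set_def)
  have mem: "U u \<in> X2" if "u \<in> X1" for u using that U by blast
  have norm_U: "form_norm d2 (U u) = form_norm d1 u" if "u \<in> X1" for u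
    using iso[OF that that] by (simp add: form_norm_def qf_def)
  define \<alpha> where "\<alpha> = Re c"
  have c_eq: "c = complex_of_real \<alpha>" using o1.approx_eigenvalue_real[OF c] by (simp add: \<alpha>_def)
  obtain u where u: "u \<in> X1" "u \<noteq> 0" "form_norm d1 (B1 u - c *\<^sub>C u) \<le> \<delta> * form_norm d1 u"
    using c \<delta> unfolding approx_eigenvalue_def by blast
  have Uu: "U u \<in> X2" "U u \<noteq> 0"
    using mem u norm_U[of u] o1.form_norm_pos[OF u(1,2)] by auto
  have "form_norm d2 (o2.shift (complex_of_real \<alpha>) (U u)) \<le> (\<eta> + \<delta>) * form_norm d2 (U u)"
  proof -
    have "B1 u = (B1 u - c *\<^sub>C u) + c *\<^sub>C u" by simp
    then have "U (B1 u) = U (B1 u - c *\<^sub>C u) + c *\<^sub>C U u"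
      using U_add[of "B1 u - c *\<^sub>C u" "c *\<^sub>C u"] U_scale[of u c] u(1) by simp
    then have eq: "o2.shift (complex_of_real \<alpha>) (U u) = (B2 (U u) - U (B1 u)) + U (B1 u - c *\<^sub>C u)"
      by (simp add: o2.shift_def c_eq)
    have "form_norm d2 ((B2 (U u) - U (B1 u)) + U (B1 u - c *\<^sub>C u))
        \<le> form_norm d2 (B2 (U u) - U (B1 u)) + form_norm d2 (U (B1 u - c *\<^sub>C u))"
      using u(1) by (intro o2.form_norm_triangle) (auto simp: mem)
    moreover have "form_norm d2 (U (B1 u - c *\<^sub>C u)) \<le> \<delta> * form_norm d1 u"
      using u by (simp add: norm_U)
    ultimately show ?thesis
      unfolding eq distrib_right norm_U[OF u(1)] using close[OF u(1)] by linarith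
  qed
  then obtain \<beta> where "\<bar>\<beta> - \<alpha>\<bar> \<le> \<eta> + \<delta>" "approx_eigenvalue X2 d2 B2 (complex_of_real \<beta>)"
    using o2.approx_eigenvalue_near[OF Uu] by metis
  then show ?thesis
    by (intro exI[of _ "complex_of_real \<beta>"]) (simp add: c_eq dist_complex_def norm_minus_commute flip: of_real_diff)
qed

text \<open>The forward transfer is applied to the inverse of \<open>U\<close>: by isometry, the
  commutation error of the inverse has the same norm as that of \<open>U\<close>.\<close>

lemma approx_eigenvalue_transfer_back:
  fixes U :: "'a::complex_vector \<Rightarrow> 'a" and \<eta> \<delta> :: real
  assumes o1: "selfadjoint_operator X1 d1 B1 C1" and o2: "selfadjoint_operator X2 d2 B2 C2"
    and U: "bij_betw U X1 X2"
    and iso: "\<And>u v. u \<in> X1 \<Longrightarrow> v \<in> X1 \<Longrightarrow> d2 (U u) (U v) = d1 u v"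
    and close: "\<And>u. u \<in> X1 \<Longrightarrow> form_norm d2 (B2 (U u) - U (B1 u)) \<le> \<eta> * form_norm d1 u"
    and c: "approx_eigenvalue X2 d2 B2 c" and \<delta>: "\<delta> > 0"
  shows "\<exists>c'. approx_eigenvalue X1 d1 B1 c' \<and> dist c c' \<le> \<eta> + \<delta>"
proof (rule approx_eigenvalue_transfer[OF o2 o1 _ _ _ c \<delta>])
  interpret o1: selfadjoint_operator X1 d1 B1 C1 by fact
  interpret o2: selfadjoint_operator X2 d2 B2 C2 by fact
  let ?U' = "inv_into X1 U"
  have img: "U ` X1 = X2" using U by (simp add: bij_betw_def)
  have U': "?U' u \<in> X1" "U (?U' u) = u" if "u \<in> X2" for u
    using that img f_inv_into_f[of u U X1] inv_into_into[of u U X1] by auto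
  have U'U: "?U' (U u) = u" if "u \<in> X1" for u using U that by (simp add: bij_betw_def)
  show "?U' ` X2 = X1" using U' U'U img by (force simp: image_iff)
  show "d1 (?U' u) (?U' v) = d2 u v" if "u \<in> X2" "v \<in> X2" for u v
    using iso[of "?U' u" "?U' v"] U' that by simp
  have lin: "linear_on_set X1 U"
    by (rule isometry_linear[OF o1.definite_form_axioms o2.definite_form_axioms img iso])
  show "form_norm d1 (B1 (?U' u) - ?U' (B2 u)) \<le> \<eta> * form_norm d2 u" if u: "u \<in> X2" for u
  proof -
    let ?x = "B1 (?U' u)" and ?y = "?U' (B2 u)"
    have xy: "?x \<in> X1" "?y \<in> X1" "U ?y = B2 u" using U' u by auto
    have "?x = (?x - ?y) + ?y" by simp
    then have "U (?x - ?y) = U ?x - B2 u"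
      using lin xy unfolding linear_on_set_def by (metis add_diff_cancel_right' o1.diff_mem)
    then have "form_norm d1 (?x - ?y) = form_norm d2 (U ?x - B2 u)"
      using iso[of "?x - ?y" "?x - ?y"] xy by (simp add: form_norm_def qf_def)
    also have "\<dots> = form_norm d2 (B2 u - U ?x)"
      using xy u img by (intro o2.form_norm_commute) auto
    also have "\<dots> \<le> \<eta> * form_norm d1 (?U' u)" using close[of "?U' u"] U' u by simp
    also have "form_norm d1 (?U' u) = form_norm d2 u"
      using iso[of "?U' u" "?U' u"] U' u by (simp add: form_norm_def qf_def)
    finally show ?thesis .
  qed
qed

lemma approx_eigenvalue_mono:
  "approx_eigenvalue X' d B c \<Longrightarrow> X' \<subseteq> X \<Longrightarrow> approx_eigenvalue X d B c"
  unfolding approx_eigenvalue_def by (meson subset_iff)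

context form_solution
begin

text \<open>\<open>sol\<close> does not mention \<open>X\<close>, so it is the solution operator in every space between \<open>D\<close> and \<open>X\<close>.
  If \<open>u\<close> almost solves \<open>sol u = c u\<close> with \<open>c \<noteq> 0\<close>, then so does \<open>sol u \<in> D\<close>.\<close>

lemma approx_eigenvalue_restrict:
  assumes ev: "approx_eigenvalue X d sol c" and c: "c \<noteq> 0" and X': "D \<subseteq> X'"
  shows "approx_eigenvalue X' d sol c"
  unfolding approx_eigenvalue_def
proof (intro allI impI)
  fix \<delta> :: real assume \<delta>: "\<delta> > 0"
  \<comment> \<open>The first entry keeps \<open>form_norm d (sol u)\<close> above
    \<open>cmod c / 2 * form_norm d u\<close>, so that \<open>sol u\<close> does not vanish; the
    second compares the error with this lower bound.\<close>
  define h where "h = min (cmod c / 2) (\<delta> * cmod c / 2)"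
  have h: "h > 0" "h \<le> cmod c / 2" "h \<le> \<delta> * cmod c / 2" using \<delta> c by (auto simp: h_def)
  obtain u where u: "u \<in> X" "u \<noteq> 0" "form_norm d (shift c u) \<le> h * form_norm d u"
    using ev h(1) unfolding approx_eigenvalue_shift by blast
  note u_pos = amb.form_norm_pos[OF u(1,2)]
  have "form_norm d (c *\<^sub>C u) \<le> form_norm d (sol u) + form_norm d (shift c u)"
    using amb.form_norm_triangle_diff[of "sol u" "shift c u"] u(1) by (simp add: shift_def)
  then have "cmod c * form_norm d u \<le> form_norm d (sol u) + cmod c / 2 * form_norm d u"
    using u(3) u_pos mult_right_mono[OF h(2), of "form_norm d u"]
    unfolding amb.form_norm_scale[OF u(1)] by linarith
  then have low: "cmod c / 2 * form_norm d u \<le> form_norm d (sol u)" by simp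
  then have "0 < form_norm d (sol u)" using u_pos c
    by (meson less_le_trans mult_pos_pos half_gt_zero zero_less_norm_iff)
  then have ne: "sol u \<noteq> 0" by auto
  \<comment> \<open>\<open>sol\<close> commutes with \<open>shift c\<close> and is a contraction, so
    the error does not grow.\<close>
  have "sol (shift c u) = sol (sol u) - c *\<^sub>C sol u"
    using op_add[of "shift c u" "c *\<^sub>C u"] op_scale[OF u(1), of c] u(1) by (simp add: shift_def)
  then have "form_norm d (sol (sol u) - c *\<^sub>C sol u) \<le> form_norm d (shift c u)"
    using bounded[of "shift c u"] u(1) by simp
  also have "\<dots> \<le> h * form_norm d u" by (rule u(3))
  also have "\<dots> \<le> \<delta> * cmod c / 2 * form_norm d u" using h u_pos by (intro mult_right_mono) auto
  also have "\<dots> \<le> \<delta> * form_norm d (sol u)" using low \<delta> by simp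
  finally show "\<exists>u\<in>X'. u \<noteq> 0 \<and> form_norm d (sol u - c *\<^sub>C u) \<le> \<delta> * form_norm d u"
    using ne sol_mem[OF u(1)] X' by blast
qed

end

section \<open>The corrector and the homogenised form\<close>

lemma sesquilinear_on_sum:
  assumes "\<And>i. sesquilinear_on S T (q i)"
  shows "sesquilinear_on S T (\<lambda>u v. \<Sum>i\<in>I. q i u v * k i)"
  using assms unfolding sesquilinear_on_def
  by (simp add: sum.distrib sum_distrib_left ring_distribs mult.assoc)

lemma nonpos_of_tendsto_0:
  fixes c k :: real
  assumes "x \<longlonglongrightarrow> 0" "\<And>n. c \<le> k * x n" shows "c \<le> 0"
proof (rule LIMSEQ_le_const)
  show "(\<lambda>n. k * x n) \<longlonglongrightarrow> 0" using tendsto_mult_left[OF assms(1), of k] by simp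
qed (use assms(2) in blast)

text \<open>Lets a bound with weight \<open>1 + (norm \<xi>)\<^sup>2\<close> control the weight
  \<open>norm \<xi>\<close> too.\<close>

lemma le_one_plus_square: "(t::real) \<le> 1 + t\<^sup>2"
  using zero_le_power2[of "t - 1 / 2"] by (simp add: power2_eq_square algebra_simps)

lemma hausdorff_distance_le:
  assumes "\<And>x. x \<in> X \<Longrightarrow> \<exists>y\<in>Y. dist x y \<le> r" "\<And>y. y \<in> Y \<Longrightarrow> \<exists>x\<in>X. dist y x \<le> r"
  shows "hausdorff_distance X Y \<le> ereal r"
proof -
  have le: "infdist x A \<le> r" if "\<exists>y\<in>A. dist x y \<le> r" for x :: 'a and A
    using that infdist_le order_trans by blast
  show ?thesis
    unfolding hausdorff_distance_def using assms le by (intro max.boundedI SUP_least) auto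
qed

text \<open>The hypotheses of the theorem with their constants fixed.  In \<open>near\<close> the infimum of the removable
  singularity condition has become a bound that is attained, at the price of a larger \<open>Ls\<close>.\<close>

locale homogenisation =
  fixes H :: "'a::complex_vector set" and \<Theta> :: "(real ^ 'n) set"
    and a b d :: "real ^ 'n \<Rightarrow> 'a \<Rightarrow> 'a \<Rightarrow> complex"
    and Vs Z :: "'a set"
    and a' :: "'a \<Rightarrow> 'a \<Rightarrow> complex ^ 'n" and a'' :: "'a \<Rightarrow> 'a \<Rightarrow> complex ^ 'n ^ 'n"
    and E :: "real ^ 'n \<Rightarrow> 'a \<Rightarrow> 'a"
    and K La Ls KZ \<nu> \<gamma> Ka' Ka'' Lb Kb Ke r0 :: real
  assumes r0: "0 < r0" "r0 \<le> 1" and ball: "norm \<theta> \<le> r0 \<Longrightarrow> \<theta> \<in> \<Theta>"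
    and a_form: "\<theta> \<in> \<Theta> \<Longrightarrow> nonneg_form H (a \<theta>)"
    and b_form: "\<theta> \<in> \<Theta> \<Longrightarrow> nonneg_form H (b \<theta>)"
    and hilbert: "\<theta> \<in> \<Theta> \<Longrightarrow> hilbert_form H (sum_form a b \<theta>)"
    and K: "1 \<le> K"
    and comparable: "u \<in> H \<Longrightarrow> \<theta>\<^sub>1 \<in> \<Theta> \<Longrightarrow> \<theta>\<^sub>2 \<in> \<Theta> \<Longrightarrow>
      form_norm (sum_form a b \<theta>\<^sub>1) u \<le> K * form_norm (sum_form a b \<theta>\<^sub>2) u"
    and La: "0 \<le> La"
    and lipschitz: "u \<in> H \<Longrightarrow> v \<in> H \<Longrightarrow> \<theta> \<in> \<Theta> \<Longrightarrow> cmod (a \<theta> u v - a 0 u v) \<le>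
      La * norm \<theta> * form_norm (sum_form a b 0) u * form_norm (sum_form a b 0) v"
    and d_form: "\<theta> \<in> \<Theta> \<Longrightarrow> definite_form UNIV (d \<theta>)"
    and d_le_b: "\<theta> \<in> \<Theta> \<Longrightarrow> u \<in> H \<Longrightarrow> form_norm (d \<theta>) u \<le> form_norm (b \<theta>) u"
    and \<nu>: "0 < \<nu>"
    and gap: "w \<in> W_space H a b 0 \<Longrightarrow> \<nu> * (form_norm (sum_form a b 0) w)\<^sup>2 \<le> qf (a 0) w"
    and Vs_subspace: "complex_vector.subspace Vs"
    and Vs_closed: "range x \<subseteq> Vs \<Longrightarrow> l \<in> H \<Longrightarrow>
      (\<lambda>n::nat. form_norm (sum_form a b 0) (x n - l)) \<longlonglongrightarrow> 0 \<Longrightarrow> l \<in> Vs"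
    and Ls: "0 \<le> Ls"
    and near: "\<theta>\<^sub>1 \<in> \<Theta> \<Longrightarrow> \<theta>\<^sub>2 \<in> \<Theta> \<Longrightarrow> v \<in> Vstar_space H a Vs \<theta>\<^sub>1 \<Longrightarrow>
      \<exists>v'\<in>Vstar_space H a Vs \<theta>\<^sub>2. form_norm (sum_form a b \<theta>\<^sub>2) (v - v')
        \<le> Ls * norm (\<theta>\<^sub>1 - \<theta>\<^sub>2) * form_norm (sum_form a b \<theta>\<^sub>1) v"
    and Z_subspace: "complex_vector.subspace Z"
    and V0_eq: "V_space H a 0 = sum_space Vs Z" and Vs_Z: "Vs \<inter> Z = {0}"
    and KZ: "0 \<le> KZ" "KZ < 1"
    and angle: "v \<in> Vs \<Longrightarrow> z \<in> Z \<Longrightarrow> cmod (sum_form a b 0 v z)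
      \<le> KZ * form_norm (sum_form a b 0) v * form_norm (sum_form a b 0) z"
    and \<gamma>: "0 < \<gamma>"
    and degeneracy: "\<theta> \<in> \<Theta> \<Longrightarrow> w \<in> W_space H a b \<theta> \<Longrightarrow>
      \<gamma> * (norm \<theta>)\<^sup>2 * (form_norm (sum_form a b \<theta>) w)\<^sup>2 \<le> qf (a \<theta>) w"
    and a'_sesquilinear: "sesquilinear_on (V_space H a 0) H (\<lambda>v u. a' v u $ i)"
    and a''_sesquilinear: "sesquilinear_on (V_space H a 0) (V_space H a 0) (\<lambda>v u. a'' v u $ i $ j)"
    and Ka': "0 \<le> Ka'" and Ka'': "0 \<le> Ka''"
    and a'_expansion: "v \<in> V_space H a 0 \<Longrightarrow> u \<in> H \<Longrightarrow> \<theta> \<in> \<Theta> \<Longrightarrow>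
      cmod (a \<theta> v u - cdot (a' v u) \<theta>)
        \<le> Ka' * (norm \<theta>)\<^sup>2 * form_norm (sum_form a b 0) v * form_norm (sum_form a b 0) u"
    and a''_expansion: "v \<in> V_space H a 0 \<Longrightarrow> u \<in> V_space H a 0 \<Longrightarrow> \<theta> \<in> \<Theta> \<Longrightarrow>
      cmod (a \<theta> v u - cdot (a'' v u *v cvec \<theta>) \<theta>)
        \<le> Ka'' * (norm \<theta>) ^ 3 * form_norm (sum_form a b 0) v * form_norm (sum_form a b 0) u"
    and Lb: "0 \<le> Lb"
    and b_expansion: "v \<in> V_space H a 0 \<Longrightarrow> u \<in> V_space H a 0 \<Longrightarrow> \<theta> \<in> \<Theta> \<Longrightarrow>
      cmod (b \<theta> v u - b 0 v u) \<le> Lb * norm \<theta> * form_norm (sum_form a b 0) v * form_norm (sum_form a b 0) u"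
    and E_Vs: "\<theta> \<in> \<Theta> \<Longrightarrow> bij_betw (E \<theta>) Vs (Vstar_space H a Vs \<theta>)"
    and E_b: "\<theta> \<in> \<Theta> \<Longrightarrow> v \<in> Vs \<Longrightarrow> v' \<in> Vs \<Longrightarrow> b \<theta> (E \<theta> v) (E \<theta> v') = b 0 v v'"
    and Kb: "0 \<le> Kb"
    and E_b_Z: "\<theta> \<in> \<Theta> \<Longrightarrow> v \<in> Vs \<Longrightarrow> z \<in> Z \<Longrightarrow> cmod (b \<theta> (E \<theta> v) z - b 0 v z)
      \<le> Kb * norm \<theta> * form_norm (sum_form a b 0) v * form_norm (sum_form a b 0) z"
    and E_bij: "\<theta> \<in> \<Theta> \<Longrightarrow> bij (E \<theta>)"
    and E_d: "\<theta> \<in> \<Theta> \<Longrightarrow> d \<theta> (E \<theta> u) (E \<theta> u') = d 0 u u'"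
    and Ke: "0 \<le> Ke"
    and E_near: "\<theta> \<in> \<Theta> \<Longrightarrow> form_norm (d \<theta>) (E \<theta> u - u) \<le> Ke * norm \<theta> * form_norm (d 0) u"
begin

section \<open>Norms of the family and their comparison\<close>

abbreviation nm where "nm \<theta> \<equiv> form_norm (sum_form a b \<theta>)"
abbreviation n0 where "n0 \<equiv> form_norm (sum_form a b 0)"
abbreviation V where "V \<equiv> V_space H a"
abbreviation W where "W \<equiv> W_space H a b"

lemma zero_Theta [simp]: "0 \<in> \<Theta>"
  using r0 by (intro ball) simp

sublocale s0: hilbert_form H "sum_form a b 0" by (rule hilbert) simp
sublocale a0: nonneg_form H "a 0" by (rule a_form) simp
sublocale b0: nonneg_form H "b 0" by (rule b_form) simp
sublocale d0: definite_form UNIV "d 0" by (rule d_form) simp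

lemma qf_sum: "qf (sum_form a b \<theta>) u = qf (a \<theta>) u + qf (b \<theta>) u"
  by (simp add: qf_def sum_form_def)

lemma nm_nonneg [simp]: "\<theta> \<in> \<Theta> \<Longrightarrow> u \<in> H \<Longrightarrow> 0 \<le> nm \<theta> u"
  using hilbert[of \<theta>] unfolding hilbert_form_def definite_form_def
  by (blast intro: nonneg_form.form_norm_nonneg)

lemma fn_a_le: assumes "\<theta> \<in> \<Theta>" "u \<in> H" shows "form_norm (a \<theta>) u \<le> nm \<theta> u"
proof -
  interpret b: nonneg_form H "b \<theta>" using assms(1) by (rule b_form)
  show ?thesis using assms by (simp add: form_norm_def qf_sum)
qed

lemma fn_b_le: assumes "\<theta> \<in> \<Theta>" "u \<in> H" shows "form_norm (b \<theta>) u \<le> nm \<theta> u"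
proof -
  interpret a: nonneg_form H "a \<theta>" using assms(1) by (rule a_form)
  show ?thesis using assms by (simp add: form_norm_def qf_sum)
qed

lemma fn_d_le: "\<theta> \<in> \<Theta> \<Longrightarrow> u \<in> H \<Longrightarrow> form_norm (d \<theta>) u \<le> nm \<theta> u"
  using d_le_b fn_b_le order_trans by blast

lemma nm_le: "\<theta> \<in> \<Theta> \<Longrightarrow> u \<in> H \<Longrightarrow> nm \<theta> u \<le> K * n0 u"
  and n0_le: "\<theta> \<in> \<Theta> \<Longrightarrow> u \<in> H \<Longrightarrow> n0 u \<le> K * nm \<theta> u"
  by (simp_all add: comparable)

lemma a_bound: assumes "\<theta> \<in> \<Theta>" "u \<in> H" "v \<in> H" shows "cmod (a \<theta> u v) \<le> form_norm (a \<theta>) u * form_norm (a \<theta>) v"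
proof -
  interpret a: nonneg_form H "a \<theta>" using assms(1) by (rule a_form)
  show ?thesis using assms by (intro a.Cauchy_Schwarz)
qed

lemma b_bound: assumes "\<theta> \<in> \<Theta>" "u \<in> H" "v \<in> H" shows "cmod (b \<theta> u v) \<le> form_norm (b \<theta>) u * form_norm (b \<theta>) v"
proof -
  interpret b: nonneg_form H "b \<theta>" using assms(1) by (rule b_form)
  show ?thesis using assms by (intro b.Cauchy_Schwarz)
qed

lemma fn_a_n0: assumes "\<theta> \<in> \<Theta>" "u \<in> H" shows "form_norm (a \<theta>) u \<le> K * n0 u"
  using fn_a_le[OF assms] nm_le[OF assms] by linarith

lemma fn_b_n0: assumes "\<theta> \<in> \<Theta>" "u \<in> H" shows "form_norm (b \<theta>) u \<le> K * n0 u"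
  using fn_b_le[OF assms] nm_le[OF assms] by linarith

lemma
  assumes "\<theta> \<in> \<Theta>" "u \<in> H"
  shows fn_a_nonneg: "0 \<le> form_norm (a \<theta>) u" and fn_b_nonneg: "0 \<le> form_norm (b \<theta>) u"
  using assms a_form b_form nonneg_form.form_norm_nonneg by blast+

lemma a_bound0:
  assumes "\<theta> \<in> \<Theta>" "u \<in> H" "v \<in> H" shows "cmod (a \<theta> u v) \<le> K\<^sup>2 * n0 u * n0 v"
proof -
  have "cmod (a \<theta> u v) \<le> (K * n0 u) * (K * n0 v)"
    using a_bound[OF assms] fn_a_n0 assms K
    by (elim order_trans) (intro mult_mono, auto simp: fn_a_nonneg)
  then show ?thesis by (simp add: power2_eq_square mult_ac)
qed

section \<open>Null spaces and their orthogonal complements\<close>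

lemma V_sub: "v \<in> V \<theta> \<Longrightarrow> v \<in> H"
  by (simp add: V_space_def)

lemma W_sub: "w \<in> W \<theta> \<Longrightarrow> w \<in> H"
  by (simp add: W_space_def)

lemma V_null_left: assumes "\<theta> \<in> \<Theta>" "v \<in> V \<theta>" "u \<in> H" shows "a \<theta> v u = 0"
proof -
  interpret a: nonneg_form H "a \<theta>" using assms(1) by (rule a_form)
  show ?thesis by (rule a.null_left) (use assms in \<open>auto simp: V_space_def\<close>)
qed

lemma V_null_right: assumes "\<theta> \<in> \<Theta>" "v \<in> V \<theta>" "u \<in> H" shows "a \<theta> u v = 0"
proof -
  interpret a: nonneg_form H "a \<theta>" using assms(1) by (rule a_form)
  show ?thesis by (rule a.null_right) (use assms in \<open>auto simp: V_space_def\<close>)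
qed

lemma V_subspace: assumes "\<theta> \<in> \<Theta>" shows "complex_vector.subspace (V \<theta>)"
proof -
  interpret a: nonneg_form H "a \<theta>" using assms(1) by (rule a_form)
  show ?thesis
  proof (rule complex_vector.subspaceI)
    show "0 \<in> V \<theta>" by (simp add: V_space_def)
    show "u + v \<in> V \<theta>" if "u \<in> V \<theta>" "v \<in> V \<theta>" for u v
      unfolding V_space_def using that V_sub V_null_left[OF assms] by (simp add: a.form_simps)
    show "c *\<^sub>C u \<in> V \<theta>" if "u \<in> V \<theta>" for c u
      unfolding V_space_def using that V_sub V_null_left[OF assms] by (simp add: a.form_simps)
  qed
qed

lemma W_subspace: assumes "\<theta> \<in> \<Theta>" shows "complex_vector.subspace (W \<theta>)"
proof -
  interpret s: hilbert_form H "sum_form a b \<theta>" using assms(1) by (rule hilbert)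
  show ?thesis
    by (rule complex_vector.subspaceI) (auto simp: W_space_def V_space_def s.form_simps)
qed

text \<open>\<open>V \<theta>\<close> is closed because the seminorm of \<open>a \<theta>\<close> is
  dominated by \<open>nm \<theta>\<close> and vanishes exactly there.\<close>

lemma hilbert_V: assumes "\<theta> \<in> \<Theta>" shows "hilbert_form (V \<theta>) (sum_form a b \<theta>)"
proof -
  interpret s: hilbert_form H "sum_form a b \<theta>" using assms(1) by (rule hilbert)
  interpret a: nonneg_form H "a \<theta>" using assms(1) by (rule a_form)
  show ?thesis
  proof (rule hilbert_form_transfer[OF hilbert[OF assms] V_subspace[OF assms]])
    show "nonneg_form_on (V \<theta>) (sum_form a b \<theta>)"
      using s.restrict[OF V_subspace[OF assms]] V_sub unfolding nonneg_form_def by blast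
    fix x l assume x: "range x \<subseteq> V \<theta>" and l: "l \<in> H" and lim: "(\<lambda>n::nat. nm \<theta> (x n - l)) \<longlonglongrightarrow> 0"
    have xV: "x n \<in> V \<theta>" for n using x by blast
    have "form_norm (a \<theta>) l \<le> 1 * nm \<theta> (x n - l)" for n
    proof -
      have xH: "x n \<in> H" using xV V_sub by blast
      have "form_norm (a \<theta>) (x n) = 0" using xV by (simp add: form_norm_def qf_def V_space_def)
      then have "form_norm (a \<theta>) l \<le> form_norm (a \<theta>) (x n - l)"
        using a.form_norm_triangle_diff[of "x n" "x n - l"] xH l by simp
      also have "\<dots> \<le> nm \<theta> (x n - l)" using xH l assms by (intro fn_a_le) auto
      finally show ?thesis by simp
    qed
    then have "form_norm (a \<theta>) l \<le> 0" by (rule nonpos_of_tendsto_0[OF lim])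
    then have "qf (a \<theta>) l = 0" using a.qf_nonneg[OF l] by (simp add: form_norm_def)
    then show "l \<in> V \<theta>" using l a.diagonal[OF l] by (simp add: V_space_def)
  next
    show "nm \<theta> u \<le> 1 * nm \<theta> u" for u by simp
    show "nm \<theta> u \<le> 1 * nm \<theta> u" for u by simp
  qed (use V_sub in auto)
qed

text \<open>The orthogonal projection to \<open>V \<theta>\<close> is the Riesz representative,
  within \<open>V \<theta>\<close>, of the functional given by \<open>u\<close>; Pythagoras yields
  both norm bounds.\<close>

lemma decompose:
  assumes \<theta>: "\<theta> \<in> \<Theta>" and u: "u \<in> H"
  obtains v w where "v \<in> V \<theta>" "w \<in> W \<theta>" "u = v + w" "nm \<theta> v \<le> nm \<theta> u" "nm \<theta> w \<le> nm \<theta> u"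
proof -
  interpret s: hilbert_form H "sum_form a b \<theta>" using \<theta> by (rule hilbert)
  interpret V: hilbert_form "V \<theta>" "sum_form a b \<theta>" using \<theta> by (rule hilbert_V)
  have "\<exists>v\<in>V \<theta>. \<forall>v'\<in>V \<theta>. sum_form a b \<theta> v v' = sum_form a b \<theta> u v'"
  proof (rule V.riesz)
    show "cmod (sum_form a b \<theta> u v) \<le> nm \<theta> u * nm \<theta> v" if "v \<in> V \<theta>" for v
      using u V_sub[OF that] by (rule s.Cauchy_Schwarz)
  qed (use u V_sub in \<open>auto simp: s.form_simps\<close>)
  then obtain v where v: "v \<in> V \<theta>" "\<forall>v'\<in>V \<theta>. sum_form a b \<theta> v v' = sum_form a b \<theta> u v'" by blast
  note vH = V_sub[OF v(1)]
  have w: "u - v \<in> W \<theta>" using u vH v(2) V_sub by (auto simp: W_space_def s.form_simps)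
  have "sum_form a b \<theta> (u - v) v = 0" using w v(1) by (simp add: W_space_def)
  then have pyth: "qf (sum_form a b \<theta>) u = qf (sum_form a b \<theta>) (u - v) + qf (sum_form a b \<theta>) v"
    using s.qf_add[of "u - v" v] u vH by simp
  then have "nm \<theta> v \<le> nm \<theta> u" "nm \<theta> (u - v) \<le> nm \<theta> u"
    using u vH by (auto simp: form_norm_def)
  then show ?thesis using that[of v "u - v"] v(1) w by simp
qed

text \<open>The spectral gap at 0 makes \<open>a 0\<close> equivalent to the full inner product on
  \<open>W 0\<close>; this is the space in which the corrector equation is solved.\<close>

lemma hilbert_W0: "hilbert_form (W 0) (a 0)"
proof (rule hilbert_form_transfer[OF s0.hilbert_form_axioms W_subspace])
  show "nonneg_form_on (W 0) (a 0)"
    using a0.restrict[OF W_subspace[OF zero_Theta]] W_sub unfolding nonneg_form_def by blast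
  fix x l assume x: "range x \<subseteq> W 0" and l: "l \<in> H" and lim: "(\<lambda>n::nat. n0 (x n - l)) \<longlonglongrightarrow> 0"
  have "sum_form a b 0 l v = 0" if v: "v \<in> V 0" for v
  proof -
    have "cmod (sum_form a b 0 l v) \<le> n0 v * n0 (x n - l)" for n
    proof -
      have xW: "x n \<in> W 0" using x by blast
      then have "sum_form a b 0 (x n - l) v = - sum_form a b 0 l v"
        using v l W_sub[OF xW] V_sub[OF v] by (simp add: s0.form_simps) (simp add: W_space_def)
      then show ?thesis
        using s0.Cauchy_Schwarz[of "x n - l" v] l W_sub[OF xW] V_sub[OF v] by (simp add: mult.commute)
    qed
    then have "cmod (sum_form a b 0 l v) \<le> 0" by (rule nonpos_of_tendsto_0[OF lim])
    then show ?thesis by simp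
  qed
  then show "l \<in> W 0" using l by (simp add: W_space_def)
next
  show "n0 u \<le> 1 / sqrt \<nu> * form_norm (a 0) u" if "u \<in> W 0" for u
  proof -
    have "sqrt (\<nu> * (n0 u)\<^sup>2) \<le> form_norm (a 0) u"
      unfolding form_norm_def[of "a 0"] using gap[OF that] by (rule real_sqrt_le_mono)
    then show ?thesis using \<nu> W_sub[OF that] by (simp add: real_sqrt_mult field_simps)
  qed
  show "form_norm (a 0) u \<le> 1 * n0 u" if "u \<in> W 0" for u
    using fn_a_le[of 0 u] W_sub[OF that] by simp
qed (use W_sub in auto)

section \<open>The splitting of \<open>V 0\<close> into \<open>Vs\<close> and
  \<open>Z\<close>\<close>

definition cZ where "cZ = 1 / sqrt (1 - KZ)"

lemma cZ: "0 < cZ" using KZ by (simp add: cZ_def)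

lemma V0_I: "v \<in> Vs \<Longrightarrow> z \<in> Z \<Longrightarrow> v + z \<in> V 0"
  unfolding V0_eq sum_space_def by blast

lemma V0_E: assumes "u \<in> V 0" obtains v z where "v \<in> Vs" "z \<in> Z" "u = v + z"
  using assms unfolding V0_eq sum_space_def by blast

lemma Vs_V0: "v \<in> Vs \<Longrightarrow> v \<in> V 0"
  using V0_I[of v 0] complex_vector.subspace_0[OF Z_subspace] by simp

lemma Z_V0: "z \<in> Z \<Longrightarrow> z \<in> V 0"
  using V0_I[of 0 z] complex_vector.subspace_0[OF Vs_subspace] by simp

lemmas Vs_H = V_sub[OF Vs_V0] and Z_H = V_sub[OF Z_V0]

text \<open>\<open>KZ\<close> bounds the cosine of the angle between \<open>Vs\<close> and
  \<open>Z\<close>. With \<open>2 x y \<le> x\<^sup>2 + y\<^sup>2\<close> the mixed term consumes at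
  most the share \<open>KZ\<close> of the sum of squares, so \<open>cZ\<close> bounds both oblique
  projections.\<close>

lemma component_bounds:
  assumes v: "v \<in> Vs" and z: "z \<in> Z"
  shows "n0 v \<le> cZ * n0 (v + z)" "n0 z \<le> cZ * n0 (v + z)"
proof -
  have vz: "v \<in> H" "z \<in> H" using v z Vs_H Z_H by auto
  have "- (KZ * n0 v * n0 z) \<le> Re (sum_form a b 0 v z)"
    using angle[OF v z] abs_Re_le_cmod[of "sum_form a b 0 v z"] by linarith
  then have "(n0 v)\<^sup>2 + (n0 z)\<^sup>2 - 2 * (KZ * n0 v * n0 z) \<le> (n0 (v + z))\<^sup>2"
    using vz by (simp add: s0.form_norm_sq s0.qf_add)
  moreover have "KZ * (2 * n0 v * n0 z) \<le> KZ * ((n0 v)\<^sup>2 + (n0 z)\<^sup>2)"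
    using KZ sum_squares_bound[of "n0 v" "n0 z"] by (intro mult_left_mono) auto
  ultimately have *: "(1 - KZ) * ((n0 v)\<^sup>2 + (n0 z)\<^sup>2) \<le> (n0 (v + z))\<^sup>2"
    by (simp add: algebra_simps)
  have aux: "x \<le> cZ * n0 (v + z)" if "(1 - KZ) * x\<^sup>2 \<le> (n0 (v + z))\<^sup>2" "0 \<le> x" for x
  proof -
    have "sqrt ((1 - KZ) * x\<^sup>2) \<le> sqrt ((n0 (v + z))\<^sup>2)" using that(1) by (rule real_sqrt_le_mono)
    then have "sqrt (1 - KZ) * x \<le> n0 (v + z)"
      using that(2) vz unfolding real_sqrt_mult real_sqrt_abs by simp
    then show ?thesis using KZ by (simp add: cZ_def field_simps)
  qed
  have le: "(1 - KZ) * x \<le> (1 - KZ) * (x + y)" "(1 - KZ) * y \<le> (1 - KZ) * (x + y)"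
    if "0 \<le> x" "0 \<le> y" for x y using KZ that by (auto intro: mult_left_mono)
  show "n0 v \<le> cZ * n0 (v + z)" "n0 z \<le> cZ * n0 (v + z)"
    using le[of "(n0 v)\<^sup>2" "(n0 z)\<^sup>2"] * vz by (auto intro!: aux)
qed

section \<open>Taylor coefficients of the forms at 0\<close>

definition A1 where "A1 \<theta> v u = cdot (a' v u) \<theta>"
definition A2 where "A2 \<theta> v u = cdot (a'' v u *v cvec \<theta>) \<theta>"

lemma A1_sesquilinear: "sesquilinear_on (V 0) H (A1 \<theta>)"
  unfolding A1_def cdot_def by (rule sesquilinear_on_sum) (rule a'_sesquilinear)

lemma A2_sesquilinear: "sesquilinear_on (V 0) (V 0) (A2 \<theta>)"
  unfolding A2_def cdot_def matrix_vector_mult_def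
  by (simp, intro sesquilinear_on_sum a''_sesquilinear)

lemma A1_scaleR: "A1 (t *\<^sub>R \<theta>) v u = complex_of_real t * A1 \<theta> v u"
  by (simp add: A1_def cdot_def sum_distrib_left mult_ac)

lemma A2_scaleR: "A2 (t *\<^sub>R \<theta>) v u = complex_of_real (t\<^sup>2) * A2 \<theta> v u"
  by (simp add: A2_def cdot_def matrix_vector_mult_def cvec_def sum_distrib_left sum_distrib_right
      power2_eq_square mult_ac)

text \<open>The expansions hold only for parameters in \<open>\<Theta>\<close>, whereas the
  homogenised form is needed for all frequencies. Estimates are made on the sphere of radius
  \<open>r0\<close> and carried outwards and inwards by homogeneity of \<open>A1\<close> and
  \<open>A2\<close>.\<close>

lemma polar:
  obtains \<eta> :: "real ^ 'n" and t where "norm \<eta> = r0" "0 \<le> t" "\<theta> = t *\<^sub>R \<eta>" "norm \<theta> = t * r0"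
proof (cases "\<theta> = 0")
  case True
  obtain \<eta> :: "real ^ 'n" where "norm \<eta> = r0" using vector_choose_size r0 less_imp_le by blast
  then show ?thesis using that[of \<eta> 0] True by simp
next
  case False
  then show ?thesis using that[of "(r0 / norm \<theta>) *\<^sub>R \<theta>" "norm \<theta> / r0"] r0 by simp
qed

definition C1 where "C1 = La + Ka'"

lemma C1: "0 \<le> C1" using La Ka' by (simp add: C1_def)

text \<open>On \<open>V 0\<close> the form \<open>a 0\<close> vanishes, so the Lipschitz condition
  bounds \<open>a \<eta>\<close> itself on the sphere of radius \<open>r0\<close>, and the expansion
  passes from \<open>a \<eta>\<close> to \<open>A1 \<eta>\<close>.\<close>

lemma A1_bound:
  assumes v: "v \<in> V 0" and u: "u \<in> H"
  shows "cmod (A1 \<theta> v u) \<le> C1 * norm \<theta> * n0 v * n0 u"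
proof -
  obtain \<eta> t where \<eta>: "norm \<eta> = r0" "0 \<le> t" "\<theta> = t *\<^sub>R \<eta>" "norm \<theta> = t * r0" by (rule polar)
  have \<eta>\<Theta>: "\<eta> \<in> \<Theta>" using \<eta>(1) by (intro ball) simp
  define x where "x = n0 v * n0 u"
  have x: "0 \<le> x" using V_sub[OF v] u by (simp add: x_def)
  have "cmod (A1 \<eta> v u) \<le> cmod (a \<eta> v u) + cmod (a \<eta> v u - A1 \<eta> v u)"
    by (metis norm_minus_commute norm_triangle_sub)
  also have "\<dots> \<le> La * r0 * x + Ka' * r0\<^sup>2 * x"
    using lipschitz[OF V_sub[OF v] u \<eta>\<Theta>] a'_expansion[OF v u \<eta>\<Theta>] V_null_left[OF zero_Theta v u] \<eta>(1)
    by (simp add: A1_def x_def mult_ac)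
  also have "\<dots> \<le> La * r0 * x + Ka' * r0 * x"
    using r0 Ka' x by (intro add_left_mono mult_right_mono mult_left_mono) (auto simp: power2_eq_square mult_left_le)
  finally have "cmod (A1 \<eta> v u) \<le> C1 * r0 * x" by (simp add: C1_def algebra_simps)
  then have "t * cmod (A1 \<eta> v u) \<le> t * (C1 * r0 * x)" using \<eta>(2) by (rule mult_left_mono)
  then show ?thesis using \<eta> by (simp add: A1_scaleR norm_mult x_def mult_ac)
qed

text \<open>At \<open>norm \<eta> = r0\<close> the form \<open>a \<eta>\<close> is estimated crudely
  by \<open>K\<^sup>2\<close>, hence the division by \<open>r0\<^sup>2\<close>.\<close>

definition C2 where "C2 = (K\<^sup>2 + Ka'') / r0\<^sup>2"

lemma C2: "0 \<le> C2" using Ka'' by (simp add: C2_def)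

lemma A2_bound:
  assumes v: "v \<in> V 0" and u: "u \<in> V 0"
  shows "cmod (A2 \<theta> v u) \<le> C2 * (norm \<theta>)\<^sup>2 * n0 v * n0 u"
proof -
  obtain \<eta> t where \<eta>: "norm \<eta> = r0" "0 \<le> t" "\<theta> = t *\<^sub>R \<eta>" "norm \<theta> = t * r0" by (rule polar)
  have \<eta>\<Theta>: "\<eta> \<in> \<Theta>" using \<eta>(1) by (intro ball) simp
  define x where "x = n0 v * n0 u"
  have x: "0 \<le> x" using V_sub[OF v] V_sub[OF u] by (simp add: x_def)
  have "cmod (A2 \<eta> v u) \<le> cmod (a \<eta> v u) + cmod (a \<eta> v u - A2 \<eta> v u)"
    by (metis norm_minus_commute norm_triangle_sub)
  also have "\<dots> \<le> K\<^sup>2 * x + Ka'' * r0 ^ 3 * x"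
    using a_bound0[OF \<eta>\<Theta> V_sub[OF v] V_sub[OF u]] a''_expansion[OF v u \<eta>\<Theta>] \<eta>(1)
    by (simp add: A2_def x_def mult_ac)
  also have "\<dots> \<le> K\<^sup>2 * x + Ka'' * 1 * x"
    using r0 Ka'' x by (intro add_left_mono mult_right_mono mult_left_mono) (auto simp: power_le_one)
  also have "\<dots> = (K\<^sup>2 + Ka'') * x" by (simp add: distrib_right)
  also have "K\<^sup>2 + Ka'' = C2 * r0\<^sup>2" using r0 by (simp add: C2_def)
  finally have "t\<^sup>2 * cmod (A2 \<eta> v u) \<le> t\<^sup>2 * (C2 * r0\<^sup>2 * x)" by (rule mult_left_mono) simp
  then show ?thesis using \<eta> by (simp add: A2_scaleR norm_mult norm_power x_def power_mult_distrib mult_ac)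
qed

section \<open>The corrector\<close>

abbreviation N where "N \<equiv> N_map H a b a'"

lemma A1_W_simps:
  assumes "v \<in> V 0"
  shows "u \<in> H \<Longrightarrow> u' \<in> H \<Longrightarrow> A1 \<theta> v (u + u') = A1 \<theta> v u + A1 \<theta> v u'"
    "u \<in> H \<Longrightarrow> A1 \<theta> v (c *\<^sub>C u) = cnj c * A1 \<theta> v u"
    "v' \<in> V 0 \<Longrightarrow> u \<in> H \<Longrightarrow> A1 \<theta> (v + v') u = A1 \<theta> v u + A1 \<theta> v' u"
    "u \<in> H \<Longrightarrow> A1 \<theta> (c *\<^sub>C v) u = c * A1 \<theta> v u"
  using A1_sesquilinear[of \<theta>] assms unfolding sesquilinear_on_def by blast+

lemma N_unique:
  assumes "w \<in> W 0" "\<And>w'. w' \<in> W 0 \<Longrightarrow> a 0 w w' = - A1 \<theta> v w'"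
  shows "N \<theta> v = w"
proof -
  interpret W: hilbert_form "W 0" "a 0" by (rule hilbert_W0)
  show ?thesis
    unfolding N_map_def using assms unfolding A1_def by (intro the_equality) (auto intro: W.form_eqI)
qed

text \<open>The spectral gap turns the bound of \<open>A1\<close> in \<open>n0\<close> into one in
  the norm of \<open>a 0\<close>, so that Riesz representation in \<open>W 0\<close> applies and the
  description in \<open>N_map\<close> denotes the solution.\<close>

lemma N:
  assumes v: "v \<in> V 0"
  shows N_W: "N \<theta> v \<in> W 0" and N_eq: "w \<in> W 0 \<Longrightarrow> a 0 (N \<theta> v) w = - A1 \<theta> v w"
proof -
  interpret W: hilbert_form "W 0" "a 0" by (rule hilbert_W0)
  have "\<exists>w\<in>W 0. \<forall>w'\<in>W 0. a 0 w w' = - A1 \<theta> v w'"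
  proof (rule W.riesz)
    fix w assume w: "w \<in> W 0"
    have "sqrt (\<nu> * (n0 w)\<^sup>2) \<le> form_norm (a 0) w"
      unfolding form_norm_def[of "a 0"] using gap[OF w] by (rule real_sqrt_le_mono)
    then have "n0 w \<le> form_norm (a 0) w / sqrt \<nu>"
      using \<nu> W_sub[OF w] by (simp add: real_sqrt_mult field_simps)
    then have "C1 * norm \<theta> * n0 v * n0 w \<le> C1 * norm \<theta> * n0 v * (form_norm (a 0) w / sqrt \<nu>)"
      using C1 V_sub[OF v] by (intro mult_left_mono) auto
    then show "cmod (- A1 \<theta> v w) \<le> C1 * norm \<theta> * n0 v / sqrt \<nu> * form_norm (a 0) w"
      using A1_bound[OF v W_sub[OF w], of \<theta>] by simp
  qed (use W_sub in \<open>auto simp: A1_W_simps[OF v]\<close>)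
  then obtain w where w: "w \<in> W 0" "\<forall>w'\<in>W 0. a 0 w w' = - A1 \<theta> v w'" by blast
  then have "N \<theta> v = w" by (intro N_unique) auto
  then show "N \<theta> v \<in> W 0" "w \<in> W 0 \<Longrightarrow> a 0 (N \<theta> v) w = - A1 \<theta> v w" for w using w by auto
qed

lemma N_H: "v \<in> V 0 \<Longrightarrow> N \<theta> v \<in> H"
  using N_W W_sub by blast

lemma W0_simps: "w \<in> W 0 \<Longrightarrow> w' \<in> W 0 \<Longrightarrow> w + w' \<in> W 0" "w \<in> W 0 \<Longrightarrow> c *\<^sub>C w \<in> W 0"
  "w \<in> W 0 \<Longrightarrow> w' \<in> W 0 \<Longrightarrow> w - w' \<in> W 0"
  using W_subspace[OF zero_Theta] complex_vector.subspace_add complex_vector.subspace_scale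
    complex_vector.subspace_diff by blast+

lemma N_add: "v \<in> V 0 \<Longrightarrow> v' \<in> V 0 \<Longrightarrow> N \<theta> (v + v') = N \<theta> v + N \<theta> v'"
  by (intro N_unique W0_simps N_W) (auto simp: a0.form_simps N_H W_sub N_eq A1_W_simps)

lemma N_scale: "v \<in> V 0 \<Longrightarrow> N \<theta> (c *\<^sub>C v) = c *\<^sub>C N \<theta> v"
  by (intro N_unique W0_simps N_W) (auto simp: a0.form_simps N_H W_sub N_eq A1_W_simps)

lemma N_scaleR: "v \<in> V 0 \<Longrightarrow> N (t *\<^sub>R \<theta>) v = complex_of_real t *\<^sub>C N \<theta> v"
  by (intro N_unique W0_simps N_W) (auto simp: a0.form_simps N_H W_sub N_eq A1_scaleR)

definition CN where "CN = C1 / \<nu>"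

lemma CN: "0 \<le> CN" using C1 \<nu> by (simp add: CN_def)

lemma N_bound:
  assumes v: "v \<in> V 0" shows "n0 (N \<theta> v) \<le> CN * norm \<theta> * n0 v"
proof (cases "n0 (N \<theta> v) = 0")
  case True then show ?thesis using CN V_sub[OF v] by simp
next
  case False
  then have pos: "0 < n0 (N \<theta> v)" using N_H[OF v] by (simp add: less_le)
  have "\<nu> * (n0 (N \<theta> v))\<^sup>2 \<le> cmod (a 0 (N \<theta> v) (N \<theta> v))"
    using gap[OF N_W[OF v, of \<theta>]] complex_Re_le_cmod[of "a 0 (N \<theta> v) (N \<theta> v)"] by (simp add: qf_def)
  also have "\<dots> \<le> C1 * norm \<theta> * n0 v * n0 (N \<theta> v)"
    using A1_bound[OF v N_H[OF v]] by (simp add: N_eq[OF v N_W[OF v]])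
  finally have "\<nu> * n0 (N \<theta> v) * n0 (N \<theta> v) \<le> C1 * norm \<theta> * n0 v * n0 (N \<theta> v)"
    by (simp add: power2_eq_square mult.assoc)
  then have "\<nu> * n0 (N \<theta> v) \<le> C1 * norm \<theta> * n0 v" using pos by (simp add: mult_le_cancel_right)
  then show ?thesis using \<nu> by (simp add: CN_def field_simps)
qed

lemma small_Theta [simp]: "norm \<theta> \<le> r0 \<Longrightarrow> \<theta> \<in> \<Theta>"
  by (rule ball)

section \<open>The homogenised form\<close>

abbreviation ah where "ah \<equiv> homogenised_form H a b a' a''"

lemma ah_eq: "ah \<theta> v v' = A2 \<theta> v v' - a 0 (N \<theta> v) (N \<theta> v')"
  by (simp add: homogenised_form_def A2_def)

lemma ah_scaleR:
  "v \<in> V 0 \<Longrightarrow> v' \<in> V 0 \<Longrightarrow> ah (t *\<^sub>R \<theta>) v v' = complex_of_real (t\<^sup>2) * ah \<theta> v v'"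
  by (simp add: ah_eq A2_scaleR N_scaleR a0.form_simps N_H algebra_simps power2_eq_square)

lemma ah_sesquilinear: "sesquilinear_on (V 0) (V 0) (ah \<theta>)"
  using A2_sesquilinear[of \<theta>] unfolding sesquilinear_on_def
  by (simp add: ah_eq N_add N_scale a0.form_simps N_H algebra_simps)

lemma ah_bound:
  assumes v: "v \<in> V 0" and v': "v' \<in> V 0"
  shows "cmod (ah \<theta> v v') \<le> (C2 + CN\<^sup>2) * (norm \<theta>)\<^sup>2 * n0 v * n0 v'"
proof -
  have "cmod (a 0 (N \<theta> v) (N \<theta> v')) \<le> form_norm (a 0) (N \<theta> v) * form_norm (a 0) (N \<theta> v')"
    by (intro a_bound N_H v v' zero_Theta)
  also have "\<dots> \<le> n0 (N \<theta> v) * n0 (N \<theta> v')"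
    using N_H[OF v] N_H[OF v'] by (intro mult_mono fn_a_le) auto
  also have "\<dots> \<le> (CN * norm \<theta> * n0 v) * (CN * norm \<theta> * n0 v')"
    using N_bound[OF v] N_bound[OF v'] N_H[OF v] N_H[OF v'] CN V_sub[OF v] by (intro mult_mono) auto
  also have "\<dots> = CN\<^sup>2 * (norm \<theta>)\<^sup>2 * n0 v * n0 v'" by (simp add: power2_eq_square)
  finally show ?thesis
    using A2_bound[OF v v', of \<theta>] norm_triangle_ineq4[of "A2 \<theta> v v'" "a 0 (N \<theta> v) (N \<theta> v')"]
    unfolding ah_eq by (simp add: algebra_simps)
qed

text \<open>\<open>a''\<close> carries no symmetry assumption; its quadratic contraction inherits it
  from \<open>a \<theta>\<close>. Along \<open>s *\<^sub>R \<eta>\<close> the asymmetry scales like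
  \<open>s\<^sup>2\<close> but is bounded by the cubic remainder, and \<open>s\<close> tends to
  0.\<close>

lemma A2_hermitian:
  assumes v: "v \<in> V 0" and v': "v' \<in> V 0"
  shows "A2 \<theta> v' v = cnj (A2 \<theta> v v')"
proof -
  obtain \<eta> t where \<eta>: "norm \<eta> = r0" "\<theta> = t *\<^sub>R \<eta>" by (rule polar)
  define D where "D = A2 \<eta> v' v - cnj (A2 \<eta> v v')"
  define M where "M = 2 * Ka'' * n0 v * n0 v'"
  have "cmod D \<le> M * s" if s: "0 < s" "s \<le> 1" for s
  proof -
    have n: "norm (s *\<^sub>R \<eta>) = s * r0" using s \<eta>(1) by simp
    have "s * r0 \<le> r0" using s r0 by simp
    then have s\<eta>: "s *\<^sub>R \<eta> \<in> \<Theta>" by (intro ball) (simp only: n)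
    interpret a: nonneg_form H "a (s *\<^sub>R \<eta>)" using s\<eta> by (rule a_form)
    have "complex_of_real (s\<^sup>2) * D
        = (A2 (s *\<^sub>R \<eta>) v' v - a (s *\<^sub>R \<eta>) v' v) + cnj (a (s *\<^sub>R \<eta>) v v' - A2 (s *\<^sub>R \<eta>) v v')"
      using a.hermitian[OF V_sub[OF v] V_sub[OF v']] by (simp add: D_def A2_scaleR algebra_simps)
    then have "s\<^sup>2 * cmod D = cmod ((A2 (s *\<^sub>R \<eta>) v' v - a (s *\<^sub>R \<eta>) v' v)
        + cnj (a (s *\<^sub>R \<eta>) v v' - A2 (s *\<^sub>R \<eta>) v v'))"
      by (metis norm_mult norm_of_real abs_of_nonneg zero_le_power2)
    also have "\<dots> \<le> cmod (a (s *\<^sub>R \<eta>) v' v - A2 (s *\<^sub>R \<eta>) v' v) + cmod (a (s *\<^sub>R \<eta>) v v' - A2 (s *\<^sub>R \<eta>) v v')"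
      by (metis norm_triangle_ineq norm_minus_commute complex_mod_cnj)
    also have "\<dots> \<le> M * (s * r0) ^ 3"
      using a''_expansion[OF v v' s\<eta>, folded A2_def, unfolded n]
        a''_expansion[OF v' v s\<eta>, folded A2_def, unfolded n]
      by (simp add: M_def algebra_simps)
    also have "\<dots> = s\<^sup>2 * (M * s * r0 ^ 3)" by (simp add: power_mult_distrib power2_eq_square power3_eq_cube)
    finally have "cmod D \<le> M * s * r0 ^ 3" using s by (simp add: mult_le_cancel_left_pos)
    also have "\<dots> \<le> M * s * 1"
      using s r0 Ka'' V_sub[OF v] V_sub[OF v'] by (intro mult_left_mono) (auto simp: M_def power_le_one)
    finally show ?thesis by simp
  qed
  then have "cmod D \<le> M * inverse (real (Suc n))" for n by (simp add: inverse_le_1_iff)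
  then have "cmod D \<le> 0" by (rule nonpos_of_tendsto_0[OF LIMSEQ_inverse_real_of_nat])
  then show ?thesis by (simp add: \<eta>(2) A2_scaleR D_def)
qed

lemma ah_hermitian: "v \<in> V 0 \<Longrightarrow> v' \<in> V 0 \<Longrightarrow> ah \<theta> v' v = cnj (ah \<theta> v v')"
  unfolding ah_eq using A2_hermitian[of v v' \<theta>] a0.hermitian[of "N \<theta> v" "N \<theta> v'"] N_H by simp

section \<open>Vectors of \<open>V 0\<close> with their first-order corrector\<close>

definition T where "T \<theta> v = v + N \<theta> v"

lemma T_H [simp]: "v \<in> V 0 \<Longrightarrow> T \<theta> v \<in> H"
  using V_sub N_H by (simp add: T_def)

lemma T_bound:
  assumes v: "v \<in> V 0" and \<theta>: "norm \<theta> \<le> r0"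
  shows "n0 (T \<theta> v) \<le> (1 + CN) * n0 v"
proof -
  have "n0 (T \<theta> v) \<le> n0 v + n0 (N \<theta> v)"
    unfolding T_def using V_sub[OF v] N_H[OF v] by (intro s0.form_norm_triangle)
  moreover have "CN * norm \<theta> * n0 v \<le> CN * 1 * n0 v"
    using \<theta> r0 CN V_sub[OF v] by (intro mult_right_mono mult_left_mono) auto
  ultimately show ?thesis using N_bound[OF v, of \<theta>] by (simp add: algebra_simps)
qed

text \<open>The first-order terms \<open>A1 \<theta> v w\<close> and
  \<open>a 0 (N \<theta> v) w\<close> cancel by the corrector equation; this is the purpose of
  \<open>T\<close>.\<close>

lemma a_T_W:
  assumes v: "v \<in> V 0" and w: "w \<in> W 0" and \<theta>: "norm \<theta> \<le> r0"
  shows "cmod (a \<theta> (T \<theta> v) w) \<le> (Ka' + La * CN) * (norm \<theta>)\<^sup>2 * n0 v * n0 w"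
proof -
  have \<theta>\<Theta>: "\<theta> \<in> \<Theta>" using \<theta> by simp
  interpret a: nonneg_form H "a \<theta>" using \<theta>\<Theta> by (rule a_form)
  note mem = V_sub[OF v] N_H[OF v, of \<theta>] W_sub[OF w]
  have "cmod (a \<theta> (N \<theta> v) w - a 0 (N \<theta> v) w) \<le> La * norm \<theta> * n0 (N \<theta> v) * n0 w"
    using mem \<theta>\<Theta> by (intro lipschitz)
  also have "\<dots> \<le> La * norm \<theta> * (CN * norm \<theta> * n0 v) * n0 w"
    using N_bound[OF v] La mem by (intro mult_right_mono mult_left_mono) auto
  finally have 1: "cmod (a \<theta> (N \<theta> v) w - a 0 (N \<theta> v) w) \<le> La * norm \<theta> * (CN * norm \<theta> * n0 v) * n0 w" .
  have 2: "cmod (a \<theta> v w - A1 \<theta> v w) \<le> Ka' * (norm \<theta>)\<^sup>2 * n0 v * n0 w"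
    unfolding A1_def using v mem \<theta>\<Theta> by (intro a'_expansion)
  have eq: "a \<theta> (T \<theta> v) w = (a \<theta> v w - A1 \<theta> v w) + (a \<theta> (N \<theta> v) w - a 0 (N \<theta> v) w)"
    using mem by (simp add: T_def a.form_simps N_eq[OF v w])
  have "cmod (a \<theta> (T \<theta> v) w)
      \<le> Ka' * (norm \<theta>)\<^sup>2 * n0 v * n0 w + La * norm \<theta> * (CN * norm \<theta> * n0 v) * n0 w"
    unfolding eq by (rule norm_triangle_mono[OF 2 1])
  also have "\<dots> = (Ka' + La * CN) * (norm \<theta>)\<^sup>2 * n0 v * n0 w"
    by (simp add: power2_eq_square algebra_simps)
  finally show ?thesis .
qed

text \<open>Against \<open>V 0\<close> nothing of first order arises: \<open>a \<theta>\<close> on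
  \<open>V 0\<close> is already quadratic in \<theta>, and \<open>a 0 (N \<theta> v)\<close>
  vanishes there, which leaves the Lipschitz error times the size of the corrector.\<close>

lemma a_T_V0:
  assumes v: "v \<in> V 0" and v': "v' \<in> V 0" and \<theta>: "norm \<theta> \<le> r0"
  shows "cmod (a \<theta> (T \<theta> v) v') \<le> (C2 + Ka'' + La * CN) * (norm \<theta>)\<^sup>2 * n0 v * n0 v'"
proof -
  have \<theta>\<Theta>: "\<theta> \<in> \<Theta>" using \<theta> by simp
  interpret a: nonneg_form H "a \<theta>" using \<theta>\<Theta> by (rule a_form)
  note mem = V_sub[OF v] N_H[OF v, of \<theta>] V_sub[OF v']
  have "cmod (a \<theta> (N \<theta> v) v' - a 0 (N \<theta> v) v') \<le> La * norm \<theta> * n0 (N \<theta> v) * n0 v'"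
    using mem \<theta>\<Theta> by (intro lipschitz)
  also have "\<dots> \<le> La * norm \<theta> * (CN * norm \<theta> * n0 v) * n0 v'"
    using N_bound[OF v] La mem by (intro mult_right_mono mult_left_mono) auto
  finally have 1: "cmod (a \<theta> (N \<theta> v) v') \<le> La * norm \<theta> * (CN * norm \<theta> * n0 v) * n0 v'"
    using V_null_right[OF zero_Theta v' N_H[OF v]] by simp
  have "cmod (a \<theta> v v' - A2 \<theta> v v') \<le> Ka'' * (norm \<theta>) ^ 3 * n0 v * n0 v'"
    unfolding A2_def using v v' \<theta>\<Theta> by (intro a''_expansion)
  also have "\<dots> \<le> Ka'' * (norm \<theta>)\<^sup>2 * n0 v * n0 v'"
    using Ka'' \<theta> r0 mem by (intro mult_right_mono mult_left_mono power_decreasing) auto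
  finally have 2: "cmod (a \<theta> v v' - A2 \<theta> v v') \<le> Ka'' * (norm \<theta>)\<^sup>2 * n0 v * n0 v'" .
  have "a \<theta> (T \<theta> v) v' = A2 \<theta> v v' + (a \<theta> v v' - A2 \<theta> v v') + a \<theta> (N \<theta> v) v'"
    using mem by (simp add: T_def a.form_simps)
  then show ?thesis
    using norm_triangle_mono[OF norm_triangle_mono[OF A2_bound[OF v v', of \<theta>] 2] 1]
    by (simp add: power2_eq_square algebra_simps)
qed

definition C3 where "C3 = (Ka' + La * CN) + (C2 + Ka'' + La * CN)"

lemma C3: "0 \<le> C3" using Ka' La CN C2 Ka'' by (simp add: C3_def)

lemma a_T_bound:
  assumes v: "v \<in> V 0" and u: "u \<in> H" and \<theta>: "norm \<theta> \<le> r0"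
  shows "cmod (a \<theta> (T \<theta> v) u) \<le> C3 * (norm \<theta>)\<^sup>2 * n0 v * n0 u"
proof -
  interpret a: nonneg_form H "a \<theta>" using \<theta> by (intro a_form) simp
  obtain v' w where *: "v' \<in> V 0" "w \<in> W 0" "u = v' + w" "n0 v' \<le> n0 u" "n0 w \<le> n0 u"
    using decompose[OF zero_Theta u] by blast
  have nn: "0 \<le> (Ka' + La * CN) * (norm \<theta>)\<^sup>2 * n0 v" "0 \<le> (C2 + Ka'' + La * CN) * (norm \<theta>)\<^sup>2 * n0 v"
    using Ka' La CN C2 Ka'' V_sub[OF v] by simp_all
  have "a \<theta> (T \<theta> v) u = a \<theta> (T \<theta> v) w + a \<theta> (T \<theta> v) v'"
    using *(3) V_sub[OF *(1)] W_sub[OF *(2)] v by (simp add: a.form_simps)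
  moreover have "cmod (a \<theta> (T \<theta> v) w) \<le> (Ka' + La * CN) * (norm \<theta>)\<^sup>2 * n0 v * n0 u"
    using a_T_W[OF v *(2) \<theta>] mult_left_mono[OF *(5) nn(1)] by linarith
  moreover have "cmod (a \<theta> (T \<theta> v) v') \<le> (C2 + Ka'' + La * CN) * (norm \<theta>)\<^sup>2 * n0 v * n0 u"
    using a_T_V0[OF v *(1) \<theta>] mult_left_mono[OF *(4) nn(2)] by linarith
  ultimately have "cmod (a \<theta> (T \<theta> v) u)
      \<le> (Ka' + La * CN) * (norm \<theta>)\<^sup>2 * n0 v * n0 u + (C2 + Ka'' + La * CN) * (norm \<theta>)\<^sup>2 * n0 v * n0 u"
    using norm_triangle_mono by metis
  then show ?thesis by (simp add: C3_def algebra_simps)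
qed

definition C6 where "C6 = Ka'' + 2 * Ka' * CN + La * CN\<^sup>2"

lemma C6: "0 \<le> C6" using Ka' La CN Ka'' by (simp add: C6_def)

text \<open>Explains the shape of \<open>ah\<close>: it is exactly the second-order part of
  \<open>a \<theta>\<close> on corrected vectors.\<close>

lemma a_T_expansion:
  assumes v: "v \<in> V 0" and v': "v' \<in> V 0" and \<theta>: "norm \<theta> \<le> r0"
  shows "cmod (a \<theta> (T \<theta> v) (T \<theta> v') - ah \<theta> v v') \<le> C6 * (norm \<theta>) ^ 3 * n0 v * n0 v'"
proof -
  have \<theta>\<Theta>: "\<theta> \<in> \<Theta>" using \<theta> by simp
  interpret a: nonneg_form H "a \<theta>" using \<theta>\<Theta> by (rule a_form)
  note mem = V_sub[OF v] N_H[OF v, of \<theta>] V_sub[OF v'] N_H[OF v', of \<theta>]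
  have 1: "cmod (a \<theta> v v' - A2 \<theta> v v') \<le> Ka'' * (norm \<theta>) ^ 3 * n0 v * n0 v'"
    unfolding A2_def using v v' \<theta>\<Theta> by (intro a''_expansion)
  have N2: "cmod (a \<theta> u (N \<theta> u') - A1 \<theta> u (N \<theta> u')) \<le> Ka' * CN * (norm \<theta>) ^ 3 * n0 u * n0 u'"
    if u: "u \<in> V 0" "u' \<in> V 0" for u u'
  proof -
    have "cmod (a \<theta> u (N \<theta> u') - A1 \<theta> u (N \<theta> u')) \<le> Ka' * (norm \<theta>)\<^sup>2 * n0 u * n0 (N \<theta> u')"
      unfolding A1_def using u \<theta>\<Theta> N_H by (intro a'_expansion) auto
    also have "\<dots> \<le> Ka' * (norm \<theta>)\<^sup>2 * n0 u * (CN * norm \<theta> * n0 u')"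
      using N_bound[OF u(2)] Ka' V_sub[OF u(1)] by (intro mult_left_mono) auto
    finally show ?thesis by (simp add: power2_eq_square power3_eq_cube mult_ac)
  qed
  have 3: "cmod (cnj (a \<theta> v' (N \<theta> v) - A1 \<theta> v' (N \<theta> v))) \<le> Ka' * CN * (norm \<theta>) ^ 3 * n0 v' * n0 v"
    using N2[OF v' v] by (simp only: complex_mod_cnj)
  have "cmod (a \<theta> (N \<theta> v) (N \<theta> v') - a 0 (N \<theta> v) (N \<theta> v')) \<le> La * norm \<theta> * n0 (N \<theta> v) * n0 (N \<theta> v')"
    using mem \<theta>\<Theta> by (intro lipschitz)
  also have "\<dots> \<le> La * norm \<theta> * (CN * norm \<theta> * n0 v) * (CN * norm \<theta> * n0 v')"
    using N_bound[OF v] N_bound[OF v'] La CN mem by (intro mult_mono mult_left_mono) auto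
  finally have 4: "cmod (a \<theta> (N \<theta> v) (N \<theta> v') - a 0 (N \<theta> v) (N \<theta> v'))
      \<le> La * norm \<theta> * (CN * norm \<theta> * n0 v) * (CN * norm \<theta> * n0 v')" .
  \<comment> \<open>To leading order each mixed term equals
    \<open>- a 0 (N \<theta> v) (N \<theta> v')\<close> and the term with two correctors equals its
    negative, so a single copy with minus sign survives.\<close>
  have A: "A1 \<theta> v (N \<theta> v') = - a 0 (N \<theta> v) (N \<theta> v')" "cnj (A1 \<theta> v' (N \<theta> v)) = - a 0 (N \<theta> v) (N \<theta> v')"
    using N_eq[OF v N_W[OF v', of \<theta>], of \<theta>] N_eq[OF v' N_W[OF v, of \<theta>], of \<theta>]
      a0.hermitian[OF N_H[OF v, of \<theta>] N_H[OF v', of \<theta>]] by (simp_all add: complex_eq_iff)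
  have "a \<theta> (N \<theta> v) v' = cnj (a \<theta> v' (N \<theta> v))" using mem by (intro a.hermitian)
  then have eq: "a \<theta> (T \<theta> v) (T \<theta> v') - ah \<theta> v v'
     = (a \<theta> v v' - A2 \<theta> v v') + (a \<theta> v (N \<theta> v') - A1 \<theta> v (N \<theta> v'))
       + cnj (a \<theta> v' (N \<theta> v) - A1 \<theta> v' (N \<theta> v))
       + (a \<theta> (N \<theta> v) (N \<theta> v') - a 0 (N \<theta> v) (N \<theta> v'))"
    using mem by (simp add: T_def ah_eq a.form_simps A)
  have "cmod (a \<theta> (T \<theta> v) (T \<theta> v') - ah \<theta> v v')
      \<le> Ka'' * (norm \<theta>) ^ 3 * n0 v * n0 v' + Ka' * CN * (norm \<theta>) ^ 3 * n0 v * n0 v'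
      + Ka' * CN * (norm \<theta>) ^ 3 * n0 v' * n0 v + La * norm \<theta> * (CN * norm \<theta> * n0 v) * (CN * norm \<theta> * n0 v')"
    unfolding eq
    by (rule norm_triangle_mono[OF norm_triangle_mono[OF norm_triangle_mono[OF 1 N2[OF v v']] 3] 4])
  also have "\<dots> = C6 * (norm \<theta>) ^ 3 * n0 v * n0 v'"
    by (simp add: C6_def power2_eq_square power3_eq_cube algebra_simps)
  finally show ?thesis .
qed

lemma Vst_V: "v \<in> Vstar_space H a Vs \<theta> \<Longrightarrow> v \<in> V \<theta>"
  using Vs_V0 by (auto simp: Vstar_space_def split: if_splits)

text \<open>For \<open>z \<in> Z\<close> the vector \<open>T \<theta> z\<close> stays at a distance from \<open>V \<theta>\<close> proportional to the norm of \<open>z\<close>,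
  because \<open>V \<theta>\<close> is close to \<open>Vs\<close>; the quadratic degeneracy then bounds \<open>a \<theta>\<close> at \<open>T \<theta> z\<close> from below.\<close>

lemma ah_coercive: "\<exists>c>0. \<forall>\<theta>. \<forall>z\<in>Z. c * (norm \<theta>)\<^sup>2 * (n0 z)\<^sup>2 \<le> Re (ah \<theta> z z)"
proof -
  \<comment> \<open>Collects what separates \<open>z\<close> from the \<open>W \<theta>\<close>-part
    of \<open>T \<theta> z\<close> in units of \<rho>: the corrector, and the displacement of
    \<open>V \<theta>\<close> from \<open>Vs\<close>.\<close>
  define C4 where "C4 = cZ * (CN + Ls * (K * (1 + CN)))"
  have C4: "0 \<le> C4" using cZ CN Ls K by (simp add: C4_def)
  \<comment> \<open>The degeneracy constant after converting \<open>nm \<theta> w\<close> into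
    \<open>n0 z\<close>; the factor 2 stems from absorbing half of \<open>x\<close>.\<close>
  define c5 where "c5 = \<gamma> / (2 * cZ * K)\<^sup>2"
  have c5: "0 < c5" using \<gamma> cZ K by (simp add: c5_def)
  \<comment> \<open>The second entry allows the \<open>C4\<close>-terms to be absorbed, the third
    allows the cubic remainder \<open>C6\<close> to use up at most half of
    \<open>c5\<close>.\<close>
  define \<rho> where "\<rho> = min r0 (min (1 / (2 * (C4 + 1))) (c5 / (2 * (C6 + 1))))"
  have \<rho>: "0 < \<rho>" "\<rho> \<le> r0" "\<rho> * (2 * (C4 + 1)) \<le> 1" "\<rho> * (2 * (C6 + 1)) \<le> c5"
  proof -
    show "0 < \<rho>" "\<rho> \<le> r0" using r0 C4 C6 c5 by (auto simp: \<rho>_def)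
    have "\<rho> \<le> 1 / (2 * (C4 + 1))" "\<rho> \<le> c5 / (2 * (C6 + 1))" by (auto simp: \<rho>_def)
    then show "\<rho> * (2 * (C4 + 1)) \<le> 1" "\<rho> * (2 * (C6 + 1)) \<le> c5" using C4 C6 by (auto simp: field_simps)
  qed
  have on_sphere: "c5 / 2 * \<rho>\<^sup>2 * (n0 z)\<^sup>2 \<le> Re (ah \<theta> z z)" if z: "z \<in> Z" and \<theta>: "norm \<theta> = \<rho>" for z \<theta>
  proof -
    have \<theta>r: "norm \<theta> \<le> r0" and \<theta>\<Theta>: "\<theta> \<in> \<Theta>" and \<theta>0: "\<theta> \<noteq> 0" using \<rho> \<theta> by auto
    interpret a: nonneg_form H "a \<theta>" using \<theta>\<Theta> by (rule a_form)
    note zV = Z_V0[OF z]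
    define x where "x = n0 z"
    have x: "0 \<le> x" using Z_H[OF z] by (simp add: x_def)
    obtain v w where vw: "v \<in> V \<theta>" "w \<in> W \<theta>" "T \<theta> z = v + w" "nm \<theta> v \<le> nm \<theta> (T \<theta> z)"
      using decompose[OF \<theta>\<Theta> T_H[OF zV]] by metis
    have vH: "v \<in> H" and wH: "w \<in> H" using vw V_sub W_sub by auto
    have nv: "nm \<theta> v \<le> K * ((1 + CN) * x)"
    proof -
      have "K * n0 (T \<theta> z) \<le> K * ((1 + CN) * x)"
        unfolding x_def using K by (intro mult_left_mono T_bound zV \<theta>r) auto
      then show ?thesis using vw(4) nm_le[OF \<theta>\<Theta> T_H[OF zV, of \<theta>]] by linarith
    qed
    have "v \<in> Vstar_space H a Vs \<theta>" using vw(1) \<theta>0 by (simp add: Vstar_space_def)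
    \<comment> \<open>The target parameter is 0, where \<open>Vstar_space\<close> is
      \<open>Vs\<close> and not all of \<open>V 0\<close>; the angle condition then keeps
      \<open>z\<close> away from \<open>v2\<close>.\<close>
    then obtain v2 where v2: "v2 \<in> Vs" "n0 (v - v2) \<le> Ls * norm \<theta> * nm \<theta> v"
      using near[OF \<theta>\<Theta> zero_Theta] by (auto simp: Vstar_space_def)
    have v2H: "v2 \<in> H" using v2 Vs_H by blast
    have dist2: "n0 (v - v2) \<le> Ls * (K * (1 + CN)) * \<rho> * x"
      using v2(2) mult_left_mono[OF nv, of "Ls * norm \<theta>"] Ls \<rho> \<theta> by (simp add: mult_ac)
    have "- v2 \<in> Vs" using v2 complex_vector.subspace_neg[OF Vs_subspace] by blast
    then have "x \<le> cZ * n0 (- v2 + z)" unfolding x_def using z by (rule component_bounds)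
    moreover have "n0 (- v2 + z) \<le> n0 w + CN * \<rho> * x + Ls * (K * (1 + CN)) * \<rho> * x"
    proof -
      have eq: "- v2 + z = (w - N \<theta> z) + (v - v2)" using vw(3) by (simp add: T_def algebra_simps)
      have "n0 ((w - N \<theta> z) + (v - v2)) \<le> n0 (w - N \<theta> z) + n0 (v - v2)"
        using wH vH v2H N_H[OF zV] by (intro s0.form_norm_triangle) auto
      moreover have "n0 (w - N \<theta> z) \<le> n0 w + n0 (N \<theta> z)"
        using wH N_H[OF zV] by (intro s0.form_norm_triangle_diff)
      ultimately show ?thesis
        using dist2 N_bound[OF zV, of \<theta>] unfolding eq \<theta> x_def by linarith
    qed
    ultimately have "x \<le> cZ * (n0 w + CN * \<rho> * x + Ls * (K * (1 + CN)) * \<rho> * x)"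
      using cZ by (meson order_trans mult_left_mono less_imp_le)
    then have "x \<le> cZ * n0 w + (\<rho> * C4) * x" by (simp add: C4_def algebra_simps)
    moreover have "(\<rho> * C4) * x \<le> 1 / 2 * x" using \<rho> x by (intro mult_right_mono) (auto simp: algebra_simps)
    ultimately have "x \<le> 2 * cZ * n0 w" by simp
    also have "\<dots> \<le> 2 * cZ * (K * nm \<theta> w)" using cZ n0_le[OF \<theta>\<Theta> wH] by (intro mult_left_mono) auto
    finally have "x\<^sup>2 \<le> (2 * cZ * K * nm \<theta> w)\<^sup>2" using x by (intro power_mono) (auto simp: mult_ac)
    then have "\<gamma> * \<rho>\<^sup>2 * x\<^sup>2 \<le> \<gamma> * \<rho>\<^sup>2 * ((2 * cZ * K)\<^sup>2 * (nm \<theta> w)\<^sup>2)"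
      using \<gamma> by (intro mult_left_mono) (auto simp: power_mult_distrib)
    then have "c5 * \<rho>\<^sup>2 * x\<^sup>2 \<le> \<gamma> * \<rho>\<^sup>2 * (nm \<theta> w)\<^sup>2"
      using cZ K by (simp add: c5_def field_simps)
    also have "\<dots> \<le> qf (a \<theta>) w" using degeneracy[OF \<theta>\<Theta> vw(2)] \<theta> by simp
    also have "\<dots> = Re (a \<theta> (T \<theta> z) (T \<theta> z))"
      using vw(3) vH wH V_null_left[OF \<theta>\<Theta> vw(1)] V_null_right[OF \<theta>\<Theta> vw(1)]
      by (simp add: qf_def a.form_simps)
    also have "\<dots> \<le> Re (ah \<theta> z z) + C6 * \<rho> ^ 3 * x * x"
      using a_T_expansion[OF zV zV \<theta>r] abs_Re_le_cmod[of "a \<theta> (T \<theta> z) (T \<theta> z) - ah \<theta> z z"]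
      by (simp add: \<theta> x_def)
    finally have "c5 * \<rho>\<^sup>2 * x\<^sup>2 \<le> Re (ah \<theta> z z) + (\<rho> * C6) * (\<rho>\<^sup>2 * x\<^sup>2)"
      by (simp add: power2_eq_square power3_eq_cube mult_ac)
    moreover have "(\<rho> * C6) * (\<rho>\<^sup>2 * x\<^sup>2) \<le> c5 / 2 * (\<rho>\<^sup>2 * x\<^sup>2)"
      using \<rho> by (intro mult_right_mono) (auto simp: algebra_simps)
    ultimately show ?thesis by (simp add: x_def mult_ac)
  qed
  \<comment> \<open>One radius suffices, since \<open>ah\<close> is homogeneous of degree 2 in the
    frequency.\<close>
  have "c5 / 2 * (norm \<theta>)\<^sup>2 * (n0 z)\<^sup>2 \<le> Re (ah \<theta> z z)" if z: "z \<in> Z" for z \<theta>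
  proof (cases "\<theta> = 0")
    case True
    then show ?thesis using ah_scaleR[OF Z_V0[OF z] Z_V0[OF z], of 0 0] by simp
  next
    case False
    define t where "t = norm \<theta> / \<rho>"
    define \<eta> where "\<eta> = (1 / t) *\<^sub>R \<theta>"
    have t: "t > 0" "norm \<theta> = t * \<rho>" using False \<rho> by (auto simp: t_def)
    then have \<eta>: "norm \<eta> = \<rho>" "\<theta> = t *\<^sub>R \<eta>" using False \<rho> by (auto simp: \<eta>_def)
    have "t\<^sup>2 * (c5 / 2 * \<rho>\<^sup>2 * (n0 z)\<^sup>2) \<le> t\<^sup>2 * Re (ah \<eta> z z)"
      by (intro mult_left_mono on_sphere z \<eta>) simp
    also have "\<dots> = Re (ah \<theta> z z)"
      unfolding \<eta>(2) ah_scaleR[OF Z_V0[OF z] Z_V0[OF z]] by simp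
    finally show ?thesis using t(2) by (simp add: power_mult_distrib mult_ac)
  qed
  then show ?thesis using c5 by (intro exI[of _ "c5 / 2"]) auto
qed

section \<open>The form of the limit operator\<close>

abbreviation S where "S \<equiv> S_form H a b a' a'' Vs Z"

lemma Z_part_eq:
  assumes v: "v \<in> Vs" and z: "z \<in> Z"
  shows "Z_part Vs Z (v + z) = z"
  unfolding Z_part_def
proof (rule the_equality)
  show "z \<in> Z \<and> (\<exists>v'\<in>Vs. v + z = v' + z)" using v z by blast
  fix z' assume "z' \<in> Z \<and> (\<exists>v'\<in>Vs. v + z = v' + z')"
  then obtain v' where *: "z' \<in> Z" "v' \<in> Vs" "v + z = v' + z'" by blast
  have "v - v' = z' - z" using *(3) by (simp add: algebra_simps)
  then have "z' - z \<in> Vs \<inter> Z"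
    using v z * complex_vector.subspace_diff[OF Vs_subspace] complex_vector.subspace_diff[OF Z_subspace]
    by (metis IntI)
  then show "z' = z" using Vs_Z by simp
qed

lemma S_eq:
  "v \<in> Vs \<Longrightarrow> z \<in> Z \<Longrightarrow> v' \<in> Vs \<Longrightarrow> z' \<in> Z \<Longrightarrow>
    S \<xi> (v + z) (v' + z') = ah \<xi> z z' + b 0 (v + z) (v' + z')"
  by (simp add: S_form_def Z_part_eq)

lemma n0_V0: "v \<in> V 0 \<Longrightarrow> n0 v = form_norm (b 0) v"
  by (simp add: form_norm_def qf_sum) (simp add: V_space_def qf_def)

lemma Vs_Z_simps: "v \<in> Vs \<Longrightarrow> v' \<in> Vs \<Longrightarrow> v + v' \<in> Vs" "v \<in> Vs \<Longrightarrow> c *\<^sub>C v \<in> Vs"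
  "z \<in> Z \<Longrightarrow> z' \<in> Z \<Longrightarrow> z + z' \<in> Z" "z \<in> Z \<Longrightarrow> c *\<^sub>C z \<in> Z" "0 \<in> Vs" "0 \<in> Z"
  using Vs_subspace Z_subspace complex_vector.subspace_add complex_vector.subspace_scale
    complex_vector.subspace_0 by blast+

lemma qf_ah_nonneg: "z \<in> Z \<Longrightarrow> 0 \<le> Re (ah \<xi> z z)"
proof -
  assume z: "z \<in> Z"
  obtain c where "c > 0" "c * (norm \<xi>)\<^sup>2 * (n0 z)\<^sup>2 \<le> Re (ah \<xi> z z)" using ah_coercive z by blast
  then show ?thesis by (meson order_trans mult_nonneg_nonneg less_imp_le zero_le_power2)
qed

lemma nonneg_form_S: "nonneg_form (V 0) (S \<xi>)"
proof
  show "complex_vector.subspace (V 0)" by (rule V_subspace) simp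
  have Zadd: "Z_part Vs Z (u + u') = Z_part Vs Z u + Z_part Vs Z u'" if u: "u \<in> V 0" and u': "u' \<in> V 0" for u u'
  proof -
    obtain v z where 1: "v \<in> Vs" "z \<in> Z" "u = v + z" using u by (rule V0_E)
    obtain v' z' where 2: "v' \<in> Vs" "z' \<in> Z" "u' = v' + z'" using u' by (rule V0_E)
    have eq: "u + u' = (v + v') + (z + z')" using 1 2 by simp
    have "Z_part Vs Z (u + u') = z + z'" unfolding eq using 1 2 by (intro Z_part_eq Vs_Z_simps)
    then show ?thesis using 1 2 by (simp add: Z_part_eq)
  qed
  have Zscale: "Z_part Vs Z (c *\<^sub>C u) = c *\<^sub>C Z_part Vs Z u" if u: "u \<in> V 0" for u c
  proof -
    obtain v z where 1: "v \<in> Vs" "z \<in> Z" "u = v + z" using u by (rule V0_E)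
    have eq: "c *\<^sub>C u = c *\<^sub>C v + c *\<^sub>C z" using 1 by (simp add: scaleC_add_right)
    have "Z_part Vs Z (c *\<^sub>C u) = c *\<^sub>C z" unfolding eq using 1 by (intro Z_part_eq Vs_Z_simps)
    then show ?thesis using 1 by (simp add: Z_part_eq)
  qed
  have Zmem: "Z_part Vs Z u \<in> Z" if u: "u \<in> V 0" for u
  proof -
    obtain v z where 1: "v \<in> Vs" "z \<in> Z" "u = v + z" using u by (rule V0_E)
    then show ?thesis by (simp add: Z_part_eq)
  qed
  note ahs = ah_sesquilinear[of \<xi>, unfolded sesquilinear_on_def]
  have 1: "sesquilinear_on (V 0) (V 0) (S \<xi>)"
    unfolding sesquilinear_on_def S_form_def
    using ahs Zmem Z_V0 V_sub by (simp add: Zadd Zscale b0.form_simps algebra_simps)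
  have "S \<xi> u u \<in> \<real> \<and> 0 \<le> Re (S \<xi> u u)" if "u \<in> V 0" for u
  proof -
    have z: "Z_part Vs Z u \<in> Z" using that by (rule Zmem)
    have "Im (ah \<xi> (Z_part Vs Z u) (Z_part Vs Z u)) = 0"
      using ah_hermitian[OF Z_V0[OF z] Z_V0[OF z], of \<xi>] by (simp add: complex_eq_iff)
    then show ?thesis
      using b0.diagonal[OF V_sub[OF that]] qf_ah_nonneg[OF z] V_sub[OF that]
      by (simp add: S_form_def complex_is_Real_iff)
  qed
  with 1 show "nonneg_form_on (V 0) (S \<xi>)" unfolding nonneg_form_on_def by blast
qed

lemma qf_S: "v \<in> Vs \<Longrightarrow> z \<in> Z \<Longrightarrow> qf (S \<xi>) (v + z) = Re (ah \<xi> z z) + (n0 (v + z))\<^sup>2"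
  using b0.form_norm_sq[OF V_sub[OF V0_I], of v z] n0_V0[OF V0_I, of v z] by (simp add: qf_def S_eq)

lemma n0_le_S: assumes "u \<in> V 0" shows "n0 u \<le> form_norm (S \<xi>) u"
proof -
  obtain v z where *: "v \<in> Vs" "z \<in> Z" "u = v + z" using assms by (rule V0_E)
  have "(n0 u)\<^sup>2 \<le> qf (S \<xi>) u" using qf_S[OF *(1,2)] qf_ah_nonneg[OF *(2)] *(3) by simp
  then show ?thesis unfolding form_norm_def[of "S \<xi>"] by (rule real_le_rsqrt)
qed

text \<open>Non-negativity of \<open>ah\<close> on \<open>Z\<close> gives the lower bound by
  \<open>n0\<close>. The upper constant depends on \<xi>, which is harmless because only
  completeness is drawn from it; uniform bounds come from coercivity.\<close>

lemma hilbert_S: "hilbert_form (V 0) (S \<xi>)"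
proof (rule hilbert_form_transfer[OF hilbert_V[OF zero_Theta]])
  interpret S: nonneg_form "V 0" "S \<xi>" by (rule nonneg_form_S)
  show "complex_vector.subspace (V 0)" "nonneg_form_on (V 0) (S \<xi>)"
    by (rule S.subspace, rule S.nonneg_form)
  show "n0 u \<le> 1 * form_norm (S \<xi>) u" if "u \<in> V 0" for u using n0_le_S[OF that] by simp
  define M where "M = (C2 + CN\<^sup>2) * (norm \<xi>)\<^sup>2"
  have M: "0 \<le> M" using C2 by (simp add: M_def)
  show "form_norm (S \<xi>) u \<le> sqrt (M * cZ\<^sup>2 + 1) * n0 u" if u: "u \<in> V 0" for u
  proof -
    obtain v z where *: "v \<in> Vs" "z \<in> Z" "u = v + z" using u by (rule V0_E)
    have "Re (ah \<xi> z z) \<le> M * (n0 z * n0 z)"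
      using ah_bound[OF Z_V0[OF *(2)] Z_V0[OF *(2)], of \<xi>] complex_Re_le_cmod[of "ah \<xi> z z"]
      by (simp add: M_def mult_ac)
    also have "\<dots> \<le> M * ((cZ * n0 u) * (cZ * n0 u))"
      using component_bounds(2)[OF *(1,2)] M cZ Z_H[OF *(2)] V_sub[OF u] *(3)
      by (intro mult_left_mono mult_mono) auto
    finally have "qf (S \<xi>) u \<le> (M * cZ\<^sup>2 + 1) * (n0 u)\<^sup>2"
      using qf_S[OF *(1,2), of \<xi>] *(3) by (simp add: power2_eq_square algebra_simps)
    then have "form_norm (S \<xi>) u \<le> sqrt ((M * cZ\<^sup>2 + 1) * (n0 u)\<^sup>2)"
      unfolding form_norm_def[of "S \<xi>"] by (rule real_sqrt_le_mono)
    then show ?thesis using V_sub[OF u] unfolding real_sqrt_mult real_sqrt_abs by simp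
  qed
qed auto

lemma solution_S: "form_solution UNIV (d 0) (V 0) (S \<xi>)"
proof -
  interpret S: hilbert_form "V 0" "S \<xi>" by (rule hilbert_S)
  show ?thesis
  proof
    show "form_norm (d 0) u \<le> form_norm (S \<xi>) u" if "u \<in> V 0" for u
      using d_le_b[OF zero_Theta V_sub[OF that]] n0_le_S[OF that, of \<xi>] n0_V0[OF that] by simp
  qed simp
qed

lemma solution_Vs: "form_solution UNIV (d 0) Vs (b 0)"
proof -
  have "hilbert_form Vs (b 0)"
  proof (rule hilbert_form_transfer[OF s0.hilbert_form_axioms Vs_subspace _ _ Vs_closed])
    show "nonneg_form_on Vs (b 0)"
      using b0.restrict[OF Vs_subspace] Vs_H unfolding nonneg_form_def by blast
    show "n0 u \<le> 1 * form_norm (b 0) u" "form_norm (b 0) u \<le> 1 * n0 u" if "u \<in> Vs" for u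
      using n0_V0[OF Vs_V0[OF that]] by simp_all
  qed (use Vs_H in auto)
  then interpret Vs: hilbert_form Vs "b 0" .
  show ?thesis
    by unfold_locales (use d_le_b[OF zero_Theta] Vs_H in auto)
qed

section \<open>The rescaled form of the family\<close>

definition Q where "Q \<epsilon> \<theta> u v = complex_of_real (1 / \<epsilon>\<^sup>2) * a \<theta> u v + b \<theta> u v"

lemma qf_Q: "qf (Q \<epsilon> \<theta>) u = 1 / \<epsilon>\<^sup>2 * qf (a \<theta>) u + qf (b \<theta>) u"
  by (simp add: qf_def Q_def)

text \<open>Small energy makes the seminorm of \<open>a \<theta>\<close> smaller still by a factor
  \<epsilon>; the gains of \<epsilon> on the test side originate here.\<close>

lemma
  assumes \<theta>: "\<theta> \<in> \<Theta>" and \<epsilon>: "0 < \<epsilon>" "\<epsilon> < 1" and u: "u \<in> H"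
  shows fn_a_le_Q: "form_norm (a \<theta>) u \<le> \<epsilon> * form_norm (Q \<epsilon> \<theta>) u"
    and fn_b_le_Q: "form_norm (b \<theta>) u \<le> form_norm (Q \<epsilon> \<theta>) u"
    and nm_le_Q: "nm \<theta> u \<le> form_norm (Q \<epsilon> \<theta>) u"
    and Q_le_nm: "form_norm (Q \<epsilon> \<theta>) u \<le> 1 / \<epsilon> * nm \<theta> u"
proof -
  interpret a: nonneg_form H "a \<theta>" using \<theta> by (rule a_form)
  interpret b: nonneg_form H "b \<theta>" using \<theta> by (rule b_form)
  have e2: "\<epsilon>\<^sup>2 \<le> 1" "0 < \<epsilon>\<^sup>2" using \<epsilon> by (auto simp: power_le_one)
  have inv: "1 \<le> 1 / \<epsilon>\<^sup>2" using e2 by (simp add: field_simps)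
  have 1: "qf (a \<theta>) u \<le> 1 / \<epsilon>\<^sup>2 * qf (a \<theta>) u" "qf (b \<theta>) u \<le> 1 / \<epsilon>\<^sup>2 * qf (b \<theta>) u"
    using mult_right_mono[OF inv, of "qf (a \<theta>) u"] mult_right_mono[OF inv, of "qf (b \<theta>) u"] u by auto
  have "qf (a \<theta>) u \<le> \<epsilon>\<^sup>2 * qf (Q \<epsilon> \<theta>) u" using e2 u by (simp add: qf_Q distrib_left)
  then have "sqrt (qf (a \<theta>) u) \<le> sqrt (\<epsilon>\<^sup>2 * qf (Q \<epsilon> \<theta>) u)" by (rule real_sqrt_le_mono)
  then show "form_norm (a \<theta>) u \<le> \<epsilon> * form_norm (Q \<epsilon> \<theta>) u"
    using \<epsilon> by (simp add: form_norm_def real_sqrt_mult)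
  show "form_norm (b \<theta>) u \<le> form_norm (Q \<epsilon> \<theta>) u"
    using u by (simp add: form_norm_def qf_Q)
  show "nm \<theta> u \<le> form_norm (Q \<epsilon> \<theta>) u" using 1 by (simp add: form_norm_def qf_Q qf_sum)
  have "qf (Q \<epsilon> \<theta>) u \<le> (1 / \<epsilon>)\<^sup>2 * qf (sum_form a b \<theta>) u"
    using 1 by (simp add: qf_Q qf_sum distrib_left power_divide add_divide_distrib)
  then have "sqrt (qf (Q \<epsilon> \<theta>) u) \<le> sqrt ((1 / \<epsilon>)\<^sup>2 * qf (sum_form a b \<theta>) u)" by (rule real_sqrt_le_mono)
  then show "form_norm (Q \<epsilon> \<theta>) u \<le> 1 / \<epsilon> * nm \<theta> u"
    using \<epsilon> unfolding real_sqrt_mult real_sqrt_abs form_norm_def by simp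
qed

lemma solution_Q:
  assumes \<theta>: "\<theta> \<in> \<Theta>" and \<epsilon>: "0 < \<epsilon>" "\<epsilon> < 1"
  shows "form_solution UNIV (d \<theta>) H (Q \<epsilon> \<theta>)"
proof -
  interpret a: nonneg_form H "a \<theta>" using \<theta> by (rule a_form)
  interpret b: nonneg_form H "b \<theta>" using \<theta> by (rule b_form)
  interpret d: definite_form UNIV "d \<theta>" using \<theta> by (rule d_form)
  have "hilbert_form H (Q \<epsilon> \<theta>)"
  proof (rule hilbert_form_transfer[OF hilbert[OF \<theta>] s0.subspace])
    show "nonneg_form_on H (Q \<epsilon> \<theta>)"
      unfolding nonneg_form_on_def sesquilinear_on_def Q_def
      by (auto simp: a.form_simps b.form_simps a.diagonal b.diagonal algebra_simps add_divide_distrib)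
    show "nm \<theta> u \<le> 1 * form_norm (Q \<epsilon> \<theta>) u" if "u \<in> H" for u using nm_le_Q[OF \<theta> \<epsilon> that] by simp
    show "form_norm (Q \<epsilon> \<theta>) u \<le> 1 / \<epsilon> * nm \<theta> u" if "u \<in> H" for u using Q_le_nm[OF \<theta> \<epsilon> that] .
  qed auto
  then interpret Q: hilbert_form H "Q \<epsilon> \<theta>" .
  show ?thesis
  proof
    show "form_norm (d \<theta>) u \<le> form_norm (Q \<epsilon> \<theta>) u" if "u \<in> H" for u
      using d_le_b[OF \<theta> that] fn_b_le_Q[OF \<theta> \<epsilon> that] by linarith
  qed simp
qed

section \<open>Error estimates\<close>

text \<open>\<open>AA \<epsilon> \<theta>\<close> and \<open>BB \<xi>\<close> invert \<open>L_op\<close> and \<open>LL_op\<close>, the latter extended to the ambient space; \<open>BS\<close> is the limit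
  of \<open>BB \<xi>\<close> as \<open>norm \<xi>\<close> tends to infinity.\<close>

abbreviation AA where "AA \<epsilon> \<theta> \<equiv> form_solution.sol (d \<theta>) H (Q \<epsilon> \<theta>)"
abbreviation BB where "BB \<xi> \<equiv> form_solution.sol (d 0) (V 0) (S \<xi>)"
abbreviation BS where "BS \<equiv> form_solution.sol (d 0) Vs (b 0)"

lemma E_Vst: "\<theta> \<in> \<Theta> \<Longrightarrow> v \<in> Vs \<Longrightarrow> E \<theta> v \<in> Vstar_space H a Vs \<theta>"
  using E_Vs[of \<theta>] by (auto simp: bij_betw_def)

lemma E_V: "\<theta> \<in> \<Theta> \<Longrightarrow> v \<in> Vs \<Longrightarrow> E \<theta> v \<in> V \<theta>"
  using E_Vst Vst_V by blast

lemma E_H: "\<theta> \<in> \<Theta> \<Longrightarrow> v \<in> Vs \<Longrightarrow> E \<theta> v \<in> H"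
  using E_V V_sub by blast

lemma E_Vst_surj: "\<theta> \<in> \<Theta> \<Longrightarrow> u \<in> Vstar_space H a Vs \<theta> \<Longrightarrow> \<exists>v\<in>Vs. u = E \<theta> v"
  using E_Vs[of \<theta>] by (auto simp: bij_betw_def)

lemma fn_b_E: "\<theta> \<in> \<Theta> \<Longrightarrow> v \<in> Vs \<Longrightarrow> form_norm (b \<theta>) (E \<theta> v) = n0 v"
  using n0_V0[OF Vs_V0] by (simp add: form_norm_def qf_def E_b)

lemma fn_d_E: "\<theta> \<in> \<Theta> \<Longrightarrow> form_norm (d \<theta>) (E \<theta> u) = form_norm (d 0) u"
  by (simp add: form_norm_def qf_def E_d)

lemma E_add: "\<theta> \<in> \<Theta> \<Longrightarrow> E \<theta> (u + v) = E \<theta> u + E \<theta> v"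
  using isometry_linear[OF d0.definite_form_axioms d_form, of \<theta> "E \<theta>"] E_bij[of \<theta>] E_d[of \<theta>]
  by (simp add: linear_on_set_def bij_def)

text \<open>Testing with the \<open>Z\<close>-component alone isolates \<open>ah \<xi> z z\<close>,
  whose coercivity supplies the decay in \<xi>; the remaining bounds come from the energy estimate
  and the oblique projections.\<close>

lemma S_solution_bounds:
  "\<exists>C\<ge>0. \<forall>\<xi> g. \<exists>v\<in>Vs. \<exists>z\<in>Z. BB \<xi> g = v + z \<and> n0 v \<le> C * form_norm (d 0) g
    \<and> (1 + (norm \<xi>)\<^sup>2) * n0 z \<le> C * form_norm (d 0) g"
proof -
  obtain c where c: "c > 0" "\<And>\<theta> z. z \<in> Z \<Longrightarrow> c * (norm \<theta>)\<^sup>2 * (n0 z)\<^sup>2 \<le> Re (ah \<theta> z z)"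
    using ah_coercive by blast
  \<comment> \<open>\<open>cZ\<close> covers the weight 1, and \<open>2 / c\<close> the weight
    \<open>(norm \<xi>)\<^sup>2\<close>: load and \<open>b 0\<close>-term each contribute one unit,
    divided by the coercivity constant.\<close>
  define C where "C = cZ + 2 / c"
  have C: "cZ \<le> C" using c by (simp add: C_def)
  have "\<exists>v\<in>Vs. \<exists>z\<in>Z. BB \<xi> g = v + z \<and> n0 v \<le> C * form_norm (d 0) g
    \<and> (1 + (norm \<xi>)\<^sup>2) * n0 z \<le> C * form_norm (d 0) g" for \<xi> g
  proof -
    interpret S: form_solution UNIV "d 0" "V 0" "S \<xi>" by (rule solution_S)
    define G where "G = form_norm (d 0) g"
    have G: "0 \<le> G" by (simp add: G_def)
    have uV: "S.sol g \<in> V 0" by (rule S.sol_mem) simp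
    obtain v z where vz: "v \<in> Vs" "z \<in> Z" "S.sol g = v + z" using uV by (rule V0_E)
    note zH = Z_H[OF vz(2)]
    have nu: "n0 (v + z) \<le> G"
      using n0_le_S[OF uV, of \<xi>] S.sol_energy[of g] vz(3) by (simp add: G_def)
    have bounds: "n0 v \<le> cZ * G" "n0 z \<le> cZ * G"
      using component_bounds[OF vz(1,2)] mult_left_mono[OF nu, of cZ] cZ by linarith+
    have "c * (norm \<xi>)\<^sup>2 * n0 z \<le> 2 * G"
    proof (cases "n0 z = 0")
      case True then show ?thesis using G by simp
    next
      case False
      then have pos: "n0 z > 0" using zH by (simp add: less_le)
      \<comment> \<open>Writing the test vector as \<open>0 + z\<close> exposes its vanishing
        \<open>Vs\<close>-component to \<open>S_eq\<close>.\<close>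
      have "S \<xi> (S.sol g) (0 + z) = d 0 g z" using S.sol_eq[of g z] Z_V0[OF vz(2)] by simp
      then have "ah \<xi> z z = d 0 g z - b 0 (v + z) z"
        unfolding vz(3) using S_eq[OF vz(1,2) _ vz(2), of 0 \<xi>] Vs_Z_simps by simp
      then have "Re (ah \<xi> z z) \<le> cmod (d 0 g z) + cmod (b 0 (v + z) z)"
        by (metis complex_Re_le_cmod norm_triangle_ineq4 order_trans)
      also have "\<dots> \<le> G * n0 z + G * n0 z"
      proof (rule add_mono)
        have "cmod (d 0 g z) \<le> G * form_norm (d 0) z" unfolding G_def by (rule d0.Cauchy_Schwarz) auto
        also have "\<dots> \<le> G * n0 z" using G fn_d_le[OF zero_Theta zH] by (rule mult_left_mono[rotated])
        finally show "cmod (d 0 g z) \<le> G * n0 z" .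
        have "cmod (b 0 (v + z) z) \<le> n0 (v + z) * n0 z"
          using b_bound[OF zero_Theta V_sub[OF V0_I[OF vz(1,2)]] zH] n0_V0[OF V0_I[OF vz(1,2)]]
            n0_V0[OF Z_V0[OF vz(2)]] by simp
        also have "\<dots> \<le> G * n0 z" using nu pos by (intro mult_right_mono) auto
        finally show "cmod (b 0 (v + z) z) \<le> G * n0 z" .
      qed
      finally have "c * (norm \<xi>)\<^sup>2 * n0 z * n0 z \<le> 2 * G * n0 z"
        using c(2)[OF vz(2), of \<xi>] by (simp add: power2_eq_square mult_ac)
      then show ?thesis using pos by (simp add: mult_le_cancel_right)
    qed
    then have "(norm \<xi>)\<^sup>2 * n0 z \<le> 2 / c * G" using c(1) by (simp add: field_simps)
    then have "(1 + (norm \<xi>)\<^sup>2) * n0 z \<le> C * G"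
      using bounds(2) by (simp add: C_def algebra_simps)
    moreover have "n0 v \<le> C * G" using bounds(1) mult_right_mono[OF C G] by linarith
    ultimately show ?thesis using vz by (auto simp: G_def)
  qed
  then show ?thesis using C cZ by (intro exI[of _ C]) auto
qed

text \<open>On \<open>Vs\<close> both solutions satisfy the same equation, so the energy of their
  difference sees only its \<open>Z\<close>-component \<open>z\<close>. Coercivity bounds
  \<open>norm \<xi> * n0 z\<close> by that energy norm, one power of which cancels; hence the rate
  \<open>1 / norm \<xi>\<close>.\<close>

lemma BB_BS_close:
  "\<exists>C\<ge>0. \<forall>\<xi> g. norm \<xi> * form_norm (d 0) (BB \<xi> g - BS g) \<le> C * form_norm (d 0) g"
proof -
  obtain c where c: "c > 0" "\<And>\<theta> z. z \<in> Z \<Longrightarrow> c * (norm \<theta>)\<^sup>2 * (n0 z)\<^sup>2 \<le> Re (ah \<theta> z z)"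
    using ah_coercive by blast
  define C where "C = 2 / sqrt c"
  have "norm \<xi> * form_norm (d 0) (BB \<xi> g - BS g) \<le> C * form_norm (d 0) g" for \<xi> g
  proof -
    interpret S: form_solution UNIV "d 0" "V 0" "S \<xi>" by (rule solution_S)
    interpret Vs: form_solution UNIV "d 0" Vs "b 0" by (rule solution_Vs)
    define G where "G = form_norm (d 0) g"
    have G: "0 \<le> G" by (simp add: G_def)
    define e where "e = S.sol g - Vs.sol g"
    have uV: "S.sol g \<in> V 0" and sV: "Vs.sol g \<in> Vs" by (simp_all add: S.sol_mem Vs.sol_mem)
    have eV: "e \<in> V 0" using uV Vs_V0[OF sV] by (simp add: e_def)
    obtain v z where vz: "v \<in> Vs" "z \<in> Z" "e = v + z" using eV by (rule V0_E)
    note zH = Z_H[OF vz(2)] and vH = Vs_H[OF vz(1)] and sH = Vs_H[OF sV]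
    define X where "X = form_norm (S \<xi>) e"
    have X: "0 \<le> X" using eV by (simp add: X_def)
    have ah0: "ah \<xi> 0 z = 0"
    proof -
      have "ah \<xi> (0 *\<^sub>C 0) z = 0 * ah \<xi> 0 z"
        using ah_sesquilinear[of \<xi>] Z_V0[OF vz(2)] Z_V0[OF Vs_Z_simps(6)] unfolding sesquilinear_on_def by blast
      then show ?thesis by simp
    qed
    have "S \<xi> (Vs.sol g) e = b 0 (Vs.sol g) (v + z)"
      using S_eq[OF sV _ vz(1,2), of 0 \<xi>] Vs_Z_simps ah0 vz(3) by simp
    also have "\<dots> = d 0 g v + b 0 (Vs.sol g) z"
      using Vs.sol_eq[of g v] vz sH vH zH by (simp add: b0.form_simps)
    finally have 1: "S \<xi> (Vs.sol g) e = d 0 g v + b 0 (Vs.sol g) z" .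
    have "S \<xi> e e = S \<xi> (S.sol g) e - S \<xi> (Vs.sol g) e"
      using S.dom.diff_left[OF uV Vs_V0[OF sV] eV] by (simp only: e_def[symmetric])
    also have "S \<xi> (S.sol g) e = d 0 g v + d 0 g z"
      using S.sol_eq[of g e] eV vz(3) by (simp add: d0.form_simps)
    finally have "S \<xi> e e = d 0 g z - b 0 (Vs.sol g) z" unfolding 1 by simp
    then have "X\<^sup>2 \<le> cmod (d 0 g z) + cmod (b 0 (Vs.sol g) z)"
      unfolding X_def S.dom.form_norm_sq[OF eV] qf_def
      by (metis complex_Re_le_cmod norm_triangle_ineq4 order_trans)
    also have "\<dots> \<le> G * n0 z + G * n0 z"
    proof (rule add_mono)
      have "cmod (d 0 g z) \<le> G * form_norm (d 0) z" unfolding G_def by (rule d0.Cauchy_Schwarz) auto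
      also have "\<dots> \<le> G * n0 z" using G fn_d_le[OF zero_Theta zH] by (rule mult_left_mono[rotated])
      finally show "cmod (d 0 g z) \<le> G * n0 z" .
      have "cmod (b 0 (Vs.sol g) z) \<le> form_norm (b 0) (Vs.sol g) * n0 z"
        using b_bound[OF zero_Theta sH zH] n0_V0[OF Z_V0[OF vz(2)]] by simp
      also have "\<dots> \<le> G * n0 z" using Vs.sol_energy[of g] zH by (intro mult_right_mono) (auto simp: G_def)
      finally show "cmod (b 0 (Vs.sol g) z) \<le> G * n0 z" .
    qed
    finally have X2: "X * X \<le> 2 * G * n0 z" by (simp add: power2_eq_square)
    have "c * (norm \<xi>)\<^sup>2 * (n0 z)\<^sup>2 \<le> qf (S \<xi>) e"
      using c(2)[OF vz(2), of \<xi>] qf_S[OF vz(1,2), of \<xi>] vz(3)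
      by (simp add: add_increasing2)
    then have "sqrt (c * (norm \<xi>)\<^sup>2 * (n0 z)\<^sup>2) \<le> X"
      unfolding X_def form_norm_def[of "S \<xi>"] by (rule real_sqrt_le_mono)
    then have Xz: "sqrt c * norm \<xi> * n0 z \<le> X"
      using zH unfolding real_sqrt_mult real_sqrt_abs by simp
    have "sqrt c * norm \<xi> * X \<le> 2 * G"
    proof (cases "X = 0")
      case True then show ?thesis using G by simp
    next
      case False
      then have pos: "X > 0" using X by simp
      have "sqrt c * norm \<xi> * (X * X) \<le> sqrt c * norm \<xi> * (2 * G * n0 z)"
        using X2 c(1) by (intro mult_left_mono) auto
      also have "\<dots> = 2 * G * (sqrt c * norm \<xi> * n0 z)" by simp
      also have "\<dots> \<le> 2 * G * X" using G Xz by (intro mult_left_mono) auto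
      finally have "(sqrt c * norm \<xi> * X) * X \<le> (2 * G) * X" by (simp add: mult.assoc)
      then show ?thesis using pos by (simp add: mult_le_cancel_right)
    qed
    then have "norm \<xi> * X \<le> C * G" using c(1) by (simp add: C_def field_simps)
    moreover have "form_norm (d 0) e \<le> X" unfolding X_def using eV by (rule S.norm_le)
    then have "norm \<xi> * form_norm (d 0) e \<le> norm \<xi> * X" by (intro mult_left_mono) auto
    ultimately show ?thesis by (simp add: e_def G_def)
  qed
  then show ?thesis using c(1) by (intro exI[of _ C]) (auto simp: C_def)
qed

text \<open>The same argument with \<open>W \<theta>\<close> in place of \<open>Z\<close> and
  quadratic degeneracy in place of coercivity: the error annihilates \<open>V \<theta>\<close>, the
  image of \<open>Vs\<close>, and \<open>n0\<close>-type control of the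
  \<open>W \<theta>\<close>-part costs \<open>\<epsilon> / \<rho>\<close>.\<close>

lemma AA_BS_close:
  assumes \<rho>: "0 < \<rho>"
  shows "\<exists>C\<ge>0. \<forall>\<theta>\<in>\<Theta>. \<forall>\<epsilon> g. \<rho> \<le> norm \<theta> \<longrightarrow> 0 < \<epsilon> \<longrightarrow> \<epsilon> < 1 \<longrightarrow>
    form_norm (d \<theta>) (AA \<epsilon> \<theta> (E \<theta> g) - E \<theta> (BS g)) \<le> C * \<epsilon> * form_norm (d 0) g"
proof -
  define C where "C = 2 / (sqrt \<gamma> * \<rho>)"
  have "form_norm (d \<theta>) (AA \<epsilon> \<theta> (E \<theta> g) - E \<theta> (BS g)) \<le> C * \<epsilon> * form_norm (d 0) g"
    if \<theta>: "\<theta> \<in> \<Theta>" "\<rho> \<le> norm \<theta>" and \<epsilon>: "0 < \<epsilon>" "\<epsilon> < 1" for \<theta> \<epsilon> g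
  proof -
    interpret Q: form_solution UNIV "d \<theta>" H "Q \<epsilon> \<theta>" using \<theta>(1) \<epsilon> by (rule solution_Q)
    interpret Vs: form_solution UNIV "d 0" Vs "b 0" by (rule solution_Vs)
    interpret a: nonneg_form H "a \<theta>" using \<theta>(1) by (rule a_form)
    define G where "G = form_norm (d 0) g"
    have G: "0 \<le> G" by (simp add: G_def)
    define s where "s = Vs.sol g"
    have s: "s \<in> Vs" by (simp add: s_def Vs.sol_mem)
    define e where "e = Q.sol (E \<theta> g) - E \<theta> s"
    have uH: "Q.sol (E \<theta> g) \<in> H" by (simp add: Q.sol_mem)
    note EH = E_H[OF \<theta>(1) s]
    have eH: "e \<in> H" using uH EH by (simp add: e_def)
    obtain v w where vw: "v \<in> V \<theta>" "w \<in> W \<theta>" "e = v + w" using decompose[OF \<theta>(1) eH] by metis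
    note vH = V_sub[OF vw(1)] and wH = W_sub[OF vw(2)]
    \<comment> \<open>As \<open>\<rho> > 0\<close>, the parameter is not 0, so
      \<open>V \<theta>\<close> is the full range of \<open>E \<theta>\<close> on
      \<open>Vs\<close>.\<close>
    have "v \<in> Vstar_space H a Vs \<theta>" using vw(1) \<theta> \<rho> by (auto simp: Vstar_space_def)
    then obtain y where y: "y \<in> Vs" "v = E \<theta> y" using E_Vst_surj[OF \<theta>(1)] by blast
    define X where "X = form_norm (Q \<epsilon> \<theta>) e"
    have X: "0 \<le> X" using eH by (simp add: X_def)
    have Es: "Q \<epsilon> \<theta> (E \<theta> s) u = b \<theta> (E \<theta> s) u" if "u \<in> H" for u
      using V_null_left[OF \<theta>(1) E_V[OF \<theta>(1) s] that] by (simp add: Q_def)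
    have "Q \<epsilon> \<theta> e v = d \<theta> (E \<theta> g) v - b \<theta> (E \<theta> s) v"
      using Q.sol_eq[of "E \<theta> g" v] vH uH EH by (simp add: e_def Q.dom.form_simps Es)
    also have "\<dots> = 0"
      using Vs.sol_eq[of g y] y s by (simp add: E_d[OF \<theta>(1)] E_b[OF \<theta>(1)] s_def)
    finally have ev: "Q \<epsilon> \<theta> e v = 0" .
    have "Q \<epsilon> \<theta> e w = d \<theta> (E \<theta> g) w - b \<theta> (E \<theta> s) w"
      using Q.sol_eq[of "E \<theta> g" w] wH uH EH by (simp add: e_def Q.dom.form_simps Es)
    then have "Q \<epsilon> \<theta> e e = d \<theta> (E \<theta> g) w - b \<theta> (E \<theta> s) w"
      using ev vH wH eH Q.dom.add_right[of e v w] vw(3) by simp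
    then have "X\<^sup>2 \<le> cmod (d \<theta> (E \<theta> g) w) + cmod (b \<theta> (E \<theta> s) w)"
      unfolding X_def Q.dom.form_norm_sq[OF eH] qf_def
      by (metis complex_Re_le_cmod norm_triangle_ineq4 order_trans)
    also have "\<dots> \<le> G * nm \<theta> w + G * nm \<theta> w"
    proof (rule add_mono)
      have "cmod (d \<theta> (E \<theta> g) w) \<le> G * form_norm (d \<theta>) w"
        using Q.amb.Cauchy_Schwarz[of "E \<theta> g" w] by (simp add: G_def fn_d_E[OF \<theta>(1)])
      also have "\<dots> \<le> G * nm \<theta> w" using G fn_d_le[OF \<theta>(1) wH] by (rule mult_left_mono[rotated])
      finally show "cmod (d \<theta> (E \<theta> g) w) \<le> G * nm \<theta> w" .
      have "cmod (b \<theta> (E \<theta> s) w) \<le> n0 s * form_norm (b \<theta>) w"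
        using b_bound[OF \<theta>(1) EH wH] by (simp add: fn_b_E[OF \<theta>(1) s])
      also have "\<dots> \<le> G * nm \<theta> w"
        using Vs.sol_energy[of g] n0_V0[OF Vs_V0[OF s]] fn_b_le[OF \<theta>(1) wH] G fn_b_nonneg[OF \<theta>(1) wH]
        by (intro mult_mono) (auto simp: G_def s_def)
      finally show "cmod (b \<theta> (E \<theta> s) w) \<le> G * nm \<theta> w" .
    qed
    finally have X2: "X * X \<le> 2 * G * nm \<theta> w" by (simp add: power2_eq_square)
    have aw: "form_norm (a \<theta>) w = form_norm (a \<theta>) e"
      unfolding form_norm_def qf_def vw(3) using vH wH V_null_left[OF \<theta>(1) vw(1)] V_null_right[OF \<theta>(1) vw(1)]
      by (simp add: a.form_simps)
    have "sqrt (\<gamma> * (norm \<theta>)\<^sup>2 * (nm \<theta> w)\<^sup>2) \<le> form_norm (a \<theta>) w"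
      unfolding form_norm_def[of "a \<theta>"] using degeneracy[OF \<theta>(1) vw(2)] by (rule real_sqrt_le_mono)
    then have "sqrt \<gamma> * norm \<theta> * nm \<theta> w \<le> \<epsilon> * X"
      using fn_a_le_Q[OF \<theta>(1) \<epsilon> eH] wH \<theta>(1) unfolding real_sqrt_mult real_sqrt_abs aw X_def by simp
    moreover have "sqrt \<gamma> * \<rho> * nm \<theta> w \<le> sqrt \<gamma> * norm \<theta> * nm \<theta> w"
      using \<theta> wH \<gamma> by (intro mult_right_mono mult_left_mono) auto
    ultimately have Xw: "sqrt \<gamma> * \<rho> * nm \<theta> w \<le> \<epsilon> * X" by linarith
    have "sqrt \<gamma> * \<rho> * X \<le> 2 * \<epsilon> * G"
    proof (cases "X = 0")
      case True then show ?thesis using G \<epsilon> by simp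
    next
      case False
      then have pos: "X > 0" using X by simp
      have "sqrt \<gamma> * \<rho> * (X * X) \<le> sqrt \<gamma> * \<rho> * (2 * G * nm \<theta> w)"
        using X2 \<gamma> \<rho> by (intro mult_left_mono) auto
      also have "\<dots> = 2 * G * (sqrt \<gamma> * \<rho> * nm \<theta> w)" by simp
      also have "\<dots> \<le> 2 * G * (\<epsilon> * X)" using G Xw by (intro mult_left_mono) auto
      finally have "(sqrt \<gamma> * \<rho> * X) * X \<le> (2 * \<epsilon> * G) * X" by (simp add: mult_ac)
      then show ?thesis using pos by (simp add: mult_le_cancel_right)
    qed
    then have "X \<le> C * \<epsilon> * G" using \<gamma> \<rho> by (simp add: C_def field_simps)
    moreover have "form_norm (d \<theta>) e \<le> X" unfolding X_def using eH by (rule Q.norm_le)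
    ultimately show ?thesis by (simp add: e_def G_def s_def)
  qed
  then show ?thesis using \<gamma> \<rho> by (intro exI[of _ C]) (auto simp: C_def)
qed

section \<open>Decomposition of test vectors\<close>

text \<open>By quadratic degeneracy the \<open>W \<theta>\<close>-component of \<open>u\<close> is of size \<open>\<epsilon> / (\<epsilon> + norm \<theta>)\<close>.  This absorbs the
  factor \<open>norm \<theta>\<close> lost in replacing the \<open>Vs\<close>-part of that component by a nearby vector of \<open>V \<theta>\<close>.\<close>

lemma test_decomposition:
  "\<exists>\<rho>>0. \<rho> \<le> r0 \<and> (\<exists>C\<ge>0. \<forall>\<theta> \<epsilon>. \<forall>u\<in>H. norm \<theta> \<le> \<rho> \<longrightarrow> 0 < \<epsilon> \<longrightarrow> \<epsilon> < 1 \<longrightarrow>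
    (\<exists>x\<in>Vs. \<exists>z\<in>Z. \<exists>w\<in>H. u = E \<theta> x + T \<theta> z + w
      \<and> n0 x \<le> C * form_norm (Q \<epsilon> \<theta>) u
      \<and> (\<epsilon> + norm \<theta>) * n0 z \<le> C * \<epsilon> * form_norm (Q \<epsilon> \<theta>) u
      \<and> n0 w \<le> C * \<epsilon> * form_norm (Q \<epsilon> \<theta>) u))"
proof -
  \<comment> \<open>Within this radius the Lipschitz condition leaves \<open>a \<theta>\<close> at
    least half of the spectral gap of \<open>a 0\<close> on \<open>W 0\<close>.\<close>
  define \<rho> where "\<rho> = min r0 (\<nu> / (2 * (La + 1)))"
  have \<rho>: "0 < \<rho>" "\<rho> \<le> r0" "La * \<rho> \<le> \<nu> / 2"
  proof -
    show "0 < \<rho>" "\<rho> \<le> r0" using r0 \<nu> La by (auto simp: \<rho>_def)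
    have "La * \<rho> \<le> (La + 1) * (\<nu> / (2 * (La + 1)))"
      using La \<open>0 < \<rho>\<close> by (intro mult_mono) (auto simp: \<rho>_def)
    also have "\<dots> = \<nu> / 2" using La by (simp add: divide_simps)
    finally show "La * \<rho> \<le> \<nu> / 2" .
  qed
  \<comment> \<open>\<open>K\<close> is for the weight \<epsilon>, \<open>K / sqrt \<gamma>\<close>
    for the weight \<open>norm \<theta>\<close>.\<close>
  define cA where "cA = K * (1 + 1 / sqrt \<gamma>)"
  have cA: "0 \<le> cA" "1 \<le> cA" "K \<le> cA" "K / sqrt \<gamma> \<le> cA" "K + K / sqrt \<gamma> \<le> cA"
  proof -
    show "K \<le> cA" "K / sqrt \<gamma> \<le> cA" "K + K / sqrt \<gamma> \<le> cA" using K \<gamma> by (auto simp: cA_def field_simps)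
    then show "0 \<le> cA" "1 \<le> cA" using K by auto
  qed
  \<comment> \<open>Comes from \<open>w1\<close> below: \<open>2 / \<nu>\<close> from the halved
    gap, \<open>K\<close> from pairing \<open>w1\<close> with \<open>u1\<close>, and
    \<open>C3 * cA\<close> from pairing it with \<open>T \<theta> v0\<close>.\<close>
  define D where "D = 2 / \<nu> * (K + C3 * cA)"
  define C where "C = (1 + (K + Ls) * cZ * K) + cZ * cA + (K * Ls * cZ * cA + CN * cZ * cA + D)"
  have D0: "0 \<le> D" using \<nu> K C3 cA by (simp add: D_def)
  have pos: "0 \<le> (K + Ls) * cZ * K" "0 \<le> cZ * cA" "0 \<le> K * Ls * cZ * cA" "0 \<le> CN * cZ * cA"
    using K Ls cZ cA CN by simp_all
  have C: "1 + (K + Ls) * cZ * K \<le> C" "cZ * cA \<le> C" "K * Ls * cZ * cA + CN * cZ * cA + D \<le> C"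
    using pos D0 unfolding C_def by linarith+
  have "\<exists>x\<in>Vs. \<exists>z\<in>Z. \<exists>w\<in>H. u = E \<theta> x + T \<theta> z + w
      \<and> n0 x \<le> C * form_norm (Q \<epsilon> \<theta>) u
      \<and> (\<epsilon> + norm \<theta>) * n0 z \<le> C * \<epsilon> * form_norm (Q \<epsilon> \<theta>) u
      \<and> n0 w \<le> C * \<epsilon> * form_norm (Q \<epsilon> \<theta>) u"
    if u: "u \<in> H" and \<theta>: "norm \<theta> \<le> \<rho>" and \<epsilon>: "0 < \<epsilon>" "\<epsilon> < 1" for \<theta> \<epsilon> u
  proof -
    have \<theta>r: "norm \<theta> \<le> r0" "norm \<theta> \<le> 1" and \<theta>\<Theta>: "\<theta> \<in> \<Theta>" using \<theta> \<rho> r0 by auto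
    interpret Q: form_solution UNIV "d \<theta>" H "Q \<epsilon> \<theta>" using \<theta>\<Theta> \<epsilon> by (rule solution_Q)
    interpret s: hilbert_form H "sum_form a b \<theta>" using \<theta>\<Theta> by (rule hilbert)
    interpret a: nonneg_form H "a \<theta>" using \<theta>\<Theta> by (rule a_form)
    define q where "q = form_norm (Q \<epsilon> \<theta>) u"
    have q: "0 \<le> q" using u by (simp add: q_def)
    have nu: "nm \<theta> u \<le> q" "form_norm (a \<theta>) u \<le> \<epsilon> * q"
      unfolding q_def using nm_le_Q[OF \<theta>\<Theta> \<epsilon> u] fn_a_le_Q[OF \<theta>\<Theta> \<epsilon> u] .
    have \<epsilon>q: "0 \<le> \<epsilon> * q" using \<epsilon> q by simp
    obtain v1 u1 where split: "v1 \<in> Vstar_space H a Vs \<theta>" "u1 \<in> H" "u = v1 + u1" "nm \<theta> v1 \<le> q"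
      "n0 u1 \<le> K * q" "(\<epsilon> + norm \<theta>) * n0 u1 \<le> cA * (\<epsilon> * q)" "form_norm (a \<theta>) u1 \<le> \<epsilon> * q"
    proof (cases "\<theta> = 0")
      \<comment> \<open>Here \<open>Vstar_space\<close> is \<open>Vs\<close>, smaller than
        \<open>V 0\<close>, so projecting to \<open>V 0\<close> would not give an admissible
        \<open>v1\<close>. The choice \<open>v1 = 0\<close> is enough, since the weight reduces to
        \<epsilon>.\<close>
      case True
      have "n0 u \<le> q" using nu True by simp
      then have "n0 u \<le> K * q" "\<epsilon> * n0 u \<le> cA * (\<epsilon> * q)"
        using K q mult_right_mono[of 1 K q] mult_right_mono[of 1 cA "\<epsilon> * q"] cA \<epsilon>q \<epsilon>
          mult_left_mono[of "n0 u" q \<epsilon>] by linarith+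
      then show ?thesis
        using that[of 0 u] Vs_Z_simps q u nu True by (simp add: Vstar_space_def)
    next
      case False
      obtain v w where vw: "v \<in> V \<theta>" "w \<in> W \<theta>" "u = v + w" "nm \<theta> v \<le> nm \<theta> u" "nm \<theta> w \<le> nm \<theta> u"
        using decompose[OF \<theta>\<Theta> u] by metis
      note vH = V_sub[OF vw(1)] and wH = W_sub[OF vw(2)]
      have aw: "form_norm (a \<theta>) w = form_norm (a \<theta>) u"
        unfolding form_norm_def qf_def vw(3) using vH wH V_null_left[OF \<theta>\<Theta> vw(1)] V_null_right[OF \<theta>\<Theta> vw(1)]
        by (simp add: a.form_simps)
      have nw: "n0 w \<le> K * q"
        using n0_le[OF \<theta>\<Theta> wH] mult_left_mono[of "nm \<theta> w" q K] vw(5) nu K by linarith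
      have "sqrt (\<gamma> * (norm \<theta>)\<^sup>2 * (nm \<theta> w)\<^sup>2) \<le> form_norm (a \<theta>) w"
        unfolding form_norm_def[of "a \<theta>"] using degeneracy[OF \<theta>\<Theta> vw(2)] by (rule real_sqrt_le_mono)
      then have "sqrt \<gamma> * norm \<theta> * nm \<theta> w \<le> \<epsilon> * q"
        using nu(2) wH \<theta>\<Theta> unfolding real_sqrt_mult real_sqrt_abs aw by simp
      then have "norm \<theta> * nm \<theta> w \<le> \<epsilon> * q / sqrt \<gamma>" using \<gamma> by (simp add: field_simps)
      then have "K * (norm \<theta> * nm \<theta> w) \<le> K * (\<epsilon> * q / sqrt \<gamma>)" using K by (intro mult_left_mono) auto
      moreover have "norm \<theta> * n0 w \<le> norm \<theta> * (K * nm \<theta> w)"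
        using n0_le[OF \<theta>\<Theta> wH] by (intro mult_left_mono) auto
      ultimately have "norm \<theta> * n0 w \<le> (K / sqrt \<gamma>) * (\<epsilon> * q)" by (simp add: mult_ac)
      moreover have "\<epsilon> * n0 w \<le> K * (\<epsilon> * q)" using mult_left_mono[OF nw, of \<epsilon>] \<epsilon> by (simp add: mult_ac)
      ultimately have "(\<epsilon> + norm \<theta>) * n0 w \<le> (K + K / sqrt \<gamma>) * (\<epsilon> * q)" by (simp add: distrib_right)
      also have "\<dots> \<le> cA * (\<epsilon> * q)" using cA(5) \<epsilon>q by (rule mult_right_mono)
      finally show ?thesis
        using that[of v w] vw(1,3,4) wH nw nu aw False by (simp add: Vstar_space_def)
    qed
    define y where "y = n0 u1"
    have y: "0 \<le> y" using split by (simp add: y_def)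
    have yb: "norm \<theta> * y \<le> cA * (\<epsilon> * q)"
      using split(6) mult_nonneg_nonneg[OF less_imp_le[OF \<epsilon>(1)] y] unfolding y_def distrib_right by linarith
    obtain v0 w0 where vw0: "v0 \<in> V 0" "w0 \<in> W 0" "u1 = v0 + w0" "n0 v0 \<le> y" "n0 w0 \<le> y"
      using decompose[OF zero_Theta split(2)] unfolding y_def by metis
    obtain vs z where vz: "vs \<in> Vs" "z \<in> Z" "v0 = vs + z" using vw0(1) by (rule V0_E)
    note vsV = Vs_V0[OF vz(1)] and zV = Z_V0[OF vz(2)]
    note mem = V_sub[OF vw0(1)] W_sub[OF vw0(2)] Vs_H[OF vz(1)] Z_H[OF vz(2)] N_H[OF vw0(1), of \<theta>]
      N_H[OF vsV, of \<theta>] N_H[OF zV, of \<theta>]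
    have nvs: "n0 vs \<le> cZ * y" and nz: "n0 z \<le> cZ * y"
      using component_bounds[OF vz(1,2)] mult_left_mono[OF vw0(4) less_imp_le[OF cZ]]
      unfolding vz(3) by linarith+
    \<comment> \<open>\<open>vs\<close> need not be null for \<open>a \<theta>\<close>. Its
      neighbour \<open>v2\<close> joins \<open>v1\<close>, and the displacement
      \<open>vs - v2\<close> carries the factor \<open>norm \<theta>\<close> that \<open>yb\<close>
      converts into \<epsilon>.\<close>
    obtain v2 where v2: "v2 \<in> Vstar_space H a Vs \<theta>" "nm \<theta> (vs - v2) \<le> Ls * norm \<theta> * n0 vs"
      using near[OF zero_Theta \<theta>\<Theta>, of vs] vz(1) by (auto simp: Vstar_space_def)
    have v2H: "v2 \<in> H" using v2 Vst_V V_sub by blast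
    have v1H: "v1 \<in> H" using split Vst_V V_sub by blast
    have "complex_vector.subspace (Vstar_space H a Vs \<theta>)"
      using Vs_subspace V_subspace[OF \<theta>\<Theta>] by (simp add: Vstar_space_def)
    then have "v1 + v2 \<in> Vstar_space H a Vs \<theta>"
      using split(1) v2(1) by (rule complex_vector.subspace_add)
    then obtain x where x: "x \<in> Vs" "v1 + v2 = E \<theta> x" using E_Vst_surj[OF \<theta>\<Theta>] by blast
    \<comment> \<open>This gives \<open>u1 = T \<theta> v0 + w1\<close>. In the final form only
      \<open>z\<close> keeps its corrector, so \<open>N \<theta> vs\<close> moves into
      \<open>w\<close>.\<close>
    define w1 where "w1 = w0 - N \<theta> v0"
    have w1W: "w1 \<in> W 0" using vw0 N_W by (simp add: w1_def W0_simps)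
    have w1H: "w1 \<in> H" using W_sub[OF w1W] .
    define w where "w = (vs - v2) + w1 + N \<theta> vs"
    have wH: "w \<in> H" using mem v2H w1H by (simp add: w_def)
    have "N \<theta> v0 = N \<theta> vs + N \<theta> z" unfolding vz(3) using vsV zV by (rule N_add)
    then have eq: "u = E \<theta> x + T \<theta> z + w"
      by (simp add: split(3) vw0(3) vz(3) w_def w1_def T_def x(2)[symmetric])
    have n2: "nm \<theta> (vs - v2) \<le> Ls * cZ * (norm \<theta> * y)"
      using v2(2) mult_left_mono[OF nvs, of "Ls * norm \<theta>"] Ls by (simp add: mult_ac)
    have p1: "n0 (vs - v2) \<le> K * Ls * cZ * cA * (\<epsilon> * q)"
    proof -
      have "n0 (vs - v2) \<le> K * nm \<theta> (vs - v2)" using \<theta>\<Theta> mem v2H by (intro n0_le) auto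
      also have "\<dots> \<le> K * (Ls * cZ * (norm \<theta> * y))" using n2 K by (intro mult_left_mono) auto
      also have "\<dots> = (K * Ls * cZ) * (norm \<theta> * y)" by simp
      also have "\<dots> \<le> (K * Ls * cZ) * (cA * (\<epsilon> * q))" using yb K Ls cZ by (intro mult_left_mono) auto
      finally show ?thesis by (simp add: mult.assoc)
    qed
    have p2: "n0 (N \<theta> vs) \<le> CN * cZ * cA * (\<epsilon> * q)"
    proof -
      have "n0 (N \<theta> vs) \<le> CN * norm \<theta> * (cZ * y)"
        using N_bound[OF vsV, of \<theta>] mult_left_mono[OF nvs, of "CN * norm \<theta>"] CN by simp
      also have "\<dots> = (CN * cZ) * (norm \<theta> * y)" by simp
      also have "\<dots> \<le> (CN * cZ) * (cA * (\<epsilon> * q))" using yb CN cZ by (intro mult_left_mono) auto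
      finally show ?thesis by (simp add: mult.assoc)
    qed
    \<comment> \<open>\<open>a \<theta>\<close> is coercive at \<open>w1\<close>. In
      \<open>a \<theta> w1 w1\<close> the part from \<open>u1\<close> is small because its seminorm
      is at most \<open>\<epsilon> * q\<close>; the part from \<open>T \<theta> v0\<close> is
      quadratic in \<theta>, and one factor \<open>norm \<theta>\<close> with \<open>y\<close> turns
      into \<epsilon>.\<close>
    have p3: "n0 w1 \<le> D * (\<epsilon> * q)"
    proof (cases "n0 w1 = 0")
      case True then show ?thesis using D0 \<epsilon>q by simp
    next
      case False
      then have npos: "0 < n0 w1" using w1H by (simp add: less_le)
      have "\<nu> * (n0 w1)\<^sup>2 \<le> qf (a 0) w1" by (rule gap[OF w1W])
      also have "\<dots> \<le> qf (a \<theta>) w1 + La * norm \<theta> * n0 w1 * n0 w1"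
        using lipschitz[OF w1H w1H \<theta>\<Theta>] abs_Re_le_cmod[of "a \<theta> w1 w1 - a 0 w1 w1"] by (simp add: qf_def)
      also have "La * norm \<theta> * n0 w1 * n0 w1 \<le> \<nu> / 2 * (n0 w1)\<^sup>2"
      proof -
        have "La * norm \<theta> \<le> \<nu> / 2" using \<theta> La \<rho>(3) mult_left_mono[OF \<theta>, of La] by linarith
        then have "(La * norm \<theta>) * (n0 w1)\<^sup>2 \<le> \<nu> / 2 * (n0 w1)\<^sup>2" by (rule mult_right_mono) simp
        then show ?thesis by (simp add: power2_eq_square mult.assoc)
      qed
      finally have 1: "\<nu> / 2 * (n0 w1)\<^sup>2 \<le> qf (a \<theta>) w1" by simp
      have "u1 = T \<theta> v0 + w1" by (simp add: vw0(3) T_def w1_def)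
      then have "a \<theta> w1 w1 = a \<theta> w1 u1 - a \<theta> w1 (T \<theta> v0)"
        using w1H T_H[OF vw0(1), of \<theta>] by (simp add: a.form_simps)
      then have "qf (a \<theta>) w1 \<le> cmod (a \<theta> w1 u1) + cmod (a \<theta> w1 (T \<theta> v0))"
        unfolding qf_def by (metis complex_Re_le_cmod norm_triangle_ineq4 order_trans)
      also have "cmod (a \<theta> w1 u1) \<le> K * n0 w1 * (\<epsilon> * q)"
      proof -
        have "cmod (a \<theta> w1 u1) \<le> form_norm (a \<theta>) w1 * form_norm (a \<theta>) u1"
          using \<theta>\<Theta> w1H split(2) by (rule a_bound)
        also have "\<dots> \<le> (K * n0 w1) * (\<epsilon> * q)"
          using fn_a_n0[OF \<theta>\<Theta> w1H] split(7) split(2) w1H K by (intro mult_mono) auto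
        finally show ?thesis .
      qed
      also have "cmod (a \<theta> w1 (T \<theta> v0)) \<le> C3 * cA * (\<epsilon> * q) * n0 w1"
      proof -
        have "a \<theta> w1 (T \<theta> v0) = cnj (a \<theta> (T \<theta> v0) w1)" using w1H T_H[OF vw0(1)] by (intro a.hermitian)
        then have "cmod (a \<theta> w1 (T \<theta> v0)) = cmod (a \<theta> (T \<theta> v0) w1)" by (simp only: complex_mod_cnj)
        also have "\<dots> \<le> C3 * (norm \<theta>)\<^sup>2 * n0 v0 * n0 w1" using vw0(1) w1H \<theta>r(1) by (rule a_T_bound)
        also have "\<dots> = C3 * (norm \<theta> * (norm \<theta> * n0 v0)) * n0 w1" by (simp add: power2_eq_square)
        also have "\<dots> \<le> C3 * (cA * (\<epsilon> * q)) * n0 w1"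
        proof (intro mult_right_mono mult_left_mono)
          have "norm \<theta> * (norm \<theta> * n0 v0) \<le> 1 * (norm \<theta> * y)"
            using \<theta>r(2) vw0(4) mem(1) by (intro mult_mono) auto
          then show "norm \<theta> * (norm \<theta> * n0 v0) \<le> cA * (\<epsilon> * q)" using yb by simp
        qed (use C3 w1H in auto)
        finally show ?thesis by (simp add: mult.assoc)
      qed
      finally have "\<nu> / 2 * n0 w1 * n0 w1 \<le> (K + C3 * cA) * (\<epsilon> * q) * n0 w1"
        using 1 by (simp add: power2_eq_square algebra_simps)
      then have "\<nu> / 2 * n0 w1 \<le> (K + C3 * cA) * (\<epsilon> * q)" using npos by (simp add: mult_le_cancel_right)
      then have "2 / \<nu> * (\<nu> / 2 * n0 w1) \<le> 2 / \<nu> * ((K + C3 * cA) * (\<epsilon> * q))"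
        using \<nu> by (intro mult_left_mono) auto
      moreover have "2 / \<nu> * (\<nu> / 2 * n0 w1) = n0 w1" using \<nu> by simp
      ultimately show ?thesis unfolding D_def by (simp only: mult.assoc)
    qed
    have "n0 w \<le> n0 (vs - v2) + n0 w1 + n0 (N \<theta> vs)"
    proof -
      have "n0 ((vs - v2) + w1) \<le> n0 (vs - v2) + n0 w1"
        using mem v2H w1H by (intro s0.form_norm_triangle) auto
      moreover have "n0 w \<le> n0 ((vs - v2) + w1) + n0 (N \<theta> vs)"
        unfolding w_def using mem v2H w1H by (intro s0.form_norm_triangle) auto
      ultimately show ?thesis by linarith
    qed
    then have "n0 w \<le> (K * Ls * cZ * cA + CN * cZ * cA + D) * (\<epsilon> * q)"
      using p1 p2 p3 by (simp add: distrib_right)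
    also have "\<dots> \<le> C * (\<epsilon> * q)" using C(3) \<epsilon>q by (rule mult_right_mono)
    finally have R1: "n0 w \<le> C * \<epsilon> * q" by simp
    have "(\<epsilon> + norm \<theta>) * n0 z \<le> (\<epsilon> + norm \<theta>) * (cZ * y)" using nz \<epsilon> by (intro mult_left_mono) auto
    also have "\<dots> = cZ * ((\<epsilon> + norm \<theta>) * y)" by simp
    also have "\<dots> \<le> cZ * (cA * (\<epsilon> * q))" using split(6) cZ unfolding y_def by (intro mult_left_mono) auto
    also have "\<dots> = (cZ * cA) * (\<epsilon> * q)" by simp
    also have "\<dots> \<le> C * (\<epsilon> * q)" using C(2) \<epsilon>q by (rule mult_right_mono)
    finally have R2: "(\<epsilon> + norm \<theta>) * n0 z \<le> C * \<epsilon> * q" by simp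
    have "nm \<theta> v2 \<le> (K + Ls) * cZ * K * q"
    proof -
      have "nm \<theta> v2 \<le> nm \<theta> vs + nm \<theta> (vs - v2)"
        using s.form_norm_triangle_diff[of vs "vs - v2"] mem v2H by simp
      also have "\<dots> \<le> K * n0 vs + Ls * 1 * n0 vs"
        using nm_le[OF \<theta>\<Theta> mem(3)] v2(2) \<theta>r(2) Ls mem
          mult_right_mono[OF mult_left_mono[OF \<theta>r(2) Ls], of "n0 vs"] by fastforce
      also have "\<dots> = (K + Ls) * n0 vs" by (simp add: distrib_right)
      also have "\<dots> \<le> (K + Ls) * (cZ * (K * q))"
      proof (rule mult_left_mono)
        show "n0 vs \<le> cZ * (K * q)"
          using nvs mult_left_mono[OF split(5) less_imp_le[OF cZ]] unfolding y_def by linarith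
      qed (use K Ls in simp)
      finally show ?thesis by (simp add: mult.assoc)
    qed
    then have "nm \<theta> (E \<theta> x) \<le> (1 + (K + Ls) * cZ * K) * q"
      using s.form_norm_triangle[OF v1H v2H] split(4) unfolding x(2)[symmetric] distrib_right by simp
    then have "n0 x \<le> (1 + (K + Ls) * cZ * K) * q"
      using fn_b_E[OF \<theta>\<Theta> x(1)] fn_b_le[OF \<theta>\<Theta> E_H[OF \<theta>\<Theta> x(1)]] by simp
    also have "\<dots> \<le> C * q" using C(1) q by (rule mult_right_mono)
    finally have R3: "n0 x \<le> C * q" .
    show ?thesis
      using eq x(1) vz(2) wH R1 R2 R3 unfolding q_def by blast
  qed
  moreover have "0 \<le> C" using C(1) pos(1) by linarith
  ultimately show ?thesis using \<rho> by blast
qed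

text \<open>The ten summands belong, in this order, to the error terms \<open>e1\<close> to
  \<open>e10\<close> of the energy comparison.\<close>

definition C7 where
  "C7 = C6 + C3 + Kb + K * CN + Kb + K * CN + Lb + K\<^sup>2 * CN + K\<^sup>2 * (CN * (1 + CN)) + (1 + K * (1 + CN)) * K"

lemma C7: "0 \<le> C7"
  using C6 C3 Kb K CN Lb by (simp add: C7_def)

text \<open>The \<open>V \<theta>\<close>-parts drop out of \<open>a \<theta>\<close> and are matched exactly by \<open>E \<theta>\<close>; so every error term
  contains a \<open>Z\<close>-component or \<open>w\<close>, and those carry the factor \<open>\<epsilon>\<close>.\<close>

lemma energy_comparison:
  assumes \<theta>: "norm \<theta> \<le> r0" and \<epsilon>: "0 < \<epsilon>" "\<epsilon> < 1" and c: "0 \<le> c" and G: "0 \<le> G" and q: "0 \<le> q"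
    and v: "v \<in> Vs" and h: "h \<in> Z" and x: "x \<in> Vs" and z: "z \<in> Z" and w: "w \<in> H"
    and bv: "n0 v \<le> c * G" and bh: "(1 + (norm \<theta> / \<epsilon>)\<^sup>2) * n0 h \<le> c * G" and bx: "n0 x \<le> c * q"
    and bz: "(\<epsilon> + norm \<theta>) * n0 z \<le> c * \<epsilon> * q" and bw: "n0 w \<le> c * \<epsilon> * q"
  shows "cmod (Q \<epsilon> \<theta> (E \<theta> v + T \<theta> h) (E \<theta> x + T \<theta> z + w) - S ((1 / \<epsilon>) *\<^sub>R \<theta>) (v + h) (x + z))
    \<le> C7 * (c * G * (c * \<epsilon> * q))"
proof -
  have \<theta>\<Theta>: "\<theta> \<in> \<Theta>" using \<theta> by simp
  interpret a: nonneg_form H "a \<theta>" using \<theta>\<Theta> by (rule a_form)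
  interpret b: nonneg_form H "b \<theta>" using \<theta>\<Theta> by (rule b_form)
  define M where "M = c * G * (c * \<epsilon> * q)"
  define \<tau> where "\<tau> = norm \<theta>"
  note hV = Z_V0[OF h] and zV = Z_V0[OF z]
  note mem [simp] = E_H[OF \<theta>\<Theta> v] E_H[OF \<theta>\<Theta> x] Z_H[OF h] Z_H[OF z] Vs_H[OF v] Vs_H[OF x] w
    N_H[OF hV] N_H[OF zV] T_H[OF hV] T_H[OF zV]
  have \<tau>: "0 \<le> \<tau>" by (simp add: \<tau>_def)
  have h1: "n0 h \<le> c * G"
    using bh mult_nonneg_nonneg[OF zero_le_power2[of "norm \<theta> / \<epsilon>"] s0.form_norm_nonneg[OF Z_H[OF h]]]
    unfolding distrib_right by linarith
  have h2: "(\<tau> / \<epsilon>)\<^sup>2 * n0 h \<le> c * G" 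
    using bh s0.form_norm_nonneg[OF Z_H[OF h]] unfolding distrib_right \<tau>_def by linarith
  \<comment> \<open>Intermediate weight between \<open>h1\<close> and \<open>h2\<close>:
    |\<theta>|/\<epsilon> is at most 1 plus its square.\<close>
  have h3: "\<tau> * n0 h \<le> c * \<epsilon> * G"
  proof -
    have "\<tau> / \<epsilon> * n0 h \<le> c * G"
      using bh mult_right_mono[OF le_one_plus_square[of "\<tau> / \<epsilon>"] s0.form_norm_nonneg[OF Z_H[OF h]]]
      by (simp add: \<tau>_def)
    then show ?thesis using \<epsilon> by (simp add: field_simps)
  qed
  have z1: "\<tau> * n0 z \<le> c * \<epsilon> * q"
    using bz mult_nonneg_nonneg[OF less_imp_le[OF \<epsilon>(1)] s0.form_norm_nonneg[OF Z_H[OF z]]]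
    unfolding \<tau>_def distrib_right by linarith
  have z2: "n0 z \<le> c * q"
  proof -
    have "\<epsilon> * n0 z \<le> c * \<epsilon> * q"
      using bz mult_nonneg_nonneg[OF \<tau> s0.form_norm_nonneg[OF Z_H[OF z]]]
      unfolding \<tau>_def distrib_right by linarith
    then have "\<epsilon> * n0 z \<le> \<epsilon> * (c * q)" by (simp only: mult_ac)
    then show ?thesis using \<epsilon> by simp
  qed
  have cs: "0 \<le> c * G" "0 \<le> c * q" "0 \<le> c * \<epsilon> * q" "0 \<le> c * \<epsilon> * G" using c G q \<epsilon> by simp_all
  \<comment> \<open>In \<open>P1\<close> the factor \<epsilon> comes from the test side, in
    \<open>P2\<close> from the solution side; each error term fits one of the two patterns.\<close>
  have P1: "D * (X * Y) \<le> D * M" if "0 \<le> D" "0 \<le> Y" "X \<le> c * G" "Y \<le> c * \<epsilon> * q" for D X Y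
    unfolding M_def using that cs by (intro mult_left_mono mult_mono) auto
  have P2: "D * (X * Y) \<le> D * M" if "0 \<le> D" "0 \<le> Y" "X \<le> c * \<epsilon> * G" "Y \<le> c * q" for D X Y
  proof -
    have "X * Y \<le> (c * \<epsilon> * G) * (c * q)" using that cs by (intro mult_mono) auto
    also have "\<dots> = M" by (simp add: M_def)
    finally show ?thesis using that(1) by (rule mult_left_mono)
  qed
  have nN: "n0 (N \<theta> h) \<le> CN * \<tau> * n0 h" "n0 (N \<theta> z) \<le> CN * \<tau> * n0 z"
    using N_bound[OF hV, of \<theta>] N_bound[OF zV, of \<theta>] by (simp_all add: \<tau>_def)
  have nT: "n0 (T \<theta> h) \<le> (1 + CN) * n0 h" "n0 (T \<theta> z) \<le> (1 + CN) * n0 z"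
    using T_bound[OF hV \<theta>] T_bound[OF zV \<theta>] by simp_all
  have ab: "cmod (b \<theta> u u') \<le> X * Y"
    if "u \<in> H" "u' \<in> H" "form_norm (b \<theta>) u \<le> X" "form_norm (b \<theta>) u' \<le> Y" for u u' X Y
    using b_bound[OF \<theta>\<Theta> that(1,2)] mult_mono[OF that(3,4)] that(1,2) b.form_norm_nonneg[OF that(1)]
      order_trans[OF b.form_norm_nonneg[OF that(1)] that(3)] by simp
  define e1 where "e1 = complex_of_real (1 / \<epsilon>\<^sup>2) * (a \<theta> (T \<theta> h) (T \<theta> z) - ah \<theta> h z)"
  define e2 where "e2 = complex_of_real (1 / \<epsilon>\<^sup>2) * a \<theta> (T \<theta> h) w"
  define e3 where "e3 = b \<theta> h (E \<theta> x) - b 0 h x"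
  define e4 where "e4 = b \<theta> (N \<theta> h) (E \<theta> x)"
  define e5 where "e5 = b \<theta> (E \<theta> v) z - b 0 v z"
  define e6 where "e6 = b \<theta> (E \<theta> v) (N \<theta> z)"
  define e7 where "e7 = b \<theta> h z - b 0 h z"
  define e8 where "e8 = b \<theta> h (N \<theta> z)"
  define e9 where "e9 = b \<theta> (N \<theta> h) (T \<theta> z)"
  define e10 where "e10 = b \<theta> (E \<theta> v + T \<theta> h) w"
  have ne: "cmod (complex_of_real (1 / \<epsilon>\<^sup>2)) = 1 / \<epsilon>\<^sup>2" by (simp only: norm_of_real) simp
  have b1: "cmod e1 \<le> C6 * M"
  proof -
    have "cmod e1 \<le> 1 / \<epsilon>\<^sup>2 * (C6 * \<tau> ^ 3 * n0 h * n0 z)"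
      unfolding e1_def norm_mult ne \<tau>_def using a_T_expansion[OF hV zV \<theta>] by (intro mult_left_mono) auto
    also have "\<dots> = C6 * (((\<tau> / \<epsilon>)\<^sup>2 * n0 h) * (\<tau> * n0 z))"
      by (simp add: power2_eq_square power3_eq_cube)
    also have "\<dots> \<le> C6 * M" using C6 \<tau> h2 z1 by (intro P1) auto
    finally show ?thesis .
  qed
  have b2: "cmod e2 \<le> C3 * M"
  proof -
    have "cmod e2 \<le> 1 / \<epsilon>\<^sup>2 * (C3 * \<tau>\<^sup>2 * n0 h * n0 w)"
      unfolding e2_def norm_mult ne \<tau>_def using a_T_bound[OF hV w \<theta>] by (intro mult_left_mono) auto
    also have "\<dots> = C3 * (((\<tau> / \<epsilon>)\<^sup>2 * n0 h) * n0 w)"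
      by (simp add: power2_eq_square)
    also have "\<dots> \<le> C3 * M" using C3 h2 bw by (intro P1) auto
    finally show ?thesis .
  qed
  have b3: "cmod e3 \<le> Kb * M"
  proof -
    \<comment> \<open>The transfer bound has the \<open>Vs\<close>-argument on the left, hence the
      passage to conjugates.\<close>
    have "e3 = cnj (b \<theta> (E \<theta> x) h - b 0 x h)"
      unfolding e3_def using b.hermitian[of "E \<theta> x" h] b0.hermitian[of x h] by simp
    then have "cmod e3 \<le> Kb * \<tau> * n0 x * n0 h"
      using E_b_Z[OF \<theta>\<Theta> x h] by (simp only: complex_mod_cnj \<tau>_def)
    also have "\<dots> = Kb * ((\<tau> * n0 h) * n0 x)" by simp
    also have "\<dots> \<le> Kb * M" using Kb h3 bx by (intro P2) auto
    finally show ?thesis .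
  qed
  have fN: "form_norm (b \<theta>) (N \<theta> h) \<le> K * (CN * \<tau> * n0 h)" "form_norm (b \<theta>) (N \<theta> z) \<le> K * (CN * \<tau> * n0 z)"
    using fn_b_n0[OF \<theta>\<Theta> N_H[OF hV]] fn_b_n0[OF \<theta>\<Theta> N_H[OF zV]] nN K
    by (meson order_trans mult_left_mono order_trans[OF zero_le_one])+
  have fT: "form_norm (b \<theta>) (T \<theta> h) \<le> K * ((1 + CN) * n0 h)" "form_norm (b \<theta>) (T \<theta> z) \<le> K * ((1 + CN) * n0 z)"
    using fn_b_n0[OF \<theta>\<Theta> T_H[OF hV]] fn_b_n0[OF \<theta>\<Theta> T_H[OF zV]] nT K
    by (meson order_trans mult_left_mono order_trans[OF zero_le_one])+
  have b4: "cmod e4 \<le> (K * CN) * M"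
  proof -
    have "cmod e4 \<le> (K * (CN * \<tau> * n0 h)) * n0 x"
      unfolding e4_def using fN fn_b_E[OF \<theta>\<Theta> x] by (intro ab) auto
    also have "\<dots> = (K * CN) * ((\<tau> * n0 h) * n0 x)" by simp
    also have "\<dots> \<le> (K * CN) * M" using K CN h3 bx by (intro P2) auto
    finally show ?thesis .
  qed
  have b5: "cmod e5 \<le> Kb * M"
  proof -
    have "cmod e5 \<le> Kb * (n0 v * (\<tau> * n0 z))"
      unfolding e5_def using E_b_Z[OF \<theta>\<Theta> v z] by (simp add: \<tau>_def mult_ac)
    also have "\<dots> \<le> Kb * M" using Kb \<tau> bv z1 by (intro P1) auto
    finally show ?thesis .
  qed
  have b6: "cmod e6 \<le> (K * CN) * M"
  proof -
    have "cmod e6 \<le> n0 v * (K * (CN * \<tau> * n0 z))"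
      unfolding e6_def using fN fn_b_E[OF \<theta>\<Theta> v] by (intro ab) auto
    also have "\<dots> = (K * CN) * (n0 v * (\<tau> * n0 z))" by simp
    also have "\<dots> \<le> (K * CN) * M" using K CN \<tau> bv z1 by (intro P1) auto
    finally show ?thesis .
  qed
  have b7: "cmod e7 \<le> Lb * M"
  proof -
    have "cmod e7 \<le> Lb * (n0 h * (\<tau> * n0 z))"
      unfolding e7_def using b_expansion[OF hV zV \<theta>\<Theta>] by (simp add: \<tau>_def mult_ac)
    also have "\<dots> \<le> Lb * M" using Lb \<tau> h1 z1 by (intro P1) auto
    finally show ?thesis .
  qed
  have b8: "cmod e8 \<le> (K\<^sup>2 * CN) * M"
  proof -
    have "cmod e8 \<le> (K * n0 h) * (K * (CN * \<tau> * n0 z))"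
      unfolding e8_def using fN fn_b_n0[OF \<theta>\<Theta> Z_H[OF h]] by (intro ab) auto
    also have "\<dots> = (K\<^sup>2 * CN) * (n0 h * (\<tau> * n0 z))" by (simp add: power2_eq_square)
    also have "\<dots> \<le> (K\<^sup>2 * CN) * M" using CN \<tau> h1 z1 by (intro P1) auto
    finally show ?thesis .
  qed
  have b9: "cmod e9 \<le> (K\<^sup>2 * (CN * (1 + CN))) * M"
  proof -
    have "cmod e9 \<le> (K * (CN * \<tau> * n0 h)) * (K * ((1 + CN) * n0 z))"
      unfolding e9_def using fN fT by (intro ab) auto
    also have "\<dots> = (K\<^sup>2 * (CN * (1 + CN))) * ((\<tau> * n0 h) * n0 z)" by (simp add: power2_eq_square)
    also have "\<dots> \<le> (K\<^sup>2 * (CN * (1 + CN))) * M" using CN h3 z2 by (intro P2) auto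
    finally show ?thesis .
  qed
  have b10: "cmod e10 \<le> ((1 + K * (1 + CN)) * K) * M"
  proof -
    have "form_norm (b \<theta>) (E \<theta> v + T \<theta> h) \<le> n0 v + K * ((1 + CN) * n0 h)"
      using b.form_norm_triangle[of "E \<theta> v" "T \<theta> h"] fn_b_E[OF \<theta>\<Theta> v] fT(1) by simp
    also have "\<dots> \<le> c * G + K * ((1 + CN) * (c * G))"
      using bv h1 K CN by (intro add_mono mult_left_mono) auto
    also have "\<dots> = (1 + K * (1 + CN)) * (c * G)" by (simp add: algebra_simps)
    finally have "cmod e10 \<le> ((1 + K * (1 + CN)) * (c * G)) * (K * n0 w)"
      unfolding e10_def using fn_b_n0[OF \<theta>\<Theta> w] by (intro ab) auto
    also have "\<dots> = ((1 + K * (1 + CN)) * K) * ((c * G) * n0 w)" by simp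
    also have "\<dots> \<le> ((1 + K * (1 + CN)) * K) * M" using K CN bw by (intro P1) auto
    finally show ?thesis .
  qed
  have A: "a \<theta> (E \<theta> v + T \<theta> h) (E \<theta> x + T \<theta> z + w) = a \<theta> (T \<theta> h) (T \<theta> z) + a \<theta> (T \<theta> h) w"
    using V_null_left[OF \<theta>\<Theta> E_V[OF \<theta>\<Theta> v]] V_null_right[OF \<theta>\<Theta> E_V[OF \<theta>\<Theta> x]] by (simp add: a.form_simps)
  have B: "b \<theta> (E \<theta> v + T \<theta> h) (E \<theta> x + T \<theta> z + w)
      = b 0 v x + (e3 + b 0 h x) + e4 + (e5 + b 0 v z) + e6 + (e7 + b 0 h z) + e8 + e9 + e10"
    by (simp add: e3_def e4_def e5_def e6_def e7_def e8_def e9_def e10_def b.form_simps E_b[OF \<theta>\<Theta> v x]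
        flip: T_def) (simp add: T_def b.form_simps E_b[OF \<theta>\<Theta> v x])
  \<comment> \<open>Homogeneity of degree 2 turns the frequency \<theta>/\<epsilon> into the factor
    \<open>1 / \<epsilon>\<^sup>2\<close>, matching the scaling of \<open>a \<theta>\<close> in
    \<open>Q\<close>.\<close>
  have SS: "S ((1 / \<epsilon>) *\<^sub>R \<theta>) (v + h) (x + z)
      = complex_of_real (1 / \<epsilon>\<^sup>2) * ah \<theta> h z + (b 0 v x + b 0 h x + b 0 v z + b 0 h z)"
    unfolding S_eq[OF v h x z] ah_scaleR[OF hV zV] by (simp add: b0.form_simps power_divide)
  have "Q \<epsilon> \<theta> (E \<theta> v + T \<theta> h) (E \<theta> x + T \<theta> z + w) - S ((1 / \<epsilon>) *\<^sub>R \<theta>) (v + h) (x + z)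
      = e1 + e2 + e3 + e4 + e5 + e6 + e7 + e8 + e9 + e10"
    unfolding Q_def A B SS e1_def e2_def by (simp add: algebra_simps)
  moreover have "cmod (e1 + e2 + e3 + e4 + e5 + e6 + e7 + e8 + e9 + e10)
      \<le> C6 * M + C3 * M + Kb * M + (K * CN) * M + Kb * M + (K * CN) * M + Lb * M
        + (K\<^sup>2 * CN) * M + (K\<^sup>2 * (CN * (1 + CN))) * M + ((1 + K * (1 + CN)) * K) * M"
    by (rule norm_triangle_mono[OF norm_triangle_mono[OF norm_triangle_mono[OF norm_triangle_mono[OF
      norm_triangle_mono[OF norm_triangle_mono[OF norm_triangle_mono[OF norm_triangle_mono[OF
      norm_triangle_mono[OF b1 b2] b3] b4] b5] b6] b7] b8] b9] b10])
  moreover have "\<dots> = C7 * M" unfolding C7_def by (simp only: distrib_right)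
  ultimately show ?thesis by (simp add: M_def)
qed

section \<open>Comparison of the solutions near 0\<close>

lemma E_near_H: "\<theta> \<in> \<Theta> \<Longrightarrow> u \<in> H \<Longrightarrow> form_norm (d \<theta>) (E \<theta> u - u) \<le> Ke * (norm \<theta> * n0 u)"
proof -
  assume \<theta>: "\<theta> \<in> \<Theta>" and u: "u \<in> H"
  have "Ke * norm \<theta> * form_norm (d 0) u \<le> Ke * norm \<theta> * n0 u"
    using fn_d_le[OF zero_Theta u] Ke by (intro mult_left_mono) auto
  then show ?thesis using E_near[OF \<theta>, of u] by simp
qed

lemma fn_d_n0: "\<theta> \<in> \<Theta> \<Longrightarrow> u \<in> H \<Longrightarrow> form_norm (d \<theta>) u \<le> K * n0 u"
  using fn_d_le nm_le order_trans by blast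

text \<open>Both vectors differ from \<open>z\<close> by O(|\<theta>|): one by the corrector, the
  other by continuity of the transfer at 0.\<close>

lemma T_E_near:
  assumes \<theta>: "norm \<theta> \<le> r0" and z: "z \<in> Z"
  shows "form_norm (d \<theta>) (T \<theta> z - E \<theta> z) \<le> (K * CN + Ke) * (norm \<theta> * n0 z)"
proof -
  have \<theta>\<Theta>: "\<theta> \<in> \<Theta>" using \<theta> by simp
  interpret d: definite_form UNIV "d \<theta>" using \<theta>\<Theta> by (rule d_form)
  have "form_norm (d \<theta>) (T \<theta> z - E \<theta> z) \<le> form_norm (d \<theta>) (N \<theta> z) + form_norm (d \<theta>) (E \<theta> z - z)"
    using d.form_norm_triangle_diff[of "N \<theta> z" "E \<theta> z - z"] by (simp add: T_def algebra_simps)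
  also have "form_norm (d \<theta>) (N \<theta> z) \<le> K * (CN * norm \<theta> * n0 z)"
    using fn_d_n0[OF \<theta>\<Theta> N_H[OF Z_V0[OF z]]] mult_left_mono[OF N_bound[OF Z_V0[OF z], of \<theta>], of K] K
    by (meson order_trans zero_le_one)
  finally show ?thesis using E_near_H[OF \<theta>\<Theta> Z_H[OF z]] by (simp add: algebra_simps)
qed

text \<open>\<open>E \<theta>\<close> is an isometry, so the limit load equals
  \<open>d \<theta> (E \<theta> g) (E \<theta> (x + z))\<close>. The \<open>x\<close>-parts cancel,
  and only \<open>T \<theta> z - E \<theta> z + w\<close> is left.\<close>

lemma load_comparison:
  assumes \<theta>: "norm \<theta> \<le> r0" and \<epsilon>: "0 < \<epsilon>" and x: "x \<in> Vs" and z: "z \<in> Z" and w: "w \<in> H"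
    and bz: "(\<epsilon> + norm \<theta>) * n0 z \<le> B" and bw: "n0 w \<le> B"
  shows "cmod (d \<theta> (E \<theta> g) (E \<theta> x + T \<theta> z + w) - d 0 g (x + z))
    \<le> (K * CN + Ke + K) * (form_norm (d 0) g * B)"
proof -
  have \<theta>\<Theta>: "\<theta> \<in> \<Theta>" using \<theta> by simp
  interpret d: definite_form UNIV "d \<theta>" using \<theta>\<Theta> by (rule d_form)
  define G where "G = form_norm (d 0) g"
  have G: "0 \<le> G" by (simp add: G_def)
  have zB: "norm \<theta> * n0 z \<le> B"
    using bz mult_nonneg_nonneg[OF less_imp_le[OF \<epsilon>] s0.form_norm_nonneg[OF Z_H[OF z]]]
    unfolding distrib_right by linarith
  have eq: "E \<theta> x + T \<theta> z + w = E \<theta> (x + z) + (T \<theta> z - E \<theta> z + w)"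
    by (simp add: E_add[OF \<theta>\<Theta>])
  have "d \<theta> (E \<theta> g) (E \<theta> x + T \<theta> z + w) - d 0 g (x + z) = d \<theta> (E \<theta> g) (T \<theta> z - E \<theta> z + w)"
    unfolding eq using d.add_right[of "E \<theta> g" "E \<theta> (x + z)" "T \<theta> z - E \<theta> z + w"]
    by (simp add: E_d[OF \<theta>\<Theta>])
  also have "cmod (d \<theta> (E \<theta> g) (T \<theta> z - E \<theta> z + w)) \<le> G * form_norm (d \<theta>) (T \<theta> z - E \<theta> z + w)"
    using d.Cauchy_Schwarz[of "E \<theta> g"] by (simp add: G_def fn_d_E[OF \<theta>\<Theta>])
  also have "\<dots> \<le> G * ((K * CN + Ke + K) * B)"
  proof (intro mult_left_mono G)
    have "form_norm (d \<theta>) (T \<theta> z - E \<theta> z + w) \<le> form_norm (d \<theta>) (T \<theta> z - E \<theta> z) + form_norm (d \<theta>) w"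
      by (rule d.form_norm_triangle) auto
    also have "\<dots> \<le> (K * CN + Ke) * (norm \<theta> * n0 z) + K * n0 w"
      by (intro add_mono T_E_near fn_d_n0 \<theta> z \<theta>\<Theta> w)
    also have "\<dots> \<le> (K * CN + Ke) * B + K * B"
      using zB bw K CN Ke by (intro add_mono mult_left_mono) auto
    finally show "form_norm (d \<theta>) (T \<theta> z - E \<theta> z + w) \<le> (K * CN + Ke + K) * B"
      by (simp add: distrib_right)
  qed
  finally show ?thesis by (simp add: G_def mult_ac)
qed

text \<open>The error \<open>e\<close> of the ansatz \<open>J\<close> is its own test vector. Its
  decomposition associates with it the test vector \<open>x + z\<close> of the limit problem, and
  the difference of the two equations is the load error minus the energy error. Both are
  \<open>O(\<epsilon>)\<close> times the energy norm of \<open>e\<close>, one power of which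
  cancels.\<close>

lemma AA_BB_close_near:
  "\<exists>\<rho>>0. \<exists>C\<ge>0. \<forall>\<theta> \<epsilon> g. norm \<theta> \<le> \<rho> \<longrightarrow> 0 < \<epsilon> \<longrightarrow> \<epsilon> < 1 \<longrightarrow>
    form_norm (d \<theta>) (AA \<epsilon> \<theta> (E \<theta> g) - E \<theta> (BB ((1 / \<epsilon>) *\<^sub>R \<theta>) g)) \<le> C * \<epsilon> * form_norm (d 0) g"
proof -
  obtain c1 where c1: "0 \<le> c1" and sol: "\<And>\<xi> g. \<exists>v\<in>Vs. \<exists>z\<in>Z. BB \<xi> g = v + z
      \<and> n0 v \<le> c1 * form_norm (d 0) g \<and> (1 + (norm \<xi>)\<^sup>2) * n0 z \<le> c1 * form_norm (d 0) g"
    using S_solution_bounds by blast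
  obtain \<rho> c2 where \<rho>: "0 < \<rho>" "\<rho> \<le> r0" and c2: "0 \<le> c2"
    and test: "\<And>\<theta> \<epsilon> u. u \<in> H \<Longrightarrow> norm \<theta> \<le> \<rho> \<Longrightarrow> 0 < \<epsilon> \<Longrightarrow> \<epsilon> < 1 \<Longrightarrow>
      \<exists>x\<in>Vs. \<exists>z\<in>Z. \<exists>w\<in>H. u = E \<theta> x + T \<theta> z + w
      \<and> n0 x \<le> c2 * form_norm (Q \<epsilon> \<theta>) u
      \<and> (\<epsilon> + norm \<theta>) * n0 z \<le> c2 * \<epsilon> * form_norm (Q \<epsilon> \<theta>) u
      \<and> n0 w \<le> c2 * \<epsilon> * form_norm (Q \<epsilon> \<theta>) u"
    using test_decomposition by blast
  define c where "c = max c1 c2"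
  have c: "0 \<le> c" "c1 \<le> c" "c2 \<le> c" using c1 by (auto simp: c_def)
  define C8 where "C8 = (K * CN + Ke + K) * c + C7 * (c * c)"
  have C8: "0 \<le> C8" using K CN Ke c C7 by (simp add: C8_def)
  define C where "C = C8 + (K * CN + Ke) * c"
  have "form_norm (d \<theta>) (AA \<epsilon> \<theta> (E \<theta> g) - E \<theta> (BB ((1 / \<epsilon>) *\<^sub>R \<theta>) g)) \<le> C * \<epsilon> * form_norm (d 0) g"
    if \<theta>: "norm \<theta> \<le> \<rho>" and \<epsilon>: "0 < \<epsilon>" "\<epsilon> < 1" for \<theta> \<epsilon> g
  proof -
    have \<theta>r: "norm \<theta> \<le> r0" and \<theta>\<Theta>: "\<theta> \<in> \<Theta>" using \<theta> \<rho> by auto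
    define \<xi> where "\<xi> = (1 / \<epsilon>) *\<^sub>R \<theta>"
    have n\<xi>: "norm \<xi> = norm \<theta> / \<epsilon>" using \<epsilon> by (simp add: \<xi>_def)
    interpret Q: form_solution UNIV "d \<theta>" H "Q \<epsilon> \<theta>" using \<theta>\<Theta> \<epsilon> by (rule solution_Q)
    interpret S: form_solution UNIV "d 0" "V 0" "S \<xi>" by (rule solution_S)
    define G where "G = form_norm (d 0) g"
    have G: "0 \<le> G" by (simp add: G_def)
    obtain v h where vh: "v \<in> Vs" "h \<in> Z" "S.sol g = v + h" "n0 v \<le> c1 * G" "(1 + (norm \<theta> / \<epsilon>)\<^sup>2) * n0 h \<le> c1 * G"
      using sol[of \<xi> g] unfolding n\<xi> G_def by blast
    have cG: "c1 * G \<le> c * G" using c G by (intro mult_right_mono)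
    have bv: "n0 v \<le> c * G" and bh: "(1 + (norm \<theta> / \<epsilon>)\<^sup>2) * n0 h \<le> c * G" using vh cG by linarith+
    define J where "J = E \<theta> v + T \<theta> h"
    have JH: "J \<in> H" using E_H[OF \<theta>\<Theta> vh(1)] T_H[OF Z_V0[OF vh(2)]] by (simp add: J_def)
    define e where "e = Q.sol (E \<theta> g) - J"
    have uH: "Q.sol (E \<theta> g) \<in> H" by (simp add: Q.sol_mem)
    have eH: "e \<in> H" using uH JH by (simp add: e_def)
    define q where "q = form_norm (Q \<epsilon> \<theta>) e"
    have q: "0 \<le> q" using eH by (simp add: q_def)
    obtain x z w where xzw: "x \<in> Vs" "z \<in> Z" "w \<in> H" "e = E \<theta> x + T \<theta> z + w"
      "n0 x \<le> c2 * q" "(\<epsilon> + norm \<theta>) * n0 z \<le> c2 * \<epsilon> * q" "n0 w \<le> c2 * \<epsilon> * q"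
      using test[OF eH \<theta> \<epsilon>] unfolding q_def by blast
    have "c2 * q \<le> c * q" "c2 * \<epsilon> * q \<le> c * \<epsilon> * q" using c q \<epsilon> by (auto intro!: mult_right_mono)
    then have bx: "n0 x \<le> c * q" and bz: "(\<epsilon> + norm \<theta>) * n0 z \<le> c * \<epsilon> * q" and bw: "n0 w \<le> c * \<epsilon> * q"
      using xzw by linarith+
    have 1: "cmod (d \<theta> (E \<theta> g) e - d 0 g (x + z)) \<le> (K * CN + Ke + K) * (G * (c * \<epsilon> * q))"
      unfolding xzw(4) G_def using \<theta>r \<epsilon>(1) xzw(1-3) bz bw by (rule load_comparison)
    have 2: "cmod (Q \<epsilon> \<theta> J e - S \<xi> (v + h) (x + z)) \<le> C7 * (c * G * (c * \<epsilon> * q))"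
      unfolding xzw(4) J_def \<xi>_def
      using \<theta>r \<epsilon> c(1) G q vh(1,2) xzw(1-3) bv bh bx bz bw by (rule energy_comparison)
    \<comment> \<open>The remainder \<open>w\<close> has no counterpart in the limit problem, which
      is tested with \<open>x + z\<close> only.\<close>
    have "S \<xi> (v + h) (x + z) = d 0 g (x + z)"
      using S.sol_eq[of g "x + z"] V0_I[OF xzw(1,2)] vh(3) by simp
    moreover have "Q \<epsilon> \<theta> e e = d \<theta> (E \<theta> g) e - Q \<epsilon> \<theta> J e"
    proof -
      have "Q \<epsilon> \<theta> e e = Q \<epsilon> \<theta> (Q.sol (E \<theta> g)) e - Q \<epsilon> \<theta> J e"
        using Q.dom.diff_left[OF uH JH eH] by (simp only: e_def[symmetric])
      then show ?thesis using Q.sol_eq[of "E \<theta> g" e] eH by simp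
    qed
    ultimately have "Q \<epsilon> \<theta> e e = (d \<theta> (E \<theta> g) e - d 0 g (x + z)) - (Q \<epsilon> \<theta> J e - S \<xi> (v + h) (x + z))"
      by simp
    then have "q\<^sup>2 \<le> cmod (d \<theta> (E \<theta> g) e - d 0 g (x + z)) + cmod (Q \<epsilon> \<theta> J e - S \<xi> (v + h) (x + z))"
      unfolding q_def Q.dom.form_norm_sq[OF eH] qf_def
      by (metis complex_Re_le_cmod norm_triangle_ineq4 order_trans)
    also have "\<dots> \<le> (K * CN + Ke + K) * (G * (c * \<epsilon> * q)) + C7 * (c * G * (c * \<epsilon> * q))"
      using 1 2 by (rule add_mono)
    also have "\<dots> = C8 * \<epsilon> * G * q" by (simp add: C8_def algebra_simps)
    finally have "q * q \<le> C8 * \<epsilon> * G * q" by (simp add: power2_eq_square)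
    then have qb: "q \<le> C8 * \<epsilon> * G"
      using q C8 \<epsilon> G by (cases "q = 0") (auto simp: mult_le_cancel_right)
    \<comment> \<open>The ansatz contains \<open>T \<theta> h\<close> where the claim has
      \<open>E \<theta> h\<close>; the decay of \<open>h\<close> in the frequency makes the exchange
      cost O(\<epsilon>).\<close>
    have "form_norm (d \<theta>) (T \<theta> h - E \<theta> h) \<le> (K * CN + Ke) * (c * \<epsilon> * G)"
    proof -
      have "norm \<theta> / \<epsilon> * n0 h \<le> c * G"
        using bh mult_right_mono[OF le_one_plus_square[of "norm \<theta> / \<epsilon>"] s0.form_norm_nonneg[OF Z_H[OF vh(2)]]]
        by simp
      then have "norm \<theta> * n0 h \<le> c * \<epsilon> * G" using \<epsilon> by (simp add: field_simps)
      then have "(K * CN + Ke) * (norm \<theta> * n0 h) \<le> (K * CN + Ke) * (c * \<epsilon> * G)"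
        using K CN Ke by (intro mult_left_mono) auto
      then show ?thesis using T_E_near[OF \<theta>r vh(2)] by linarith
    qed
    moreover have "form_norm (d \<theta>) e \<le> C8 * \<epsilon> * G"
      using Q.norm_le[OF eH] qb by (simp add: q_def)
    moreover have "Q.sol (E \<theta> g) - E \<theta> (S.sol g) = e + (T \<theta> h - E \<theta> h)"
      by (simp add: e_def J_def vh(3) E_add[OF \<theta>\<Theta>])
    moreover have "form_norm (d \<theta>) (e + (T \<theta> h - E \<theta> h)) \<le> form_norm (d \<theta>) e + form_norm (d \<theta>) (T \<theta> h - E \<theta> h)"
      by (rule Q.amb.form_norm_triangle) auto
    ultimately have "form_norm (d \<theta>) (Q.sol (E \<theta> g) - E \<theta> (S.sol g)) \<le> C8 * \<epsilon> * G + (K * CN + Ke) * (c * \<epsilon> * G)"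
      by simp
    then show ?thesis by (simp add: C_def G_def \<xi>_def algebra_simps)
  qed
  moreover have "0 \<le> C" using C8 K CN Ke c by (simp add: C_def)
  ultimately show ?thesis using \<rho> by blast
qed

section \<open>Estimates for all parameters and frequencies\<close>

lemma E_diff: "\<theta> \<in> \<Theta> \<Longrightarrow> E \<theta> (u - v) = E \<theta> u - E \<theta> v"
  using E_add[of \<theta> "u - v" v] by simp

text \<open>For |\<theta>| > \<rho> the frequency exceeds \<rho>/\<epsilon>, so the decay rate of
  \<open>BB \<xi> - BS\<close> becomes O(\<epsilon>) and combines with
  \<open>AA_BS_close\<close>.\<close>

lemma operator_estimate:
  "\<exists>C\<ge>0. \<forall>\<theta>\<in>\<Theta>. \<forall>\<epsilon> g. 0 < \<epsilon> \<longrightarrow> \<epsilon> < 1 \<longrightarrow>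
    form_norm (d \<theta>) (AA \<epsilon> \<theta> (E \<theta> g) - E \<theta> (BB ((1 / \<epsilon>) *\<^sub>R \<theta>) g)) \<le> C * \<epsilon> * form_norm (d 0) g"
proof -
  obtain \<rho> C1 where \<rho>: "0 < \<rho>" and C1: "0 \<le> C1"
    and near0: "\<And>\<theta> \<epsilon> g. norm \<theta> \<le> \<rho> \<Longrightarrow> 0 < \<epsilon> \<Longrightarrow> \<epsilon> < 1 \<Longrightarrow>
      form_norm (d \<theta>) (AA \<epsilon> \<theta> (E \<theta> g) - E \<theta> (BB ((1 / \<epsilon>) *\<^sub>R \<theta>) g)) \<le> C1 * \<epsilon> * form_norm (d 0) g"
    using AA_BB_close_near by blast
  obtain C2 where C2: "0 \<le> C2"
    and far: "\<And>\<theta> \<epsilon> g. \<theta> \<in> \<Theta> \<Longrightarrow> \<rho> \<le> norm \<theta> \<Longrightarrow> 0 < \<epsilon> \<Longrightarrow> \<epsilon> < 1 \<Longrightarrow>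
      form_norm (d \<theta>) (AA \<epsilon> \<theta> (E \<theta> g) - E \<theta> (BS g)) \<le> C2 * \<epsilon> * form_norm (d 0) g"
    using AA_BS_close[OF \<rho>] by blast
  obtain C3' where C3': "0 \<le> C3'"
    and BS: "\<And>\<xi> g. norm \<xi> * form_norm (d 0) (BB \<xi> g - BS g) \<le> C3' * form_norm (d 0) g"
    using BB_BS_close by blast
  define C where "C = C1 + (C2 + C3' / \<rho>)"
  have CC: "C1 \<le> C" "C2 + C3' / \<rho> \<le> C" using C1 C2 C3' \<rho> by (auto simp: C_def)
  have "form_norm (d \<theta>) (AA \<epsilon> \<theta> (E \<theta> g) - E \<theta> (BB ((1 / \<epsilon>) *\<^sub>R \<theta>) g)) \<le> C * \<epsilon> * form_norm (d 0) g"
    if \<theta>: "\<theta> \<in> \<Theta>" and \<epsilon>: "0 < \<epsilon>" "\<epsilon> < 1" for \<theta> \<epsilon> g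
  proof -
    define G where "G = form_norm (d 0) g"
    have G: "0 \<le> G" by (simp add: G_def)
    define \<xi> where "\<xi> = (1 / \<epsilon>) *\<^sub>R \<theta>"
    interpret dt: definite_form UNIV "d \<theta>" using \<theta> by (rule d_form)
    have mono: "x * \<epsilon> * G \<le> C * \<epsilon> * G" if "x \<le> C" for x
      using that \<epsilon> G by (intro mult_right_mono) auto
    show ?thesis
    proof (cases "norm \<theta> \<le> \<rho>")
      case True
      then show ?thesis using near0[OF True \<epsilon>, of g] mono[OF CC(1)] by (simp add: G_def)
    next
      case False
      have "form_norm (d 0) (BS g - BB \<xi> g) \<le> C3' / \<rho> * \<epsilon> * G"
      proof -
        let ?x = "form_norm (d 0) (BB \<xi> g - BS g)"
        have "\<rho> * ?x \<le> norm \<theta> * ?x" using False by (intro mult_right_mono) auto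
        also have "\<dots> = \<epsilon> * (norm \<xi> * ?x)" using \<epsilon> by (simp add: \<xi>_def)
        also have "\<dots> \<le> \<epsilon> * (C3' * G)" using BS[of \<xi> g] \<epsilon> by (simp add: G_def)
        finally have "?x \<le> C3' / \<rho> * \<epsilon> * G" using \<rho> by (simp add: field_simps)
        then show ?thesis using d0.form_norm_commute[of "BB \<xi> g" "BS g"] by simp
      qed
      then have "form_norm (d \<theta>) (E \<theta> (BS g) - E \<theta> (BB \<xi> g)) \<le> C3' / \<rho> * \<epsilon> * G"
        using fn_d_E[OF \<theta>, of "BS g - BB \<xi> g"] by (simp add: E_diff[OF \<theta>])
      moreover have "form_norm (d \<theta>) (AA \<epsilon> \<theta> (E \<theta> g) - E \<theta> (BS g)) \<le> C2 * \<epsilon> * G"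
        unfolding G_def using \<theta> False \<epsilon> by (intro far) auto
      ultimately have "form_norm (d \<theta>) (AA \<epsilon> \<theta> (E \<theta> g) - E \<theta> (BB \<xi> g)) \<le> (C2 + C3' / \<rho>) * \<epsilon> * G"
        using dt.form_norm_triangle_dist[of "AA \<epsilon> \<theta> (E \<theta> g)" "E \<theta> (BS g)" "E \<theta> (BB \<xi> g)"]
        by (simp add: distrib_right)
      then show ?thesis using mono[OF CC(2)] by (simp add: \<xi>_def G_def)
    qed
  qed
  moreover have "0 \<le> C" using C1 CC by linarith
  ultimately show ?thesis by blast
qed

text \<open>For \<open>\<xi>\<close> outside \<open>\<epsilon>\<inverse> \<Theta>\<close> the operator at \<open>\<xi>\<close> is compared with the one at a point of
  \<open>\<epsilon>\<inverse> \<Theta>\<close> of norm \<open>r0 / \<epsilon>\<close>: both are \<open>O(\<epsilon>)\<close>-close to the operator on \<open>Vs\<close>.\<close>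

lemma operator_estimate_all_xi:
  "\<exists>C\<ge>0. \<forall>\<xi>. \<forall>\<epsilon>. 0 < \<epsilon> \<longrightarrow> \<epsilon> < 1 \<longrightarrow> (\<exists>\<theta>\<in>\<Theta>. \<forall>g.
    form_norm (d \<theta>) (AA \<epsilon> \<theta> (E \<theta> g) - E \<theta> (BB \<xi> g)) \<le> C * \<epsilon> * form_norm (d 0) g)"
proof -
  obtain C1 where C1: "0 \<le> C1"
    and near0: "\<And>\<theta> \<epsilon> g. \<theta> \<in> \<Theta> \<Longrightarrow> 0 < \<epsilon> \<Longrightarrow> \<epsilon> < 1 \<Longrightarrow>
      form_norm (d \<theta>) (AA \<epsilon> \<theta> (E \<theta> g) - E \<theta> (BB ((1 / \<epsilon>) *\<^sub>R \<theta>) g)) \<le> C1 * \<epsilon> * form_norm (d 0) g"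
    using operator_estimate by blast
  obtain C3' where C3': "0 \<le> C3'"
    and BS: "\<And>\<xi> g. norm \<xi> * form_norm (d 0) (BB \<xi> g - BS g) \<le> C3' * form_norm (d 0) g"
    using BB_BS_close by blast
  \<comment> \<open>In the far case \<open>BS\<close> is approached twice, from \<xi> and from the
    substitute \<eta>, each at cost \<open>C3' / r0\<close>.\<close>
  define C where "C = C1 + 2 * (C3' / r0)"
  have CC: "C1 \<le> C" using C3' r0 by (simp add: C_def)
  have "\<exists>\<theta>\<in>\<Theta>. \<forall>g. form_norm (d \<theta>) (AA \<epsilon> \<theta> (E \<theta> g) - E \<theta> (BB \<xi> g)) \<le> C * \<epsilon> * form_norm (d 0) g"
    if \<epsilon>: "0 < \<epsilon>" "\<epsilon> < 1" for \<xi> \<epsilon>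
  proof (cases "norm (\<epsilon> *\<^sub>R \<xi>) \<le> r0")
    case True
    have eq: "(1 / \<epsilon>) *\<^sub>R (\<epsilon> *\<^sub>R \<xi>) = \<xi>" using \<epsilon> by simp
    have "form_norm (d (\<epsilon> *\<^sub>R \<xi>)) (AA \<epsilon> (\<epsilon> *\<^sub>R \<xi>) (E (\<epsilon> *\<^sub>R \<xi>) g) - E (\<epsilon> *\<^sub>R \<xi>) (BB \<xi> g))
        \<le> C * \<epsilon> * form_norm (d 0) g" for g
    proof -
      have "C1 * \<epsilon> * form_norm (d 0) g \<le> C * \<epsilon> * form_norm (d 0) g"
        using CC \<epsilon> by (intro mult_right_mono) auto
      then show ?thesis using near0[OF ball[OF True] \<epsilon>, of g] unfolding eq by linarith
    qed
    then show ?thesis using ball[OF True] by blast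
  next
    case False
    obtain \<theta> :: "real ^ 'n" where n\<theta>: "norm \<theta> = r0" using vector_choose_size r0 less_imp_le by blast
    have \<theta>: "\<theta> \<in> \<Theta>" using n\<theta> by (intro ball) simp
    interpret dt: definite_form UNIV "d \<theta>" using \<theta> by (rule d_form)
    define \<eta> where "\<eta> = (1 / \<epsilon>) *\<^sub>R \<theta>"
    have large: "r0 \<le> \<epsilon> * norm \<eta>" "r0 \<le> \<epsilon> * norm \<xi>" using False \<epsilon> n\<theta> by (simp_all add: \<eta>_def)
    have "form_norm (d \<theta>) (AA \<epsilon> \<theta> (E \<theta> g) - E \<theta> (BB \<xi> g)) \<le> C * \<epsilon> * form_norm (d 0) g" for g
    proof -
      define G where "G = form_norm (d 0) g"
      have BSx: "form_norm (d 0) (BB x g - BS g) \<le> C3' / r0 * \<epsilon> * G" if "r0 \<le> \<epsilon> * norm x" for x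
      proof -
        let ?x = "form_norm (d 0) (BB x g - BS g)"
        have "r0 * ?x \<le> \<epsilon> * norm x * ?x" using that by (intro mult_right_mono) auto
        also have "\<dots> = \<epsilon> * (norm x * ?x)" by simp
        also have "\<dots> \<le> \<epsilon> * (C3' * G)" using BS[of x g] \<epsilon> by (simp add: G_def)
        finally show ?thesis using r0 by (simp add: field_simps)
      qed
      have "form_norm (d 0) (BB \<eta> g - BB \<xi> g) \<le> C3' / r0 * \<epsilon> * G + C3' / r0 * \<epsilon> * G"
        using d0.form_norm_triangle_dist[of "BB \<eta> g" "BS g" "BB \<xi> g", OF UNIV_I UNIV_I UNIV_I]
          BSx[OF large(1)] BSx[OF large(2)] d0.form_norm_commute[OF UNIV_I UNIV_I, of "BB \<xi> g" "BS g"]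
        by linarith
      then have "form_norm (d \<theta>) (E \<theta> (BB \<eta> g) - E \<theta> (BB \<xi> g)) \<le> C3' / r0 * \<epsilon> * G + C3' / r0 * \<epsilon> * G"
        using fn_d_E[OF \<theta>, of "BB \<eta> g - BB \<xi> g"] by (simp add: E_diff[OF \<theta>])
      moreover have "form_norm (d \<theta>) (AA \<epsilon> \<theta> (E \<theta> g) - E \<theta> (BB \<eta> g)) \<le> C1 * \<epsilon> * G"
        unfolding G_def \<eta>_def using \<theta> \<epsilon> by (rule near0)
      ultimately show ?thesis
        using dt.form_norm_triangle_dist[of "AA \<epsilon> \<theta> (E \<theta> g)" "E \<theta> (BB \<eta> g)" "E \<theta> (BB \<xi> g)"]
        by (simp add: C_def G_def distrib_right)
    qed
    then show ?thesis using \<theta> by blast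
  qed
  moreover have "0 \<le> C" using C1 CC by linarith
  ultimately show ?thesis by blast
qed

text \<open>The transfer runs between \<open>BB \<xi>\<close> and
  \<open>AA \<epsilon> \<theta>\<close>, both on the ambient space because \<open>E \<theta>\<close>
  is a bijection there, with slack \<delta> = \<epsilon>. Approximate eigenvalues found for
  \<open>BB \<xi>\<close> return to \<open>X0\<close> if they are not 0, and 0 belongs to the set
  anyway; the opposite passage is plain inclusion of \<open>X0\<close>.\<close>

lemma spectra_close:
  assumes X0: "hilbert_form X0 (d 0)" "V 0 \<subseteq> X0" and complete: "\<And>\<theta>. \<theta> \<in> \<Theta> \<Longrightarrow> hilbert_form UNIV (d \<theta>)"
  shows "\<exists>C>0. \<forall>\<epsilon>. 0 < \<epsilon> \<and> \<epsilon> < 1 \<longrightarrow>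
    hausdorff_distance
      ((\<Union>\<theta>\<in>\<Theta>. spectrum UNIV (d \<theta>) ((form_operator UNIV (d \<theta>) H (Q \<epsilon> \<theta>))\<inverse>)) \<union> {0})
      ((\<Union>\<xi>. spectrum X0 (d 0) ((form_operator X0 (d 0) (V 0) (S \<xi>))\<inverse>)) \<union> {0})
    \<le> ereal (C * \<epsilon>)"
proof -
  obtain C1 where C1: "0 \<le> C1"
    and est1: "\<And>\<theta> \<epsilon> g. \<theta> \<in> \<Theta> \<Longrightarrow> 0 < \<epsilon> \<Longrightarrow> \<epsilon> < 1 \<Longrightarrow>
      form_norm (d \<theta>) (AA \<epsilon> \<theta> (E \<theta> g) - E \<theta> (BB ((1 / \<epsilon>) *\<^sub>R \<theta>) g)) \<le> C1 * \<epsilon> * form_norm (d 0) g"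
    using operator_estimate by blast
  obtain C2' where C2': "0 \<le> C2'"
    and est2: "\<And>\<xi> \<epsilon>. 0 < \<epsilon> \<Longrightarrow> \<epsilon> < 1 \<Longrightarrow> \<exists>\<theta>\<in>\<Theta>. \<forall>g.
      form_norm (d \<theta>) (AA \<epsilon> \<theta> (E \<theta> g) - E \<theta> (BB \<xi> g)) \<le> C2' * \<epsilon> * form_norm (d 0) g"
    using operator_estimate_all_xi by blast
  define C where "C = C1 + C2' + 1"
  have C: "0 < C" "C1 + 1 \<le> C" "C2' + 1 \<le> C" using C1 C2' by (auto simp: C_def)
  have sol0: "form_solution X0 (d 0) (V 0) (S \<xi>)" for \<xi>
  proof -
    interpret X: hilbert_form X0 "d 0" by (rule X0(1))
    interpret S: form_solution UNIV "d 0" "V 0" "S \<xi>" by (rule solution_S)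
    show ?thesis by unfold_locales (use X0(2) S.norm_le in auto)
  qed
  have "hausdorff_distance
      ((\<Union>\<theta>\<in>\<Theta>. spectrum UNIV (d \<theta>) ((form_operator UNIV (d \<theta>) H (Q \<epsilon> \<theta>))\<inverse>)) \<union> {0})
      ((\<Union>\<xi>. spectrum X0 (d 0) ((form_operator X0 (d 0) (V 0) (S \<xi>))\<inverse>)) \<union> {0})
    \<le> ereal (C * \<epsilon>)" (is "hausdorff_distance (?A \<union> {0}) (?B \<union> {0}) \<le> _") if \<epsilon>: "0 < \<epsilon>" "\<epsilon> < 1" for \<epsilon>
  proof (rule hausdorff_distance_le)
    fix c assume "c \<in> ?A \<union> {0}"
    then consider "c = 0" | \<theta> where "\<theta> \<in> \<Theta>" "c \<in> spectrum UNIV (d \<theta>) ((form_operator UNIV (d \<theta>) H (Q \<epsilon> \<theta>))\<inverse>)"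
      by blast
    then show "\<exists>c'\<in>?B \<union> {0}. dist c c' \<le> C * \<epsilon>"
    proof cases
      case 1
      then show ?thesis using C \<epsilon> by (intro bexI[of _ 0]) auto
    next
      case (2 \<theta>)
      define \<xi> where "\<xi> = (1 / \<epsilon>) *\<^sub>R \<theta>"
      interpret Q: form_solution UNIV "d \<theta>" H "Q \<epsilon> \<theta>" using 2(1) \<epsilon> by (rule solution_Q)
      interpret S: form_solution UNIV "d 0" "V 0" "S \<xi>" by (rule solution_S)
      interpret S0: form_solution X0 "d 0" "V 0" "S \<xi>" by (rule sol0)
      have "approx_eigenvalue UNIV (d \<theta>) Q.sol c"
        using 2(2) unfolding Q.inverse_form_operator by (rule Q.spectrum_approx_eigenvalue[OF complete[OF 2(1)]])
      then obtain c' where c': "approx_eigenvalue UNIV (d 0) S.sol c'" "dist c c' \<le> C1 * \<epsilon> + \<epsilon>"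
        using approx_eigenvalue_transfer_back[OF S.selfadjoint_operator_axioms Q.selfadjoint_operator_axioms
            E_bij[OF 2(1)] E_d[OF 2(1)] est1[OF 2(1) \<epsilon>, folded \<xi>_def] _ \<epsilon>(1)] by blast
      have "c' \<in> ?B \<union> {0}"
      proof (cases "c' = 0")
        case False
        then have "approx_eigenvalue X0 (d 0) S.sol c'"
          using X0(2) by (rule S.approx_eigenvalue_restrict[OF c'(1)])
        then have "c' \<in> spectrum X0 (d 0) {(g, S0.sol g) |g. g \<in> X0}"
          by (rule S0.approx_eigenvalue_in_spectrum)
        then show ?thesis unfolding S0.inverse_form_operator[symmetric] by blast
      qed simp
      moreover have "C1 * \<epsilon> + \<epsilon> \<le> C * \<epsilon>"
        using mult_right_mono[OF C(2), of \<epsilon>] \<epsilon> by (simp add: distrib_right)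
      ultimately show ?thesis using c'(2) by (meson order_trans)
    qed
  next
    fix c assume "c \<in> ?B \<union> {0}"
    then consider "c = 0" | \<xi> where "c \<in> spectrum X0 (d 0) ((form_operator X0 (d 0) (V 0) (S \<xi>))\<inverse>)"
      by blast
    then show "\<exists>c'\<in>?A \<union> {0}. dist c c' \<le> C * \<epsilon>"
    proof cases
      case 1
      then show ?thesis using C \<epsilon> by (intro bexI[of _ 0]) auto
    next
      case (2 \<xi>)
      obtain \<theta> where \<theta>: "\<theta> \<in> \<Theta>"
        and est: "\<And>g. form_norm (d \<theta>) (AA \<epsilon> \<theta> (E \<theta> g) - E \<theta> (BB \<xi> g)) \<le> C2' * \<epsilon> * form_norm (d 0) g"
        using est2[OF \<epsilon>] by blast
      interpret Q: form_solution UNIV "d \<theta>" H "Q \<epsilon> \<theta>" using \<theta> \<epsilon> by (rule solution_Q)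
      interpret S: form_solution UNIV "d 0" "V 0" "S \<xi>" by (rule solution_S)
      interpret S0: form_solution X0 "d 0" "V 0" "S \<xi>" by (rule sol0)
      have "approx_eigenvalue X0 (d 0) S.sol c"
        using 2 unfolding S0.inverse_form_operator by (rule S0.spectrum_approx_eigenvalue[OF X0(1)])
      then have "approx_eigenvalue UNIV (d 0) S.sol c" by (rule approx_eigenvalue_mono) simp
      then obtain c' where c': "approx_eigenvalue UNIV (d \<theta>) Q.sol c'" "dist c c' \<le> C2' * \<epsilon> + \<epsilon>"
        using approx_eigenvalue_transfer[OF S.selfadjoint_operator_axioms Q.selfadjoint_operator_axioms
            bij_is_surj[OF E_bij[OF \<theta>]] E_d[OF \<theta>] est _ \<epsilon>(1)] by blast
      then have "c' \<in> spectrum UNIV (d \<theta>) {(g, Q.sol g) |g. g \<in> UNIV}"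
        by (intro Q.approx_eigenvalue_in_spectrum)
      then have "c' \<in> ?A \<union> {0}" unfolding Q.inverse_form_operator[symmetric] using \<theta> by blast
      moreover have "C2' * \<epsilon> + \<epsilon> \<le> C * \<epsilon>"
        using mult_right_mono[OF C(3), of \<epsilon>] \<epsilon> by (simp add: distrib_right)
      ultimately show ?thesis using c'(2) by (meson order_trans)
    qed
  qed
  then show ?thesis using C(1) by blast
qed

end

section \<open>Comparison of the spectra\<close>

theorem theorem6p5:
  fixes ipH ip :: "'a::complex_vector \<Rightarrow> 'a \<Rightarrow> complex"
    and H :: "'a set"
    and \<Theta> :: "(real ^ 'n) set"
    and a b d :: "real ^ 'n \<Rightarrow> 'a \<Rightarrow> 'a \<Rightarrow> complex"
    and Vs Z :: "'a set"
    and a' :: "'a \<Rightarrow> 'a \<Rightarrow> complex ^ 'n"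
    and a'' :: "'a \<Rightarrow> 'a \<Rightarrow> complex ^ 'n ^ 'n"
    and E :: "real ^ 'n \<Rightarrow> 'a \<Rightarrow> 'a"
  assumes "ambient_form_family ipH H \<Theta> a b ip d"
    and "spectral_gap H \<Theta> a b"
    and "removable_singularity ipH H \<Theta> a b Vs"
    and "defect_complement ipH H a b Vs Z"
    and "quadratic_degeneracy H \<Theta> a b"
    and "a_regularity H \<Theta> a b a' a''"
    and "b_regularity H \<Theta> a b"
    and "unitary_transfer H \<Theta> a b d Vs Z E"
  shows "\<exists>C\<^sub>1\<^sub>2>0. \<forall>\<epsilon>. 0 < \<epsilon> \<and> \<epsilon> < 1 \<longrightarrow>
    hausdorff_distance
      ((\<Union>\<theta>\<in>\<Theta>. spectrum UNIV (d \<theta>) ((L_op H a b d \<epsilon> \<theta>)\<inverse>)) \<union> {0})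
      ((\<Union>\<xi>. spectrum (H0_space ip Vs Z) (d 0) ((LL_op ip H a b d a' a'' Vs Z \<xi>)\<inverse>)) \<union> {0})
    \<le> ereal (C\<^sub>1\<^sub>2 * \<epsilon>)"
proof -
  interpret A: ambient_form_family ipH H \<Theta> a b ip d by (rule assms(1))
  have hilbertH: "hilbert_form H ipH"
    using A.H_hilbert unfolding separable_hilbert_on_def by (blast intro: hilbert_formI)
  interpret ipH: hilbert_form H ipH by (rule hilbertH)
  have hilbertU: "hilbert_form UNIV ip"
    using A.ambient_hilbert unfolding separable_hilbert_on_def by (blast intro: hilbert_formI)
  interpret ip: hilbert_form UNIV ip by (rule hilbertU)
  have hilbert: "hilbert_form H (sum_form a b \<theta>)" if "\<theta> \<in> \<Theta>" for \<theta>
    using hilbertH A.sum_equivalent[OF that] ipH.subspace closedin_form_topology_self[OF ipH.definite_form_axioms]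
    by (rule hilbert_form_equivalent)
  have hilbert_d: "hilbert_form UNIV (d \<theta>)" if "\<theta> \<in> \<Theta>" for \<theta>
    using hilbertU A.d_equivalent[OF that] ip.subspace closedin_form_topology_self[OF ip.definite_form_axioms]
    by (rule hilbert_form_equivalent)
  have d_form: "definite_form UNIV (d \<theta>)" if "\<theta> \<in> \<Theta>" for \<theta>
    using hilbert_d[OF that] by (simp add: hilbert_form_def)
  have a_form: "nonneg_form H (a \<theta>)" if "\<theta> \<in> \<Theta>" for \<theta>
    using A.a_nonneg[OF that] ipH.subspace by (simp add: nonneg_form_def)
  have b_form: "nonneg_form H (b \<theta>)" if "\<theta> \<in> \<Theta>" for \<theta>
    using A.b_nonneg[OF that] ipH.subspace by (simp add: nonneg_form_def)
  obtain e where e: "e > 0" "cball 0 e \<subseteq> \<Theta>" using A.Theta(3) unfolding mem_interior_cball by blast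
  \<comment> \<open>The cap 1 allows higher powers of \<open>norm \<theta>\<close> to be bounded by
    lower ones.\<close>
  define r0 where "r0 = min e 1"
  have r0: "0 < r0" "r0 \<le> 1" using e by (auto simp: r0_def)
  have ball: "\<theta> \<in> \<Theta>" if "norm \<theta> \<le> r0" for \<theta>
    using e(2) that by (auto simp: r0_def subset_iff)
  have \<Theta>0: "0 \<in> \<Theta>" using r0 by (intro ball) simp
  interpret s0: hilbert_form H "sum_form a b 0" using \<Theta>0 by (rule hilbert)
  have nn: "0 \<le> form_norm (sum_form a b \<theta>) u" if "\<theta> \<in> \<Theta>" "u \<in> H" for \<theta> u
    using hilbert[OF that(1)] that(2) unfolding hilbert_form_def definite_form_def
    by (blast intro: nonneg_form.form_norm_nonneg)
  obtain K0 where K0: "\<forall>u\<in>H. \<forall>\<theta>\<^sub>1\<in>\<Theta>. \<forall>\<theta>\<^sub>2\<in>\<Theta>.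
      form_norm (sum_form a b \<theta>\<^sub>1) u \<le> K0 * form_norm (sum_form a b \<theta>\<^sub>2) u"
    using A.norms_comparable by blast
  define K where "K = max K0 1"
  have K: "1 \<le> K" by (simp add: K_def)
  have comparable: "form_norm (sum_form a b \<theta>\<^sub>1) u \<le> K * form_norm (sum_form a b \<theta>\<^sub>2) u"
    if "u \<in> H" "\<theta>\<^sub>1 \<in> \<Theta>" "\<theta>\<^sub>2 \<in> \<Theta>" for u \<theta>\<^sub>1 \<theta>\<^sub>2
  proof -
    have "K0 * form_norm (sum_form a b \<theta>\<^sub>2) u \<le> K * form_norm (sum_form a b \<theta>\<^sub>2) u"
      using nn that by (intro mult_right_mono) (auto simp: K_def)
    moreover have "form_norm (sum_form a b \<theta>\<^sub>1) u \<le> K0 * form_norm (sum_form a b \<theta>\<^sub>2) u"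
      using K0 that by blast
    ultimately show ?thesis by linarith
  qed
  obtain La where "0 < La" and La_all: "\<forall>u\<in>H. \<forall>v\<in>H. \<forall>\<theta>\<^sub>1\<in>\<Theta>. \<forall>\<theta>\<^sub>2\<in>\<Theta>.
      cmod (a \<theta>\<^sub>1 u v - a \<theta>\<^sub>2 u v) \<le> La * norm (\<theta>\<^sub>1 - \<theta>\<^sub>2)
        * form_norm (sum_form a b \<theta>\<^sub>1) u * form_norm (sum_form a b \<theta>\<^sub>1) v"
    using A.a_lipschitz by blast
  have La: "0 \<le> La" using \<open>0 < La\<close> by simp
  have lipschitz: "cmod (a \<theta> u v - a 0 u v) \<le>
      La * norm \<theta> * form_norm (sum_form a b 0) u * form_norm (sum_form a b 0) v"
    if "u \<in> H" "v \<in> H" "\<theta> \<in> \<Theta>" for u v \<theta>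
  proof -
    \<comment> \<open>Taking 0 as the first parameter yields norms at 0 on the right.\<close>
    have "cmod (a 0 u v - a \<theta> u v) \<le> La * norm (0 - \<theta>)
        * form_norm (sum_form a b 0) u * form_norm (sum_form a b 0) v"
      using La_all that \<Theta>0 by blast
    then show ?thesis by (simp add: norm_minus_commute)
  qed
  have d_le_b: "form_norm (d \<theta>) u \<le> form_norm (b \<theta>) u" if "\<theta> \<in> \<Theta>" "u \<in> H" for \<theta> u
    unfolding form_norm_def using A.d_le_b[OF that] by (rule real_sqrt_le_mono)
  obtain \<nu> where \<nu>: "0 < \<nu>" and gap_all: "\<forall>w\<in>W_space H a b 0.
      \<nu> * (form_norm (sum_form a b 0) w)\<^sup>2 \<le> qf (a 0) w"
    using assms(2) \<Theta>0 unfolding spectral_gap_def by blast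
  have gap: "\<nu> * (form_norm (sum_form a b 0) w)\<^sup>2 \<le> qf (a 0) w" if "w \<in> W_space H a b 0" for w
    using gap_all that by blast
  obtain L where L: "0 \<le> L" and L_all: "\<forall>\<theta>\<^sub>1\<in>\<Theta>. \<forall>\<theta>\<^sub>2\<in>\<Theta>. \<forall>v\<^sub>1\<in>Vstar_space H a Vs \<theta>\<^sub>1.
        (INF v\<^sub>2\<in>Vstar_space H a Vs \<theta>\<^sub>2. form_norm (sum_form a b \<theta>\<^sub>2) (v\<^sub>1 - v\<^sub>2))
          \<le> L * norm (\<theta>\<^sub>1 - \<theta>\<^sub>2) * form_norm (sum_form a b \<theta>\<^sub>1) v\<^sub>1"
    using assms(3) unfolding removable_singularity_def by blast
  have Vs: "closed_subspace_on H ipH Vs" using assms(3) unfolding removable_singularity_def by blast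
  then have Vs_subspace: "complex_vector.subspace Vs" and Vs_cl: "closedin (form_topology H ipH) Vs"
    by (auto simp: closed_subspace_on_def)
  obtain c0 where c0: "c0 > 0" "\<forall>u\<in>H. c0 * form_norm ipH u \<le> form_norm (sum_form a b 0) u"
    using A.sum_equivalent[OF \<Theta>0] unfolding equivalent_inner_product_on_def by blast
  have VsH: "Vs \<subseteq> H"
  proof -
    interpret M: Metric_space H "form_dist H ipH" by (rule ipH.metric)
    show ?thesis using closedin_subset[OF Vs_cl] by (simp add: form_topology_def)
  qed
  have Vs_closed: "l \<in> Vs" if x: "range x \<subseteq> Vs" and l: "l \<in> H"
      and lim: "(\<lambda>n::nat. form_norm (sum_form a b 0) (x n - l)) \<longlonglongrightarrow> 0" for x l
  proof (rule ipH.closedin_sequentially[OF Vs_cl x l])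
    show "(\<lambda>n. form_norm ipH (x n - l)) \<longlonglongrightarrow> 0"
    proof (rule Lim_null_comparison)
      have "x n - l \<in> H" for n using x VsH l by (intro ipH.diff_mem) auto
      then show "\<forall>\<^sub>F n in sequentially. norm (form_norm ipH (x n - l))
          \<le> 1 / c0 * form_norm (sum_form a b 0) (x n - l)"
        using c0 by (intro always_eventually allI) (simp add: field_simps)
      show "(\<lambda>n. 1 / c0 * form_norm (sum_form a b 0) (x n - l)) \<longlonglongrightarrow> 0"
        using tendsto_mult_left[OF lim, of "1 / c0"] by simp
    qed
  qed
  have Vst: "0 \<in> Vstar_space H a Vs \<theta>" "Vstar_space H a Vs \<theta> \<subseteq> H" if "\<theta> \<in> \<Theta>" for \<theta>
  proof -
    interpret a: nonneg_form H "a \<theta>" using that by (rule a_form)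
    show "0 \<in> Vstar_space H a Vs \<theta>" "Vstar_space H a Vs \<theta> \<subseteq> H"
      using complex_vector.subspace_0[OF Vs_subspace] VsH by (auto simp: Vstar_space_def V_space_def)
  qed
  define Ls where "Ls = L + 1"
  have Ls: "0 \<le> Ls" using L by (simp add: Ls_def)
  have near: "\<exists>v'\<in>Vstar_space H a Vs \<theta>\<^sub>2. form_norm (sum_form a b \<theta>\<^sub>2) (v - v')
        \<le> Ls * norm (\<theta>\<^sub>1 - \<theta>\<^sub>2) * form_norm (sum_form a b \<theta>\<^sub>1) v"
    if \<theta>: "\<theta>\<^sub>1 \<in> \<Theta>" "\<theta>\<^sub>2 \<in> \<Theta>" and v: "v \<in> Vstar_space H a Vs \<theta>\<^sub>1" for \<theta>\<^sub>1 \<theta>\<^sub>2 v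
  proof -
    interpret s1: hilbert_form H "sum_form a b \<theta>\<^sub>1" using \<theta>(1) by (rule hilbert)
    interpret s2: hilbert_form H "sum_form a b \<theta>\<^sub>2" using \<theta>(2) by (rule hilbert)
    have vH: "v \<in> H" using Vst \<theta> v by blast
    show ?thesis
    \<comment> \<open>If the right-hand side vanishes, \<open>v\<close> itself or 0 attains the
      bound exactly. Otherwise enlarging \<open>L\<close> by 1 makes the inequality for the infimum
      strict, so some vector realises it.\<close>
    proof (cases "\<theta>\<^sub>1 = \<theta>\<^sub>2 \<or> v = 0")
      case True
      then show ?thesis
      proof
        assume "\<theta>\<^sub>1 = \<theta>\<^sub>2"
        then show ?thesis using v by (intro bexI[of _ v]) auto
      next
        assume "v = 0"
        then show ?thesis using Vst(1)[OF \<theta>(2)] by (intro bexI[of _ 0]) auto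
      qed
    next
      case False
      let ?R = "norm (\<theta>\<^sub>1 - \<theta>\<^sub>2) * form_norm (sum_form a b \<theta>\<^sub>1) v"
      have "0 < ?R" using False s1.form_norm_pos[OF vH] by simp
      then have "L * ?R < Ls * ?R" by (simp add: Ls_def distrib_right)
      moreover have "(INF v\<^sub>2\<in>Vstar_space H a Vs \<theta>\<^sub>2. form_norm (sum_form a b \<theta>\<^sub>2) (v - v\<^sub>2)) \<le> L * ?R"
        using L_all \<theta> v by (simp add: mult.assoc)
      ultimately have less: "(INF v\<^sub>2\<in>Vstar_space H a Vs \<theta>\<^sub>2. form_norm (sum_form a b \<theta>\<^sub>2) (v - v\<^sub>2)) < Ls * ?R"
        by linarith
      have "(\<lambda>v\<^sub>2. form_norm (sum_form a b \<theta>\<^sub>2) (v - v\<^sub>2)) ` Vstar_space H a Vs \<theta>\<^sub>2 \<noteq> {}"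
        using Vst(1)[OF \<theta>(2)] by blast
      from cInf_lessD[OF this less] obtain v' where
        "v' \<in> Vstar_space H a Vs \<theta>\<^sub>2" "form_norm (sum_form a b \<theta>\<^sub>2) (v - v') < Ls * ?R" by blast
      then show ?thesis by (intro bexI[of _ v']) (simp_all add: mult.assoc)
    qed
  qed
  note dc = assms(4)[unfolded defect_complement_def closed_subspace_on_def]
  have Z_subspace: "complex_vector.subspace Z" by (rule conjunct1[OF conjunct1[OF dc]])
  have V0_eq: "V_space H a 0 = sum_space Vs Z" by (rule conjunct1[OF conjunct2[OF dc]])
  have Vs_Z: "Vs \<inter> Z = {0}" by (rule conjunct1[OF conjunct2[OF conjunct2[OF dc]]])
  obtain KZ where KZ: "0 \<le> KZ" "KZ < 1" and angle_all: "\<forall>v\<in>Vs. \<forall>z\<in>Z. cmod (sum_form a b 0 v z)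
      \<le> KZ * form_norm (sum_form a b 0) v * form_norm (sum_form a b 0) z"
    using conjunct2[OF conjunct2[OF conjunct2[OF dc]]] by blast
  have angle: "cmod (sum_form a b 0 v z)
      \<le> KZ * form_norm (sum_form a b 0) v * form_norm (sum_form a b 0) z" if "v \<in> Vs" "z \<in> Z" for v z
    using angle_all that by blast
  obtain \<gamma> where \<gamma>: "0 < \<gamma>" and deg_all: "\<forall>\<theta>\<in>\<Theta>. \<forall>w\<in>W_space H a b \<theta>.
      \<gamma> * (norm \<theta>)\<^sup>2 * (form_norm (sum_form a b \<theta>) w)\<^sup>2 \<le> qf (a \<theta>) w"
    using assms(5) unfolding quadratic_degeneracy_def by blast
  have degeneracy: "\<gamma> * (norm \<theta>)\<^sup>2 * (form_norm (sum_form a b \<theta>) w)\<^sup>2 \<le> qf (a \<theta>) w"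
    if "\<theta> \<in> \<Theta>" "w \<in> W_space H a b \<theta>" for \<theta> w
    using deg_all that by blast
  note ar = assms(6)[unfolded a_regularity_def]
  have a'_sesquilinear: "sesquilinear_on (V_space H a 0) H (\<lambda>v u. a' v u $ i)"
    and a''_sesquilinear: "sesquilinear_on (V_space H a 0) (V_space H a 0) (\<lambda>v u. a'' v u $ i $ j)" for i j
    using ar by blast+
  obtain Ka' where Ka': "0 \<le> Ka'" and a'_all: "\<forall>v\<in>V_space H a 0. \<forall>u\<in>H. \<forall>\<theta>\<in>\<Theta>.
        cmod (a \<theta> v u - cdot (a' v u) \<theta>) \<le>
          Ka' * (norm \<theta>)\<^sup>2 * form_norm (sum_form a b 0) v * form_norm (sum_form a b 0) u"
    using ar by blast
  have a'_expansion: "cmod (a \<theta> v u - cdot (a' v u) \<theta>)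
      \<le> Ka' * (norm \<theta>)\<^sup>2 * form_norm (sum_form a b 0) v * form_norm (sum_form a b 0) u"
    if "v \<in> V_space H a 0" "u \<in> H" "\<theta> \<in> \<Theta>" for v u \<theta>
    using a'_all that by blast
  obtain Ka'' where Ka'': "0 \<le> Ka''" and a''_all: "\<forall>v\<in>V_space H a 0. \<forall>u\<in>V_space H a 0. \<forall>\<theta>\<in>\<Theta>.
        cmod (a \<theta> v u - cdot (a'' v u *v cvec \<theta>) \<theta>) \<le>
          Ka'' * (norm \<theta>) ^ 3 * form_norm (sum_form a b 0) v * form_norm (sum_form a b 0) u"
    using ar by blast
  have a''_expansion: "cmod (a \<theta> v u - cdot (a'' v u *v cvec \<theta>) \<theta>)
      \<le> Ka'' * (norm \<theta>) ^ 3 * form_norm (sum_form a b 0) v * form_norm (sum_form a b 0) u"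
    if "v \<in> V_space H a 0" "u \<in> V_space H a 0" "\<theta> \<in> \<Theta>" for v u \<theta>
    using a''_all that by blast
  obtain L2 where L2: "0 \<le> L2" and b_all: "\<forall>v\<in>V_space H a 0. \<forall>u\<in>V_space H a 0. \<forall>\<theta>\<in>\<Theta>.
        cmod (b \<theta> v u - b 0 v u) \<le>
          L2 * norm \<theta> * form_norm (sum_form a b 0) v * form_norm (sum_form a b \<theta>) u"
    using assms(7) unfolding b_regularity_def by blast
  \<comment> \<open>The factor \<open>K\<close> replaces the norm at \<theta> by the norm at
    0.\<close>
  define Lb where "Lb = L2 * K"
  have Lb: "0 \<le> Lb" using L2 K by (simp add: Lb_def)
  have b_expansion: "cmod (b \<theta> v u - b 0 v u)
      \<le> Lb * norm \<theta> * form_norm (sum_form a b 0) v * form_norm (sum_form a b 0) u"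
    if "v \<in> V_space H a 0" "u \<in> V_space H a 0" "\<theta> \<in> \<Theta>" for v u \<theta>
  proof -
    have H: "v \<in> H" "u \<in> H" using that by (auto simp: V_space_def)
    have "cmod (b \<theta> v u - b 0 v u) \<le> L2 * norm \<theta> * form_norm (sum_form a b 0) v * form_norm (sum_form a b \<theta>) u"
      using b_all that by blast
    also have "\<dots> \<le> L2 * norm \<theta> * form_norm (sum_form a b 0) v * (K * form_norm (sum_form a b 0) u)"
      using comparable[OF H(2) that(3) \<Theta>0] L2 H by (intro mult_left_mono) auto
    finally show ?thesis by (simp add: Lb_def mult_ac)
  qed
  note ut = assms(8)[unfolded unitary_transfer_def]
  note ut2 = conjunct2[OF ut]
  note ut3 = conjunct2[OF ut2]
  note ut4 = conjunct2[OF ut3]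
  note ut5 = conjunct2[OF ut4]
  have E_Vs: "bij_betw (E \<theta>) Vs (Vstar_space H a Vs \<theta>)" if "\<theta> \<in> \<Theta>" for \<theta>
    using conjunct1[OF ut] that by blast
  have E_bij: "bij (E \<theta>)" if "\<theta> \<in> \<Theta>" for \<theta>
    using conjunct1[OF ut4] that by blast
  have E_d: "d \<theta> (E \<theta> u) (E \<theta> u') = d 0 u u'" if "\<theta> \<in> \<Theta>" for \<theta> u u'
    using bspec[OF conjunct1[OF ut4] that] by simp
  have E_b: "b \<theta> (E \<theta> v) (E \<theta> v') = b 0 v v'" if "\<theta> \<in> \<Theta>" "v \<in> Vs" "v' \<in> Vs" for \<theta> v v'
    using bspec[OF bspec[OF bspec[OF conjunct1[OF ut2] that(1)] that(2)] that(3)] .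
  obtain Kb where Kb: "0 \<le> Kb" and Kb_all: "\<forall>\<theta>\<in>\<Theta>. \<forall>v\<in>Vs. \<forall>z\<in>Z.
        cmod (b \<theta> (E \<theta> v) z - b 0 v z) \<le>
          Kb * norm \<theta> * form_norm (sum_form a b 0) v * form_norm (sum_form a b 0) z"
    using conjunct1[OF ut3] by blast
  have E_b_Z: "cmod (b \<theta> (E \<theta> v) z - b 0 v z)
      \<le> Kb * norm \<theta> * form_norm (sum_form a b 0) v * form_norm (sum_form a b 0) z"
    if "\<theta> \<in> \<Theta>" "v \<in> Vs" "z \<in> Z" for \<theta> v z
    using Kb_all that by blast
  obtain Ke where Ke: "0 \<le> Ke" and Ke_all: "\<forall>\<theta>\<^sub>1\<in>\<Theta>. \<forall>\<theta>\<^sub>2\<in>\<Theta>. \<forall>u.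
        form_norm (d \<theta>\<^sub>1) (E \<theta>\<^sub>1 u - E \<theta>\<^sub>2 u) \<le> Ke * norm (\<theta>\<^sub>1 - \<theta>\<^sub>2) * form_norm (d 0) u"
    using conjunct2[OF ut5] by blast
  have E0: "E 0 = id" by (rule conjunct1[OF ut5])
  have E_near: "form_norm (d \<theta>) (E \<theta> u - u) \<le> Ke * norm \<theta> * form_norm (d 0) u" if "\<theta> \<in> \<Theta>" for \<theta> u
    using bspec[OF bspec[OF Ke_all that] \<Theta>0] by (simp add: E0)
  interpret homogenisation H \<Theta> a b d Vs Z a' a'' E K La Ls KZ \<nu> \<gamma> Ka' Ka'' Lb Kb Ke r0
    by (rule homogenisation.intro; fact)
  define X0 where "X0 = H0_space ip Vs Z"
  have V0_subspace: "complex_vector.subspace (V_space H a 0)" using \<Theta>0 by (rule V_subspace)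
  interpret M: Metric_space UNIV "form_dist UNIV ip" by (rule ip.metric)
  \<comment> \<open>As a closed subspace for \<open>ip\<close>, \<open>X0\<close> is also complete
    for the equivalent \<open>d 0\<close>.\<close>
  have X0: "hilbert_form X0 (d 0)"
    using hilbertU A.d_equivalent[OF \<Theta>0]
  proof (rule hilbert_form_equivalent)
    show "complex_vector.subspace X0"
      unfolding X0_def H0_space_def V0_eq[symmetric] using V0_subspace by (rule ip.subspace_closure_of) simp
    show "closedin (form_topology UNIV ip) X0" unfolding X0_def H0_space_def by (rule closedin_closure_of)
  qed
  have V0_X0: "V_space H a 0 \<subseteq> X0"
    unfolding X0_def H0_space_def V0_eq[symmetric] by (rule closure_of_subset) (simp add: form_topology_def)
  have L_eq: "L_op H a b d \<epsilon> \<theta> = form_operator UNIV (d \<theta>) H (Q \<epsilon> \<theta>)" for \<epsilon> \<theta>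
    by (simp add: L_op_def Q_def[abs_def])
  have LL_eq: "LL_op ip H a b d a' a'' Vs Z \<xi> = form_operator X0 (d 0) (V_space H a 0) (S \<xi>)" for \<xi>
    by (simp add: LL_op_def X0_def V0_eq)
  show ?thesis
    unfolding L_eq LL_eq X0_def[symmetric] using X0 V0_X0 hilbert_d by (rule spectra_close)
qed

end
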